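(* Let $1\le p_0<\infty$ and let $f$ and $g$ be two positive measurable functions on $\mathbb R^n$ such that, for every $w\in A_{p_0}$, $$\|g\|_{L^{p_0,\infty}(w)}\le \varphi(\|w\|_{A_{p_0}})\,\|f\|_{L^{p_0}(w)},$$ where $\varphi$ is a locally bounded function. Let $0<q<1<p<\infty$, let $u,v$ be weights and assume $v\in L^1(\mathbb R^n)$. If either (a) $(u,v)\in A_{\delta p,\delta q}$ for some $0<\delta<1$, and $M_\mu(v)\in L^{p'}(u^{1-p'})$ for some $0<\mu<1$; or (b) $(u,v)\in A_{p,q}$ and there exists $1<s<p$ such that $M_\mu(v)\in L^{\frac p{p-s}}\big(u^{1-\frac p{p-s}}\big)$ for some $0<\mu<1$, then $$\|g\|_{L^{q,\infty}(v)}\le C\|f\|_{L^p(u)},$$ with $C$ independent of $f$ and $g$ (it may depend on $\varphi$, the weights and the parameters).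
   Context: Weights are positive locally integrable functions on $\mathbb R^n$. $M$ is the Hardy–Littlewood maximal operator $Mf(x)=\sup_{x\in Q}\frac1{|Q|}\int_Q|f|$ (supremum over cubes containing $x$), and for $0<\mu<1$, $M_\mu f=\big(M(|f|^{1/\mu})\big)^\mu$. $\|g\|_{L^{p,\infty}(w)}=\sup_{y>0}y\,w(\{|g|>y\})^{1/p}$. $A_p$ (one index) is the Muckenhoupt class with $\|w\|_{A_p}=\sup_Q\big(\frac1{|Q|}\int_Qw\big)\big(\frac1{|Q|}\int_Qw^{-1/(p-1)}\big)^{p-1}$ for $1<p<\infty$ and $\|w\|_{A_1}=\sup_Q\big(\frac1{|Q|}\int_Qw\big)\|w^{-1}\|_{L^\infty(Q)}$. For $0<p,q<\infty$, $(u,v)\in A_{p,q}$ means that $M:L^p(u)\to L^{q,\infty}(v)$ is bounded. $p'$ is the conjugate exponent of $p$. A function $\varphi$ on $(0,\infty)$ is locally bounded if $\sup_{0<t<K}\varphi(t)<\infty$ for every $K>0$. *)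

theory Defs
  imports "HOL-Analysis.Analysis" "HOL-Probability.Essential_Supremum"
begin

text \<open>Real powers on \<open>[0,\<infinity>]\<close>. Only used with exponents \<open>a > 0\<close>, where \<open>0\<^sup>a = 0\<close>
  and \<open>\<infinity>\<^sup>a = \<infinity>\<close>.\<close>

definition epowr :: "ennreal \<Rightarrow> real \<Rightarrow> ennreal" where
  "epowr x a = (if x = \<infinity> then \<infinity> else ennreal (enn2real x powr a))"

text \<open>Positivity of a weight is understood almost everywhere, so that for instance the power
  weights \<open>norm x powr a\<close> are included regardless of their value at the origin.\<close>

definition weight :: "(real ^ 'n \<Rightarrow> real) \<Rightarrow> bool" where
  "weight w \<longleftrightarrow> w \<in> borel_measurable lebesgue \<and> (AE x in lebesgue. 0 < w x) \<and>
     (\<forall>K. compact K \<longrightarrow> set_integrable lebesgue K w)"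

definition cubes :: "(real ^ 'n) set set" where
  "cubes = {cbox a (\<chi> i. a $ i + l) | a l. 0 < l}"

definition avg :: "(real ^ 'n) set \<Rightarrow> (real ^ 'n \<Rightarrow> ennreal) \<Rightarrow> ennreal" where
  "avg Q F = (\<integral>\<^sup>+x\<in>Q. F x \<partial>lebesgue) / emeasure lebesgue Q"

definition HL_maximal :: "(real ^ 'n \<Rightarrow> real) \<Rightarrow> real ^ 'n \<Rightarrow> ennreal" where
  "HL_maximal f x = (SUP Q\<in>{Q \<in> cubes. x \<in> Q}. avg Q (\<lambda>y. ennreal \<bar>f y\<bar>))"

definition HL_maximal_mu :: "real \<Rightarrow> (real ^ 'n \<Rightarrow> real) \<Rightarrow> real ^ 'n \<Rightarrow> ennreal" where
  "HL_maximal_mu \<mu> f x = epowr (HL_maximal (\<lambda>y. \<bar>f y\<bar> powr (1 / \<mu>)) x) \<mu>"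

text \<open>The (quasi-)norms of \<open>L\<^sup>p(w)\<close> and \<open>L\<^sup>p\<^sup>,\<^sup>\<infinity>(w)\<close> are stated for \<open>[0,\<infinity>]\<close>-valued functions,
  since maximal functions may be infinite; a real-valued function \<open>f\<close> enters through
  \<open>\<lambda>x. ennreal \<bar>f x\<bar>\<close>.\<close>

definition Lp_norm :: "real \<Rightarrow> (real ^ 'n \<Rightarrow> real) \<Rightarrow> (real ^ 'n \<Rightarrow> ennreal) \<Rightarrow> ennreal" where
  "Lp_norm p w F = epowr (\<integral>\<^sup>+x. epowr (F x) p * ennreal (w x) \<partial>lebesgue) (1 / p)"

definition in_Lp :: "real \<Rightarrow> (real ^ 'n \<Rightarrow> real) \<Rightarrow> (real ^ 'n \<Rightarrow> ennreal) \<Rightarrow> bool" where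
  "in_Lp p w F \<longleftrightarrow> F \<in> borel_measurable lebesgue \<and> Lp_norm p w F < \<infinity>"

definition weak_Lp_norm :: "real \<Rightarrow> (real ^ 'n \<Rightarrow> real) \<Rightarrow> (real ^ 'n \<Rightarrow> ennreal) \<Rightarrow> ennreal" where
  "weak_Lp_norm p w G =
     (SUP y\<in>{0<..}. ennreal y * epowr (\<integral>\<^sup>+x\<in>{x. ennreal y < G x}. ennreal (w x) \<partial>lebesgue) (1 / p))"

definition Ap_norm :: "real \<Rightarrow> (real ^ 'n \<Rightarrow> real) \<Rightarrow> ennreal" where
  "Ap_norm p w =
     (if p = 1
      then (SUP Q\<in>cubes. avg Q (\<lambda>x. ennreal (w x)) *
              esssup (lebesgue_on Q) (\<lambda>x. ennreal (1 / w x)))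
      else (SUP Q\<in>cubes. avg Q (\<lambda>x. ennreal (w x)) *
              epowr (avg Q (\<lambda>x. ennreal (w x powr (- 1 / (p - 1))))) (p - 1)))"

definition Ap_class :: "real \<Rightarrow> (real ^ 'n \<Rightarrow> real) set" where
  "Ap_class p = {w. weight w \<and> Ap_norm p w < \<infinity>}"

text \<open>The two-index class: \<open>M : L\<^sup>p(u) \<rightarrow> L\<^sup>q\<^sup>,\<^sup>\<infinity>(v)\<close> is bounded. As \<open>C > 0\<close>, the inequality is
  void for functions \<open>f\<close> outside \<open>L\<^sup>p(u)\<close>.\<close>

definition Apq :: "real \<Rightarrow> real \<Rightarrow> (real ^ 'n \<Rightarrow> real) \<Rightarrow> (real ^ 'n \<Rightarrow> real) \<Rightarrow> bool" where
  "Apq p q u v \<longleftrightarrow>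
     (\<exists>C::real. 0 < C \<and> (\<forall>f \<in> borel_measurable lebesgue.
        weak_Lp_norm q v (HL_maximal f) \<le> ennreal C * Lp_norm p u (\<lambda>x. ennreal \<bar>f x\<bar>)))"

definition locally_bounded :: "(real \<Rightarrow> ennreal) \<Rightarrow> bool" where
  "locally_bounded \<phi> \<longleftrightarrow> (\<forall>K>0. (SUP t\<in>{0<..<K}. \<phi> t) < \<infinity>)"

end

theory Submission
  imports Defs
begin

text \<open>Put \<open>V = M\<^sub>\<mu> v\<close>, which dominates \<open>v\<close> and lies in \<open>A\<^sub>1\<close> by the Coifman-Rochberg theorem, and let
  \<open>r = 1\<close> in case (a), \<open>r = s\<close> and \<open>\<delta> = 1\<close> in case (b). If \<open>r \<le> p0\<close>, let \<open>m\<close> be the power \<open>\<delta>\<close> of the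
  maximal function of \<open>f powr (1 / \<delta>)\<close>. The weight \<open>m powr (r - p0) * V\<close> is in \<open>A\<^sub>p\<^sub>0\<close>, so the hypothesis
  on \<open>f\<close> and \<open>g\<close> bounds the \<open>v\<close>-measure of \<open>{g > y, m \<le> y}\<close> by a multiple of \<open>y powr (- r)\<close> times the
  integral of \<open>f powr r * V\<close>, because \<open>f \<le> m\<close> almost everywhere. Hoelder's inequality and the
  integrability of \<open>V\<close> turn this into \<open>(A / y) powr r\<close>, where \<open>A\<close> is the norm of \<open>f\<close> in \<open>L\<^sup>p(u)\<close>, while
  the measure of \<open>{m > y}\<close> is at most a multiple of \<open>(A / y) powr q\<close> by the boundedness of the maximal
  operator. As \<open>q < 1 \<le> r\<close>, the power \<open>q\<close> prevails for \<open>A \<le> y\<close>, and for \<open>y < A\<close> the total mass of \<open>v\<close>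
  is a sufficient bound. If \<open>p0 < r\<close>, the estimate with exponent \<open>r\<close> is extrapolated from the one with
  exponent \<open>p0\<close> by means of a weight adapted to the level set \<open>{g > y}\<close>.\<close>

section \<open>Powers of extended non-negative reals and the layer cake formula\<close>

text \<open>Cases (a) and (b) are two ways to keep one exponent below 1. For \<open>r < p0\<close>
  the weight of the overview is \<open>V * B powr (1 - p0)\<close>, where \<open>B\<close> is the
  power \<open>\<tau> = (p0 - r) * \<delta> / (p0 - 1)\<close> of the maximal function of
  \<open>f powr (1 / \<delta>)\<close>. Coifman-Rochberg makes such a power an A1 weight for
  \<open>\<tau> < 1\<close>, whereas \<open>r = 1\<close> and \<open>\<delta> = 1\<close> would give
  \<open>\<tau> = 1\<close>. Case (a) lowers \<open>\<delta>\<close>, case (b) raises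
  \<open>r\<close>. The final constant may not depend on \<open>f\<close>, although this weight
  does. The reason why it does not: the A1 constant of \<open>B\<close> depends only on the
  dimension and \<open>\<tau>\<close>, so the norms of all these weights lie in one bounded
  interval, on which \<open>\<phi>\<close> has a single bound. Maximal functions are treated for a
  general doubling measure because the case \<open>p0 < r\<close> needs them with respect to
  \<open>V dx\<close>.\<close>

lemma epowr_ennreal: "0 \<le> r \<Longrightarrow> epowr (ennreal r) a = ennreal (r powr a)"
  by (simp add: epowr_def)

lemma epowr_top [simp]: "epowr top a = top"
  by (simp add: epowr_def)

lemma epowr_0 [simp]: "epowr 0 a = 0"
  by (simp add: epowr_def)

lemma epowr_1 [simp]: "epowr x 1 = x"
  by (simp add: epowr_def less_top[symmetric])

lemma epowr_one [simp]: "epowr 1 a = 1"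
  by (simp add: epowr_def)

lemma epowr_mono:
  assumes "x \<le> y" "0 \<le> a"
  shows "epowr x a \<le> epowr y a"
proof (cases "y = \<infinity>")
  case False
  then have "x \<noteq> \<infinity>" using assms by (auto simp: top_unique)
  with False show ?thesis
    using assms by (auto simp: epowr_def intro!: ennreal_leI powr_mono2 enn2real_mono simp: less_top[symmetric])
qed simp

lemma epowr_epowr: "epowr (epowr x a) b = epowr x (a * b)"
  by (simp add: epowr_def powr_powr)

lemma epowr_le_iff:
  assumes "0 < a"
  shows "epowr x a \<le> y \<longleftrightarrow> x \<le> epowr y (1 / a)"
proof
  assume "epowr x a \<le> y"
  from epowr_mono[OF this, of "1 / a"] assms show "x \<le> epowr y (1 / a)"
    by (simp add: epowr_epowr)
next
  assume "x \<le> epowr y (1 / a)"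
  from epowr_mono[OF this, of a] assms show "epowr x a \<le> y"
    by (simp add: epowr_epowr)
qed

lemma epowr_mult:
  assumes "0 < a"
  shows "epowr (x * y) a = epowr x a * epowr y a"
proof (cases "x = \<infinity> \<or> y = \<infinity>")
  case True
  \<comment> \<open>With an infinite factor the product is infinite or 0, according to whether the
    other factor vanishes. \<open>epowr\<close> preserves this distinction because it vanishes only
    at 0.\<close>
  have *: "epowr z a = 0 \<longleftrightarrow> z = 0" for z
    by (cases z) (auto simp: epowr_def)
  show ?thesis
  proof (cases "x * y = 0")
    case False
    with True have "x * y = \<infinity>" "epowr x a * epowr y a = \<infinity>"
      by (auto simp: ennreal_mult_eq_top_iff *)
    then show ?thesis by simp
  next
    case True
    then have "x = 0 \<or> y = 0" by simp
    then show ?thesis by (elim disjE) simp_all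
  qed
next
  case False
  define r s where "r = enn2real x" and "s = enn2real y"
  have rs: "x = ennreal r" "0 \<le> r" "y = ennreal s" "0 \<le> s"
    using False unfolding r_def s_def by (simp_all add: less_top)
  have "epowr (x * y) a = epowr (ennreal (r * s)) a"
    using rs by (simp add: ennreal_mult)
  also have "\<dots> = ennreal (r powr a) * ennreal (s powr a)"
    using rs(2,4) by (subst epowr_ennreal) (simp_all add: powr_mult ennreal_mult)
  finally show ?thesis
    using rs by (simp add: epowr_ennreal)
qed

lemma measurable_epowr [measurable]:
  assumes [measurable]: "f \<in> borel_measurable M"
  shows "(\<lambda>x. epowr (f x) a) \<in> borel_measurable M"
  unfolding epowr_def by measurable

section \<open>Integrals over levels and the layer cake formula\<close>

lemma has_integral_rescaled_powr:
  fixes k X :: real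
  assumes "0 < k" "0 \<le> X"
  shows "((\<lambda>t. k * t powr (k - 1)) has_integral X powr k) {0..X}"
  using has_integral_mult_right[OF has_integral_powr_from_0[of "k - 1" X], of k] assms
  by simp

lemma nn_integral_powr_0:
  fixes k X :: real
  assumes "0 < k" "0 \<le> X"
  shows "(\<integral>\<^sup>+t\<in>{0<..<X}. ennreal (k * t powr (k - 1)) \<partial>lborel) = ennreal (X powr k)"
proof -
  have "(\<integral>\<^sup>+t\<in>{0<..<X}. ennreal (k * t powr (k - 1)) \<partial>lborel) =
      (\<integral>\<^sup>+t. ennreal (indicator {0..X} t * (k * t powr (k - 1))) \<partial>lborel)"
    by (intro nn_integral_cong_AE)
      (use AE_lborel_singleton[of 0] AE_lborel_singleton[of X] in
        \<open>eventually_elim, auto simp: indicator_def\<close>)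
  also have "\<dots> = ennreal (X powr k)"
  proof (rule nn_integral_has_integral_lborel)
    have "((\<lambda>t. if t \<in> {0..X} then k * t powr (k - 1) else 0) has_integral X powr k) UNIV"
      using has_integral_rescaled_powr[OF assms] by (simp only: has_integral_restrict_UNIV)
    then show "((\<lambda>t. indicator {0..X} t * (k * t powr (k - 1))) has_integral X powr k) UNIV"
      by (rule has_integral_eq[rotated]) (auto simp: indicator_def)
  qed (use assms in \<open>auto simp: indicator_def\<close>)
  finally show ?thesis .
qed

lemma nn_integral_powr_tail:
  fixes k X :: real
  assumes "k < 1" "0 < X"
  shows "(\<integral>\<^sup>+t\<in>{X..}. ennreal (t powr (k - 2)) \<partial>lborel) = ennreal (X powr (k - 1) / (1 - k))"
proof -
  have "(\<integral>\<^sup>+t\<in>{X..}. ennreal (t powr (k - 2)) \<partial>lborel) =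
      (\<integral>\<^sup>+t. ennreal (indicator {X..} t * t powr (k - 2)) \<partial>lborel)"
    by (intro nn_integral_cong) (auto simp: indicator_def)
  also have "\<dots> = ennreal (X powr (k - 1) / (1 - k))"
  proof (rule nn_integral_has_integral_lborel)
    have "((\<lambda>t. t powr (k - 2)) has_integral X powr (k - 1) / (1 - k)) {X..}"
      using has_integral_powr_to_inf[of "k - 2" X] assms
      by (simp add: minus_divide_right)
    then have "((\<lambda>t. if t \<in> {X..} then t powr (k - 2) else 0) has_integral X powr (k - 1) / (1 - k)) UNIV"
      by (simp only: has_integral_restrict_UNIV)
    then show "((\<lambda>t. indicator {X..} t * t powr (k - 2)) has_integral X powr (k - 1) / (1 - k)) UNIV"
      by (rule has_integral_eq[rotated]) (auto simp: indicator_def)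
  qed (use assms in \<open>auto simp: indicator_def\<close>)
  finally show ?thesis .
qed

lemma epowr_eq_nn_integral:
  assumes "0 < k"
  shows "epowr X k = (\<integral>\<^sup>+t\<in>{0<..}. ennreal (k * t powr (k - 1)) * indicator {t. ennreal t < X} t \<partial>lborel)"
proof (cases X)
  case (real r)
  then have "(\<integral>\<^sup>+t\<in>{0<..}. ennreal (k * t powr (k - 1)) * indicator {t. ennreal t < X} t \<partial>lborel)
      = (\<integral>\<^sup>+t\<in>{0<..<r}. ennreal (k * t powr (k - 1)) \<partial>lborel)"
    by (intro nn_integral_cong) (auto simp: indicator_def ennreal_less_iff)
  with real nn_integral_powr_0[OF assms] show ?thesis
    by (simp add: epowr_ennreal)
next
  case top
  have le: "ennreal (Y powr k) \<le> (\<integral>\<^sup>+t\<in>{0<..}. ennreal (k * t powr (k - 1)) \<partial>lborel)" if "0 \<le> Y" for Y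
    unfolding nn_integral_powr_0[OF assms that, symmetric]
    by (intro nn_integral_mono) (auto simp: indicator_def)
  \<comment> \<open>The truncation at \<open>Y = n powr (1 / k)\<close> has integral exactly
    \<open>n\<close>, so the full integral exceeds every natural number.\<close>
  have "ennreal (real n) \<le> (\<integral>\<^sup>+t\<in>{0<..}. ennreal (k * t powr (k - 1)) \<partial>lborel)" for n
    using le[of "real n powr (1 / k)"] assms by (cases "n = 0") (simp_all add: powr_powr)
  then have "(\<integral>\<^sup>+t\<in>{0<..}. ennreal (k * t powr (k - 1)) \<partial>lborel) = \<infinity>"
    unfolding infinity_ennreal_def
    by (intro top_unique[THEN iffD1] order.trans[OF eq_refl[OF ennreal_SUP_of_nat_eq_top[symmetric]]] SUP_least) (simp add: ennreal_of_nat_eq_real_of_nat)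
  with top show ?thesis by simp
qed

text \<open>The power is the integral of \<open>k * t powr (k - 1)\<close> over the levels
  \<open>t\<close> below \<open>X x\<close>; Tonelli's theorem then swaps the two integrals, which
  is what sigma-finiteness of \<open>M\<close> is for.\<close>

lemma nn_integral_epowr_layer_cake:
  assumes "sigma_finite_measure M" and k: "0 < k"
    and [measurable]: "X \<in> borel_measurable M" "S \<in> sets M"
  shows "(\<integral>\<^sup>+x\<in>S. epowr (X x) k \<partial>M) =
    (\<integral>\<^sup>+t\<in>{0<..}. ennreal (k * t powr (k - 1)) * emeasure M {x \<in> S. ennreal t < X x} \<partial>lborel)"
proof -
  interpret sigma_finite_measure M by fact
  interpret pair_sigma_finite lborel M
    by (simp add: lborel.sigma_finite_measure_axioms pair_sigma_finite.intro sigma_finite_measure_axioms)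
  have sub: "S \<subseteq> space M" by (rule sets.sets_into_space) measurable
  have "(\<integral>\<^sup>+x\<in>S. epowr (X x) k \<partial>M) = (\<integral>\<^sup>+x. \<integral>\<^sup>+t. ennreal (k * t powr (k - 1)) *
      indicator {0<..} t * indicator {t. ennreal t < X x} t * indicator S x \<partial>lborel \<partial>M)"
    unfolding epowr_eq_nn_integral[OF k]
    by (intro nn_integral_cong) (auto simp: indicator_def intro!: nn_integral_cong)
  also have "\<dots> = (\<integral>\<^sup>+t. \<integral>\<^sup>+x. ennreal (k * t powr (k - 1)) *
      indicator {0<..} t * indicator {t. ennreal t < X x} t * indicator S x \<partial>M \<partial>lborel)"
    by (rule Fubini') measurable
  also have "\<dots> = (\<integral>\<^sup>+t\<in>{0<..}. ennreal (k * t powr (k - 1)) * emeasure M {x \<in> S. ennreal t < X x} \<partial>lborel)"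
  proof (intro nn_integral_cong)
    fix t :: real
    have [measurable]: "{x \<in> S. ennreal t < X x} \<in> sets M"
    proof -
      have "{x \<in> S. ennreal t < X x} = S \<inter> {x \<in> space M. ennreal t < X x}"
        using sub by auto
      also have "\<dots> \<in> sets M" by measurable
      finally show ?thesis .
    qed
    have "(\<integral>\<^sup>+x. ennreal (k * t powr (k - 1)) *
      indicator {0<..} t * indicator {t. ennreal t < X x} t * indicator S x \<partial>M) =
      (\<integral>\<^sup>+x. (ennreal (k * t powr (k - 1)) * indicator {0<..} t) * indicator {x \<in> S. ennreal t < X x} x \<partial>M)"
      by (intro nn_integral_cong) (auto simp: indicator_def)
    also have "\<dots> = (ennreal (k * t powr (k - 1)) * indicator {0<..} t) * emeasure M {x \<in> S. ennreal t < X x}"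
      by (rule nn_integral_cmult_indicator) measurable
    finally show "(\<integral>\<^sup>+x. ennreal (k * t powr (k - 1)) *
      indicator {0<..} t * indicator {t. ennreal t < X x} t * indicator S x \<partial>M) =
      ennreal (k * t powr (k - 1)) * emeasure M {x \<in> S. ennreal t < X x} * indicator {0<..} t"
      by (simp add: mult_ac)
  qed
  finally show ?thesis .
qed

section \<open>Cubes\<close>

text \<open>Corner and side length are separate arguments because Vitali's selection compares side
  lengths and works with a finite set of pairs.\<close>

definition cube :: "real ^ 'n \<Rightarrow> real \<Rightarrow> (real ^ 'n) set" where
  "cube a l = cbox a (\<chi> i. a $ i + l)"

definition cube3 :: "real ^ 'n \<Rightarrow> real \<Rightarrow> (real ^ 'n) set" where
  "cube3 a l = cube (\<chi> i. a $ i - l) (3 * l)"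

lemma mem_cube: "x \<in> cube a l \<longleftrightarrow> (\<forall>i. a $ i \<le> x $ i \<and> x $ i \<le> a $ i + l)"
  by (simp add: cube_def mem_box_cart)

lemma mem_cube3: "x \<in> cube3 a l \<longleftrightarrow> (\<forall>i. a $ i - l \<le> x $ i \<and> x $ i \<le> a $ i + 2 * l)"
  by (simp add: cube3_def mem_cube algebra_simps)

lemma mem_interior_cube: "x \<in> interior (cube a l) \<longleftrightarrow> (\<forall>i. a $ i < x $ i \<and> x $ i < a $ i + l)"
  by (simp add: cube_def mem_box_cart)

lemma cubes_iff: "Q \<in> cubes \<longleftrightarrow> (\<exists>a l. Q = cube a l \<and> 0 < l)"
  by (auto simp: cubes_def cube_def)

lemma cube_in_cubes [intro, simp]: "0 < l \<Longrightarrow> cube a l \<in> cubes"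
  by (auto simp: cubes_iff)

lemma cube3_in_cubes [intro, simp]: "0 < l \<Longrightarrow> cube3 a l \<in> cubes"
  by (simp add: cube3_def)

lemma cube_subset_cube3: "0 < l \<Longrightarrow> cube a l \<subseteq> cube3 a l"
  unfolding mem_cube mem_cube3 subset_iff by (smt (verit))

lemma cubes_lebesgue [simp]: "Q \<in> cubes \<Longrightarrow> Q \<in> sets lebesgue"
  by (auto simp: cubes_def)

lemma cube3_lebesgue [simp]: "cube3 a l \<in> sets lebesgue"
  by (simp add: cube3_def cube_def)

lemma emeasure_cube: "0 < l \<Longrightarrow> emeasure lebesgue (cube (a :: real ^ 'n) l) = ennreal (l ^ CARD('n))"
proof -
  assume "0 < l"
  then have "cbox a (\<chi> i. a $ i + l) \<noteq> {}"
    by (auto simp: interval_ne_empty_cart less_imp_le)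
  then have "measure lborel (cube a l) = l ^ CARD('n)"
    by (simp add: cube_def content_cbox_cart)
  then show ?thesis
    using emeasure_eq_measure2[of "cube a l" lebesgue] by (simp add: cube_def lmeasurable_cbox)
qed

lemma bounded_subset_interior_cube:
  assumes "bounded (S :: (real ^ 'n) set)"
  obtains a l where "0 < l" "S \<subseteq> interior (cube a l)"
proof -
  obtain r where r: "0 < r" "\<And>x. x \<in> S \<Longrightarrow> norm x \<le> r"
    using assms by (auto simp: bounded_pos)
  have "S \<subseteq> interior (cube (\<chi> i. - r - 1) (2 * r + 2))"
  proof
    fix x assume "x \<in> S"
    have "\<bar>x $ i\<bar> \<le> r" for i
      using component_le_norm_cart[of x i] r(2)[OF \<open>x \<in> S\<close>] by linarith
    then have "- r - 1 < x $ i \<and> x $ i < r + 1" for i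
      by (smt (verit, best))
    then show "x \<in> interior (cube (\<chi> i. - r - 1) (2 * r + 2))"
      by (simp add: mem_interior_cube)
  qed
  then show thesis
    using r by (intro that[of "2 * r + 2"]) auto
qed

text \<open>A cube that meets \<open>cube a l\<close> and leaves its triple has to cross a collar of
  width \<open>l\<close>, so it is longer than \<open>l\<close>, and its own triple swallows
  \<open>cube a l\<close>. This is the geometric input of the Coifman-Rochberg estimate.\<close>

lemma cube_subset_cube3_if_not_subset:
  fixes a b :: "real ^ 'n"
  assumes "z \<in> cube a l" "z \<in> cube b k" "x \<in> cube a l" "\<not> cube b k \<subseteq> cube3 a l"
  shows "x \<in> cube3 b k"
proof -
  from assms obtain w where w: "w \<in> cube b k" "w \<notin> cube3 a l" by auto
  then obtain i where "w $ i < a $ i - l \<or> a $ i + 2 * l < w $ i"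
    by (auto simp: mem_cube3 not_le)
  with assms w have "l < k"
    unfolding mem_cube by (smt (verit))
  with assms show ?thesis
    unfolding mem_cube mem_cube3 by (smt (verit))
qed

lemma cube_subset_cube3_if_inter:
  fixes a b :: "real ^ 'n"
  assumes "z \<in> cube a l" "z \<in> cube b k" "k \<le> l"
  shows "cube b k \<subseteq> cube3 a l"
  using assms unfolding mem_cube mem_cube3 subset_iff by (smt (verit))

text \<open>Greedy selection: keep a cube of maximal side, drop every cube that meets it (all of
  these lie in its triple), and continue with the rest.\<close>

lemma finite_Vitali_covering:
  fixes A :: "((real ^ 'n) \<times> real) set"
  assumes "finite A"
  shows "\<exists>B \<subseteq> A. disjoint_family_on (\<lambda>(a, l). cube a l) B \<and>
    (\<Union>(a, l)\<in>A. cube a l) \<subseteq> (\<Union>(a, l)\<in>B. cube3 a l)"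
  using assms
proof (induction "card A" arbitrary: A rule: less_induct)
  case less
  show ?case
  proof (cases "A = {}")
    case False
    obtain m where m: "m \<in> A" "\<And>x. x \<in> A \<Longrightarrow> snd x \<le> snd m"
      using Max_in[of "snd ` A"] Max_ge[of "snd ` A"] less.prems False
      by (metis (no_types, lifting) empty_is_image finite_imageI image_iff)
    obtain a l where al: "m = (a, l)" by force
    \<comment> \<open>Removing \<open>m\<close> explicitly matters: the sides are arbitrary reals
      here, and an empty cube is disjoint from itself, so the family would not shrink.\<close>
    define A' where "A' = {(b, k). (b, k) \<in> A \<and> cube b k \<inter> cube a l = {}} - {m}"
    have "A' \<subset> A" using m by (auto simp: A'_def)
    then have "card A' < card A" "finite A'"
      using less.prems by (auto intro: psubset_card_mono finite_subset)
    from less.hyps[OF this] obtain B where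
      B: "B \<subseteq> A'" "disjoint_family_on (\<lambda>(a, l). cube a l) B"
        "(\<Union>(a, l)\<in>A'. cube a l) \<subseteq> (\<Union>(a, l)\<in>B. cube3 a l)" by blast
    have "m \<notin> B" using B by (auto simp: A'_def)
    have sub: "cube b k \<subseteq> cube3 a l" if "(b, k) \<in> A" "(b, k) \<notin> A'" for b k
    proof (cases "cube b k \<inter> cube a l = {}")
      case True
      with that have "(b, k) = (a, l)" by (auto simp: A'_def al)
      with True show ?thesis by auto
    next
      case False
      with that m(2)[of "(b, k)"] show ?thesis
        using cube_subset_cube3_if_inter[of _ a l b k] by (auto simp: al)
    qed
    show ?thesis
    proof (intro exI[of _ "insert m B"] conjI)
      show "insert m B \<subseteq> A" using B m \<open>A' \<subset> A\<close> by auto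
      show "disjoint_family_on (\<lambda>(a, l). cube a l) (insert m B)"
        unfolding disjoint_family_on_insert[OF \<open>m \<notin> B\<close>]
        using B by (auto simp: al A'_def)
      show "(\<Union>(a, l)\<in>A. cube a l) \<subseteq> (\<Union>(a, l)\<in>insert m B. cube3 a l)"
      proof clarify
        fix x b k assume x: "(b, k) \<in> A" "x \<in> cube b k"
        show "x \<in> (\<Union>(a, l)\<in>insert m B. cube3 a l)"
        proof (cases "(b, k) \<in> A'")
          case True
          with x B show ?thesis by auto
        next
          case False
          with sub[OF x(1)] x show ?thesis by (auto simp: al)
        qed
      qed
    qed
  qed (simp add: disjoint_family_on_def)
qed

section \<open>The maximal function of a doubling measure\<close>

lemma ennreal_divide_le_iff:
  fixes b :: ennreal
  assumes "0 < b" "b < top"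
  shows "a / b \<le> c \<longleftrightarrow> a \<le> c * b"
proof
  assume "a / b \<le> c"
  from mult_right_mono[OF this, of b] assms show "a \<le> c * b"
    by (simp add: ennreal_divide_times)
next
  assume "a \<le> c * b"
  from divide_right_mono_ennreal[OF this, of b] assms show "a / b \<le> c"
    by (simp add: mult_divide_eq_ennreal)
qed

text \<open>The averages are taken in the measure \<open>N\<close>. Lebesgue measure gives the
  Hardy-Littlewood operator; the extrapolation argument uses \<open>V dx\<close>.\<close>

definition maximal_wrt :: "(real ^ 'n) measure \<Rightarrow> (real ^ 'n \<Rightarrow> ennreal) \<Rightarrow> real ^ 'n \<Rightarrow> ennreal" where
  "maximal_wrt N F x = (SUP Q\<in>{Q \<in> cubes. x \<in> Q}. (\<integral>\<^sup>+y\<in>Q. F y \<partial>N) / emeasure N Q)"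

text \<open>The intended instances are Lebesgue measure and \<open>V dx\<close> with an A1 weight
  \<open>V\<close>. Doubling is stated for \<open>cube3\<close> because tripling is the enlargement
  that the covering arguments use. Absolute continuity makes Lebesgue null sets, such as boundaries
  of cubes, null for \<open>N\<close>.\<close>

locale doubling_measure =
  fixes N :: "(real ^ 'n) measure" and D :: real
  assumes sets_N [simp, measurable_cong]: "sets N = sets lebesgue"
    and abs_cont: "absolutely_continuous lebesgue N"
    and emeasure_cubes_finite: "Q \<in> cubes \<Longrightarrow> emeasure N Q < \<infinity>"
    and emeasure_cubes_pos: "Q \<in> cubes \<Longrightarrow> 0 < emeasure N Q"
    and doubling: "0 < l \<Longrightarrow> emeasure N (cube3 a l) \<le> ennreal D * emeasure N (cube a l)"
begin

lemma space_N [simp]: "space N = UNIV"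
  using sets_eq_imp_space_eq[OF sets_N] by simp

lemma borel_measurable_N: "borel_measurable N = borel_measurable lebesgue"
  by (intro measurable_cong_sets) simp_all

lemma open_in_sets_N: "open S \<Longrightarrow> S \<in> sets N"
  by simp

lemma sigma_finite_N: "sigma_finite_measure N"
proof
  let ?A = "range (\<lambda>n::nat. cube (\<chi> i. - real (Suc n)) (2 * real (Suc n)) :: (real ^ 'n) set)"
  have "x \<in> \<Union> ?A" for x :: "real ^ 'n"
  proof -
    obtain n where n: "norm x \<le> real n" using real_arch_simple by blast
    have "- real (Suc n) \<le> x $ i \<and> x $ i \<le> real (Suc n)" for i
      using component_le_norm_cart[of x i] n by auto
    then have "x \<in> cube (\<chi> i. - real (Suc n)) (2 * real (Suc n))"
      by (simp add: mem_cube)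
    then show ?thesis by blast
  qed
  moreover have "emeasure N Q \<noteq> \<infinity>" if "Q \<in> ?A" for Q
    using that emeasure_cubes_finite[of Q] by auto
  ultimately show "\<exists>A. countable A \<and> A \<subseteq> sets N \<and> \<Union>A = space N \<and> (\<forall>a\<in>A. emeasure N a \<noteq> \<infinity>)"
    by (intro exI[of _ ?A]) auto
qed

lemma less_div_iff:
  assumes "Q \<in> cubes"
  shows "t < I / emeasure N Q \<longleftrightarrow> t * emeasure N Q < I"
  using ennreal_divide_le_iff[OF emeasure_cubes_pos[OF assms], of I t] emeasure_cubes_finite[OF assms]
  by (simp add: not_le[symmetric])

lemma maximal_geD:
  assumes "Q \<in> cubes" "x \<in> Q"
  shows "(\<integral>\<^sup>+y\<in>Q. F y \<partial>N) \<le> maximal_wrt N F x * emeasure N Q"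
proof -
  have "\<not> maximal_wrt N F x < (\<integral>\<^sup>+y\<in>Q. F y \<partial>N) / emeasure N Q"
    unfolding maximal_wrt_def not_less using assms by (auto intro: SUP_upper2)
  then show ?thesis
    using less_div_iff[OF assms(1)] by (simp add: not_less)
qed

lemma maximal_lessI:
  assumes "Q \<in> cubes" "x \<in> Q" "t * emeasure N Q < (\<integral>\<^sup>+y\<in>Q. F y \<partial>N)"
  shows "t < maximal_wrt N F x"
  unfolding maximal_wrt_def less_SUP_iff using assms less_div_iff[OF assms(1)] by auto

lemma maximal_le_imp:
  assumes "\<And>Q. Q \<in> cubes \<Longrightarrow> x \<in> Q \<Longrightarrow> (\<integral>\<^sup>+y\<in>Q. F y \<partial>N) \<le> t * emeasure N Q"
  shows "maximal_wrt N F x \<le> t"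
  unfolding maximal_wrt_def
  by (intro SUP_least) (use assms less_div_iff in \<open>auto simp: not_less[symmetric]\<close>)

lemma maximal_lessE:
  assumes "t < maximal_wrt N F x"
  obtains a l where "0 < l" "x \<in> cube a l" "t * emeasure N (cube a l) < (\<integral>\<^sup>+y\<in>cube a l. F y \<partial>N)"
  using assms less_div_iff unfolding maximal_wrt_def less_SUP_iff by (auto simp: cubes_iff)

text \<open>The cubes are closed, so \<open>x\<close> may sit on the boundary. Slightly larger
  concentric cubes decrease to the given one, and by continuity from above the strict inequality
  survives for one of them, which has \<open>x\<close> in its interior. Openness of the level sets,
  and with it measurability, rests on this.\<close>

lemma maximal_less_interiorE:
  assumes "t < maximal_wrt N F x"
  obtains a l where "0 < l" "x \<in> interior (cube a l)"
    "t * emeasure N (cube a l) < (\<integral>\<^sup>+y\<in>cube a l. F y \<partial>N)"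
proof -
  obtain a l where Q: "0 < l" "x \<in> cube a l"
    "t * emeasure N (cube a l) < (\<integral>\<^sup>+y\<in>cube a l. F y \<partial>N)"
    using maximal_lessE[OF assms] by blast
  define e where "e n = inverse (real (Suc n))" for n
  have e0: "0 < e n" for n by (simp add: e_def)
  define R where "R n = cube (\<chi> i. a $ i - e n) (l + 2 * e n)" for n
  have RQ: "R n \<in> cubes" for n using Q e0[of n] by (auto simp: R_def)
  have mem: "y \<in> R n \<longleftrightarrow> (\<forall>i. a $ i - e n \<le> y $ i \<and> y $ i \<le> a $ i + l + e n)" for y n
    by (simp add: R_def mem_cube algebra_simps)
  have sub: "cube a l \<subseteq> R n" for n
    using e0[of n] unfolding subset_iff mem mem_cube by (smt (verit))
  have "decseq R"
  proof (intro decseq_SucI)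
    fix n have "e (Suc n) \<le> e n" by (simp add: e_def field_simps)
    then show "R (Suc n) \<subseteq> R n"
      unfolding subset_iff mem by (smt (verit))
  qed
  have Int: "(\<Inter>n. R n) = cube a l"
  proof
    show "(\<Inter>n. R n) \<subseteq> cube a l"
    proof
      fix y assume y: "y \<in> (\<Inter>n. R n)"
      have lim: "e \<longlonglongrightarrow> 0" unfolding e_def by (rule LIMSEQ_inverse_real_of_nat)
      have "a $ i \<le> y $ i \<and> y $ i \<le> a $ i + l" for i
      proof
        have "(\<lambda>n. a $ i - e n) \<longlonglongrightarrow> a $ i - 0" by (intro tendsto_intros lim)
        then show "a $ i \<le> y $ i"
          using y by (intro LIMSEQ_le_const2[of "\<lambda>n. a $ i - e n"]) (auto simp: mem)
        have "(\<lambda>n. a $ i + l + e n) \<longlonglongrightarrow> a $ i + l + 0" by (intro tendsto_intros lim)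
        then show "y $ i \<le> a $ i + l"
          using y by (intro LIMSEQ_le_const[of "\<lambda>n. a $ i + l + e n"]) (auto simp: mem)
      qed
      then show "y \<in> cube a l" by (simp add: mem_cube)
    qed
  qed (use sub in blast)
  have "(\<lambda>n. emeasure N (R n)) \<longlonglongrightarrow> emeasure N (\<Inter>n. R n)"
    using RQ emeasure_cubes_finite \<open>decseq R\<close>
    by (intro Lim_emeasure_decseq) (auto simp: less_top)
  then have "(\<lambda>n. t * emeasure N (R n)) \<longlonglongrightarrow> t * emeasure N (cube a l)"
    unfolding Int using assms by (intro tendsto_intros ennreal_tendsto_cmult) (auto intro: less_le_trans simp: less_top[symmetric])
  from order_tendstoD(2)[OF this Q(3)] obtain n
    where n: "t * emeasure N (R n) < (\<integral>\<^sup>+y\<in>cube a l. F y \<partial>N)"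
    by (auto simp: eventually_sequentially)
  also have "\<dots> \<le> (\<integral>\<^sup>+y\<in>R n. F y \<partial>N)"
    using sub[of n] by (intro nn_integral_mono) (auto simp: indicator_def)
  finally have *: "t * emeasure N (R n) < (\<integral>\<^sup>+y\<in>R n. F y \<partial>N)" .
  have "a $ i - e n < x $ i \<and> x $ i < a $ i + l + e n" for i
    using Q(2) e0[of n] unfolding mem_cube by (smt (verit))
  then have **: "x \<in> interior (R n)"
    by (simp add: R_def mem_interior_cube add_ac less_diff_eq diff_less_eq)
  have "0 < l + 2 * e n"
    using Q(1) e0[of n] by linarith
  then show thesis
    by (rule that[OF _ **[unfolded R_def] *[unfolded R_def]])
qed

section \<open>Level sets of the maximal function and the weak type inequality\<close>

lemma open_maximal_less: "open {x. t < maximal_wrt N F x}"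
proof (subst open_subopen, clarify)
  fix x assume "t < maximal_wrt N F x"
  from maximal_less_interiorE[OF this] obtain a l where
    "0 < l" "x \<in> interior (cube a l)" "t * emeasure N (cube a l) < (\<integral>\<^sup>+y\<in>cube a l. F y \<partial>N)" .
  then show "\<exists>T. open T \<and> x \<in> T \<and> T \<subseteq> {x. t < maximal_wrt N F x}"
    by (intro exI[of _ "interior (cube a l)"])
      (auto intro!: maximal_lessI[of "cube a l"] dest: interior_subset[THEN subsetD])
qed

lemma borel_measurable_maximal [measurable]: "maximal_wrt N F \<in> borel_measurable lebesgue"
proof -
  have "maximal_wrt N F \<in> borel_measurable borel"
    by (rule borel_measurableI_greater) (use open_maximal_less in auto)
  then show ?thesis
    by (intro measurable_completion) simp
qed

text \<open>The interiors of the cubes with average above \<open>t\<close> cover \<open>K\<close>.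
  Compactness and Vitali's selection leave finitely many disjoint ones whose triples cover
  \<open>K\<close>; tripling costs the factor \<open>D\<close>, and by disjointness the integrals
  add up to at most the integral over the whole space.\<close>

lemma weak_type_compact:
  assumes "compact K" "K \<subseteq> {x. t < maximal_wrt N F x}" and [measurable]: "F \<in> borel_measurable lebesgue"
  shows "t * emeasure N K \<le> ennreal D * (\<integral>\<^sup>+y. F y \<partial>N)"
proof -
  define P where "P = {p. 0 < snd p \<and> t * emeasure N (cube (fst p) (snd p)) < (\<integral>\<^sup>+y\<in>cube (fst p) (snd p). F y \<partial>N)}"
  have "K \<subseteq> (\<Union>p\<in>P. interior (cube (fst p) (snd p)))"
  proof
    fix x assume "x \<in> K"
    with assms have "t < maximal_wrt N F x" by auto
    from maximal_less_interiorE[OF this] obtain a l where "(a, l) \<in> P" "x \<in> interior (cube a l)"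
      unfolding P_def mem_Collect_eq fst_conv snd_conv by blast
    then show "x \<in> (\<Union>p\<in>P. interior (cube (fst p) (snd p)))"
      by (intro UN_I[of "(a, l)"]) simp_all
  qed
  then obtain A where A: "A \<subseteq> P" "finite A" "K \<subseteq> (\<Union>p\<in>A. interior (cube (fst p) (snd p)))"
    using compactE_image[OF assms(1), of P "\<lambda>p. interior (cube (fst p) (snd p))"] by auto
  from finite_Vitali_covering[OF A(2)] obtain B where
    B: "B \<subseteq> A" "disjoint_family_on (\<lambda>(a, l). cube a l) B"
      "(\<Union>(a, l)\<in>A. cube a l) \<subseteq> (\<Union>(a, l)\<in>B. cube3 a l)" by blast
  have BP: "0 < snd p" "t * emeasure N (cube (fst p) (snd p)) < (\<integral>\<^sup>+y\<in>cube (fst p) (snd p). F y \<partial>N)"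
    if "p \<in> B" for p
    using that A(1) B(1) unfolding P_def by blast+
  have [simp]: "finite B" using A B finite_subset by auto
  have sub: "(\<Union>p\<in>A. interior (cube (fst p) (snd p))) \<subseteq> (\<Union>p\<in>A. cube (fst p) (snd p))"
    by (intro UN_mono interior_subset order_refl)
  have "K \<subseteq> (\<Union>p\<in>B. cube3 (fst p) (snd p))"
    using order_trans[OF A(3) order_trans[OF sub]] B(3) unfolding case_prod_beta by this
  then have "emeasure N K \<le> emeasure N (\<Union>p\<in>B. cube3 (fst p) (snd p))"
    by (intro emeasure_mono) auto
  also have "\<dots> \<le> (\<Sum>p\<in>B. emeasure N (cube3 (fst p) (snd p)))"
    by (intro emeasure_subadditive_finite) auto
  also have "\<dots> \<le> (\<Sum>p\<in>B. ennreal D * emeasure N (cube (fst p) (snd p)))"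
    by (intro sum_mono doubling BP)
  finally have "t * emeasure N K \<le> t * (\<Sum>p\<in>B. ennreal D * emeasure N (cube (fst p) (snd p)))"
    by (rule mult_left_mono) simp
  also have "\<dots> = ennreal D * (\<Sum>p\<in>B. t * emeasure N (cube (fst p) (snd p)))"
    by (simp add: sum_distrib_left mult_ac)
  also have "\<dots> \<le> ennreal D * (\<Sum>p\<in>B. \<integral>\<^sup>+y\<in>cube (fst p) (snd p). F y \<partial>N)"
    by (intro mult_left_mono sum_mono less_imp_le[OF BP(2)]) auto
  also have "(\<Sum>p\<in>B. \<integral>\<^sup>+y\<in>cube (fst p) (snd p). F y \<partial>N) = (\<Sum>p\<in>B. emeasure (density N F) (cube (fst p) (snd p)))"
    using BP(1) by (intro sum.cong) (auto simp: emeasure_density borel_measurable_N)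
  also have "\<dots> = emeasure (density N F) (\<Union>p\<in>B. cube (fst p) (snd p))"
    using BP(1) B(2)[unfolded case_prod_beta] by (intro sum_emeasure) auto
  also have "ennreal D * \<dots> \<le> ennreal D * emeasure (density N F) (space N)"
    by (intro mult_left_mono emeasure_mono) auto
  also have "emeasure (density N F) (space N) = (\<integral>\<^sup>+y. F y \<partial>N)"
    by (subst emeasure_density) (auto simp: borel_measurable_N)
  finally show ?thesis .
qed

text \<open>The level set is open, hence an increasing union of compact sets, so no inner regularity
  of \<open>N\<close> has to be established.\<close>

lemma weak_type_maximal:
  assumes [measurable]: "F \<in> borel_measurable lebesgue"
  shows "t * emeasure N {x. t < maximal_wrt N F x} \<le> ennreal D * (\<integral>\<^sup>+y. F y \<partial>N)"
proof -
  obtain C where C: "\<And>n::nat. compact (C n)" "\<And>n. C n \<subseteq> {x. t < maximal_wrt N F x}"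
    "\<And>n. C n \<subseteq> interior (C (Suc n))" "(\<Union>n. C n) = {x. t < maximal_wrt N F x}"
    using open_Union_compact_subsets[OF open_maximal_less[of t F]] by metis
  have "incseq C"
    using C(3) interior_subset by (intro incseq_SucI) blast
  have "emeasure N {x. t < maximal_wrt N F x} = (SUP n. emeasure N (C n))"
    unfolding C(4)[symmetric] using C(1) \<open>incseq C\<close>
    by (intro SUP_emeasure_incseq[symmetric]) (auto simp: compact_imp_closed)
  then have "t * emeasure N {x. t < maximal_wrt N F x} = (SUP n. t * emeasure N (C n))"
    by (simp add: SUP_mult_left_ennreal)
  also have "\<dots> \<le> ennreal D * (\<integral>\<^sup>+y. F y \<partial>N)"
    by (intro SUP_least weak_type_compact C assms)
  finally show ?thesis .
qed

lemma level_set_in_sets [simp]: "{x. t < maximal_wrt N F x} \<in> sets lebesgue"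
  using open_in_sets_N[OF open_maximal_less] by simp

section \<open>Almost everywhere domination of a function by its maximal function\<close>

lemma null_sets_lebesgue_N: "S \<in> null_sets lebesgue \<Longrightarrow> S \<in> null_sets N"
  using abs_cont by (auto simp: absolutely_continuous_def)

text \<open>Outer regularity of \<open>N\<close>, inherited from Lebesgue measure: open sets
  shrinking to \<open>S\<close> up to a Lebesgue null set do so up to an \<open>N\<close>-null set.
  The bounding set \<open>B\<close> provides the finite measure that continuity from above
  requires.\<close>

lemma emeasure_open_hull:
  assumes S: "S \<in> sets lebesgue" and B: "open B" "S \<subseteq> B" "emeasure N B < \<infinity>"
    and less: "emeasure N S < c"
  obtains U where "open U" "S \<subseteq> U" "U \<subseteq> B" "emeasure N U < c"
proof -
  have "\<exists>T. open T \<and> S \<subseteq> T \<and> emeasure lebesgue (T - S) < ennreal (inverse (real (Suc n)))" for n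
    using sets_lebesgue_outer_open[OF S, of "inverse (real (Suc n))"] by (metis of_nat_0_less_iff positive_imp_inverse_positive zero_less_Suc)
  then obtain T where T: "\<And>n. open (T n)" "\<And>n. S \<subseteq> T n"
    "\<And>n. emeasure lebesgue (T n - S) < ennreal (inverse (real (Suc n)))"
    by metis
  define U where "U n = B \<inter> (\<Inter>k\<le>n. T k)" for n
  have U: "open (U n)" "S \<subseteq> U n" "U n \<subseteq> B" "U n \<subseteq> T n" for n
    unfolding U_def using T B by (auto intro!: open_Int)
  have [measurable]: "S \<in> sets N" "U n \<in> sets N" for n using S U by auto
  have "decseq U" by (auto simp: decseq_def U_def)
  have "(\<Inter>n. U n) - S \<in> null_sets lebesgue"
  proof (rule null_setsI)
    have "emeasure lebesgue ((\<Inter>n. U n) - S) \<le> ennreal (inverse (real (Suc n)))" for n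
    proof -
      have "emeasure lebesgue ((\<Inter>n. U n) - S) \<le> emeasure lebesgue (T n - S)"
        using U(4)[of n] S T(1)[of n] by (intro emeasure_mono) auto
      with T(3)[of n] show ?thesis by simp
    qed
    moreover have "(\<lambda>n. ennreal (inverse (real (Suc n)))) \<longlonglongrightarrow> ennreal 0"
      by (intro tendsto_ennrealI LIMSEQ_inverse_real_of_nat)
    ultimately have "emeasure lebesgue ((\<Inter>n. U n) - S) \<le> ennreal 0"
      by (intro LIMSEQ_le_const) auto
    then show "emeasure lebesgue ((\<Inter>n. U n) - S) = 0" by simp
    show "(\<Inter>n. U n) - S \<in> sets lebesgue"
      using S U(1) by (intro sets.Diff sets.countable_INT) auto
  qed
  then have null: "(\<Inter>n. U n) - S \<in> null_sets N"
    by (rule null_sets_lebesgue_N)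
  have "S \<subseteq> (\<Inter>n. U n)" using U(2) by blast
  then have eq: "emeasure N (\<Inter>n. U n) = emeasure N S"
    using emeasure_Un_null_set[OF _ null, of S] S by (simp add: Un_absorb1)
  have "emeasure N (U n) \<le> emeasure N B" for n
    using B U by (intro emeasure_mono) auto
  then have "emeasure N (U n) \<noteq> \<infinity>" for n
    using B(3) by (metis less_le_not_le infinity_ennreal_def top_greatest)
  then have "(\<lambda>n. emeasure N (U n)) \<longlonglongrightarrow> emeasure N S"
    unfolding eq[symmetric] using U(1) \<open>decseq U\<close> by (intro Lim_emeasure_decseq) auto
  from order_tendstoD(2)[OF this less] obtain n where "emeasure N (U n) < c"
    by (auto simp: eventually_sequentially)
  with U show thesis by (intro that)
qed

text \<open>Suppose \<open>S\<close> has positive measure and cover it by non-overlapping cubes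
  inside an open set \<open>U\<close> barely larger than \<open>S\<close>. Each cube contains a
  point of \<open>S\<close>, so its average is at most \<open>s\<close>; summation gives
  \<open>t * N(S) \<le> s * N(U)\<close>, which fails when \<open>U\<close> is close to
  \<open>S\<close>. Vitali's selection would lose the factor \<open>D\<close> here, while a dyadic
  covering loses nothing.\<close>

lemma maximal_less_null:
  assumes [measurable]: "F \<in> borel_measurable lebesgue" "S \<in> sets lebesgue"
    and S: "S \<subseteq> interior (cube a l)" "0 < l"
    and b: "0 \<le> s" "s < t" "\<And>x. x \<in> S \<Longrightarrow> maximal_wrt N F x \<le> ennreal s" "\<And>x. x \<in> S \<Longrightarrow> ennreal t < F x"
  shows "emeasure N S = 0"
proof (rule ccontr)
  assume pos: "emeasure N S \<noteq> 0"
  let ?B = "interior (cube a l)"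
  have "emeasure N ?B \<le> emeasure N (cube a l)"
    using S(2) interior_subset by (intro emeasure_mono) auto
  also have "\<dots> < \<infinity>" using emeasure_cubes_finite S(2) by auto
  finally have finB: "emeasure N ?B < \<infinity>" .
  have "emeasure N S \<le> emeasure N ?B" using S by (intro emeasure_mono) auto
  with finB have finS: "emeasure N S < \<infinity>" by (rule le_less_trans[rotated])
  define m where "m = measure N S"
  have m: "emeasure N S = ennreal m" "0 < m"
    using finS pos emeasure_eq_ennreal_measure[of N S] by (auto simp: m_def less_top zero_less_measure_iff measure_def enn2real_positive_iff zero_less_iff_neq_zero)
  \<comment> \<open>\<open>c\<close> is the largest size allowed for the open hull: a hull of
    measure below \<open>c\<close> makes \<open>s * N(U)\<close> smaller than
    \<open>t * m\<close>.\<close>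
  obtain c where c: "m < c" "s * c < t * m"
  proof (cases "s = 0")
    case True
    with b m show thesis by (intro that[of "m + 1"]) auto
  next
    case False
    with b have "0 < s" by auto
    with b m have "m < t * m / s" by (simp add: field_simps)
    then obtain c where "m < c" "c < t * m / s" using dense by blast
    with \<open>0 < s\<close> show thesis by (intro that[of c]) (auto simp: field_simps)
  qed
  have "emeasure N S < ennreal c" using c m by (simp add: ennreal_less_iff)
  then obtain U where U: "open U" "S \<subseteq> U" "U \<subseteq> ?B" "emeasure N U < ennreal c"
    by (rule emeasure_open_hull[OF assms(2) _ S(1) finB, rotated]) auto
  \<comment> \<open>At the points of \<open>S\<close>, which lie in \<open>U\<close>, this gauge
    returns \<open>U\<close> itself, so the covering lemma produces only cubes inside
    \<open>U\<close>.\<close>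
  define g where "g x = (if x \<in> U then U else UNIV)" for x
  have g: "gauge g"
    using U(1) by (auto simp: g_def gauge_def)
  have SB: "S \<subseteq> cbox a (\<chi> i. a $ i + l)"
    using S(1) interior_subset unfolding cube_def by blast
  have "box a (\<chi> i. a $ i + l) \<noteq> {}"
    using S(2) by (simp add: interval_ne_empty_cart)
  from covering_lemma[OF SB this g] obtain \<D> where
    \<D>: "countable \<D>" "\<And>K. K \<in> \<D> \<Longrightarrow> interior K \<noteq> {} \<and> (\<exists>c d. K = cbox c d)"
      "pairwise (\<lambda>A B. interior A \<inter> interior B = {}) \<D>"
      "\<And>K. K \<in> \<D> \<Longrightarrow> \<exists>x\<in>S \<inter> K. K \<subseteq> g x"
      "\<And>u v. cbox u v \<in> \<D> \<Longrightarrow> \<exists>n. \<forall>i\<in>Basis. v \<bullet> i - u \<bullet> i = ((\<chi> i. a $ i + l) \<bullet> i - a \<bullet> i) / 2 ^ n"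
      "S \<subseteq> \<Union>\<D>"
    by metis
  have cubes: "K \<in> cubes" if K: "K \<in> \<D>" for K
  proof -
    obtain u v where uv: "K = cbox u v" using \<D>(2)[OF K] by blast
    obtain n where n: "\<forall>i\<in>Basis. v \<bullet> i - u \<bullet> i = ((\<chi> i. a $ i + l) \<bullet> i - a \<bullet> i) / 2 ^ n"
      using \<D>(5) K unfolding uv by blast
    \<comment> \<open>The covering lemma yields boxes whose sides are those of the large cube halved
      \<open>n\<close> times. All sides are therefore equal, and the box belongs to
      \<open>cubes\<close>.\<close>
    have "v $ i = u $ i + l / 2 ^ n" for i
      using n[rule_format, of "axis i 1"] by (simp add: inner_axis axis_in_Basis_iff)
    then have "v = (\<chi> i. u $ i + l / 2 ^ n)" by (simp add: vec_eq_iff)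
    with uv have "K = cube u (l / 2 ^ n)" by (simp add: cube_def)
    with S(2) show ?thesis by simp
  qed
  have KU: "K \<subseteq> U" if "K \<in> \<D>" for K
    using \<D>(4)[OF that] U(2) by (auto simp: g_def split: if_splits)
  have leK: "(\<integral>\<^sup>+y\<in>K. F y \<partial>N) \<le> ennreal s * emeasure N K" if K: "K \<in> \<D>" for K
  proof -
    obtain x where x: "x \<in> S" "x \<in> K" using \<D>(4)[OF K] by blast
    have "(\<integral>\<^sup>+y\<in>K. F y \<partial>N) \<le> maximal_wrt N F x * emeasure N K"
      by (rule maximal_geD[OF cubes[OF K] x(2)])
    also have "\<dots> \<le> ennreal s * emeasure N K"
      using b(3)[OF x(1)] by (intro mult_right_mono) auto
    finally show ?thesis .
  qed
  have bd: "K - interior K \<in> null_sets N" if K: "K \<in> \<D>" for K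
  proof (rule null_sets_lebesgue_N)
    obtain u v where uv: "K = cbox u v" using \<D>(2)[OF K] by blast
    have "negligible (cbox u v - box u v)" by (rule negligible_frontier_interval)
    then show "K - interior K \<in> null_sets lebesgue"
      by (simp add: uv negligible_iff_null_sets)
  qed
  have meas [measurable]: "K \<in> sets N" "interior K \<in> sets N" if "K \<in> \<D>" for K
    using cubes[OF that] by auto
  have eqK: "emeasure N (interior K) = emeasure N K" if K: "K \<in> \<D>" for K
  proof -
    have "interior K \<union> (K - interior K) = K" using interior_subset[of K] by auto
    with emeasure_Un_null_set[OF meas(2)[OF K] bd[OF K]] show ?thesis by simp
  qed
  \<comment> \<open>Only the interiors of the covering cubes are disjoint, so the sums run over
    interiors; the boundaries left out are null for \<open>N\<close>.\<close>
  define I where "I = (\<Union>K\<in>\<D>. interior K)"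
  have "open I" unfolding I_def by (intro open_UN) auto
  then have I [simp]: "I \<in> sets lebesgue" by auto
  have disj: "disjoint_family_on interior \<D>"
    using \<D>(3) by (auto simp: disjoint_family_on_def pairwise_def)
  have sub: "S - I \<subseteq> (\<Union>K\<in>\<D>. K - interior K)"
    using \<D>(6) by (auto simp: I_def)
  have "(\<Union>K\<in>\<D>. K - interior K) \<in> null_sets N"
    using \<D>(1) bd by (intro null_sets_UN')
  then have AE_I: "AE x in N. x \<in> S \<longrightarrow> x \<in> I"
    by (rule AE_I') (use sub in auto)
  have "ennreal t * emeasure N S = (\<integral>\<^sup>+x. ennreal t * indicator S x \<partial>N)"
    by (subst nn_integral_cmult_indicator) auto
  also have "\<dots> \<le> (\<integral>\<^sup>+x\<in>I. F x \<partial>N)"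
    by (intro nn_integral_mono_AE eventually_mono[OF AE_I])
      (use b(4) in \<open>auto simp: indicator_def less_imp_le\<close>)
  also have "\<dots> = emeasure (density N F) I"
    by (subst emeasure_density) (auto simp: borel_measurable_N)
  also have "\<dots> = (\<integral>\<^sup>+K. emeasure (density N F) (interior K) \<partial>count_space \<D>)"
    unfolding I_def using disj \<D>(1) by (intro emeasure_UN_countable) auto
  also have "\<dots> \<le> (\<integral>\<^sup>+K. ennreal s * emeasure N (interior K) \<partial>count_space \<D>)"
  proof (intro nn_integral_mono)
    fix K assume "K \<in> space (count_space \<D>)"
    then have K: "K \<in> \<D>" by simp
    have "emeasure (density N F) (interior K) = (\<integral>\<^sup>+x\<in>interior K. F x \<partial>N)"
      using meas[OF K] by (subst emeasure_density) (auto simp: borel_measurable_N)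
    also have "\<dots> \<le> (\<integral>\<^sup>+x\<in>K. F x \<partial>N)"
      using interior_subset[of K] by (intro nn_integral_mono) (auto simp: indicator_def)
    also have "\<dots> \<le> ennreal s * emeasure N (interior K)"
      using leK[OF K] by (simp add: eqK[OF K])
    finally show "emeasure (density N F) (interior K) \<le> ennreal s * emeasure N (interior K)" .
  qed
  also have "\<dots> = ennreal s * (\<integral>\<^sup>+K. emeasure N (interior K) \<partial>count_space \<D>)"
    by (rule nn_integral_cmult) auto
  also have "(\<integral>\<^sup>+K. emeasure N (interior K) \<partial>count_space \<D>) = emeasure N I"
    unfolding I_def using disj \<D>(1) by (intro emeasure_UN_countable[symmetric]) auto
  also have "ennreal s * emeasure N I \<le> ennreal s * ennreal c"
  proof (intro mult_left_mono)
    have "I \<subseteq> U" using KU interior_subset unfolding I_def by blast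
    then have "emeasure N I \<le> emeasure N U" using U(1) by (intro emeasure_mono) auto
    with U(4) show "emeasure N I \<le> ennreal c" by auto
  qed auto
  finally have "ennreal (t * m) \<le> ennreal (s * c)"
    using b m c by (simp add: ennreal_mult)
  with c b m show False by (simp add: ennreal_le_iff)
qed

text \<open>A failure at \<open>x\<close> is witnessed by two rationals between the maximal function
  and \<open>F\<close> and by a bounded cube around \<open>x\<close>. The exceptional set is thus a
  countable union of sets to which \<open>maximal_less_null\<close> applies.\<close>

lemma AE_le_maximal:
  assumes [measurable]: "F \<in> borel_measurable lebesgue"
  shows "AE x in N. F x \<le> maximal_wrt N F x"
proof -
  define S where "S = (\<lambda>(r :: rat \<times> rat, n :: nat). {x. maximal_wrt N F x \<le> ennreal (of_rat (fst r))} \<inter>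
    {x. ennreal (of_rat (snd r)) < F x} \<inter> interior (cube (\<chi> i. - real (Suc n)) (2 * real (Suc n))))"
  define J where "J = {(r :: rat \<times> rat, n :: nat). 0 \<le> fst r \<and> fst r < snd r}"
  have null: "S j \<in> null_sets N" if "j \<in> J" for j
  proof -
    obtain r t n where j: "j = ((r, t), n)" by (metis surj_pair)
    have rt: "0 \<le> r" "r < t" using that by (auto simp: J_def j)
    have meas: "S j \<in> sets lebesgue"
    proof -
      have "{x \<in> space lebesgue. maximal_wrt N F x \<le> ennreal (of_rat r)} \<in> sets lebesgue" by measurable
      moreover have "{x \<in> space lebesgue. ennreal (of_rat t) < F x} \<in> sets lebesgue" by measurable
      ultimately show ?thesis by (auto simp: S_def j)
    qed
    have "emeasure N (S j) = 0"
      by (rule maximal_less_null[OF assms meas, of "\<chi> i. - real (Suc n)" "2 * real (Suc n)" "of_rat r" "of_rat t"])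
        (use rt in \<open>simp_all add: S_def j of_rat_less\<close>)
    with meas show ?thesis by (intro null_setsI) simp_all
  qed
  have "(\<Union>j\<in>J. S j) \<in> null_sets N"
    by (intro null_sets_UN' null) auto
  moreover have "{x \<in> space N. \<not> F x \<le> maximal_wrt N F x} \<subseteq> (\<Union>j\<in>J. S j)"
  proof clarify
    fix x assume "\<not> F x \<le> maximal_wrt N F x"
    then have "maximal_wrt N F x < F x" by (simp add: not_le)
    from dense[OF this] obtain z where z: "maximal_wrt N F x < z" "z < F x" by blast
    then obtain m \<zeta> where m: "maximal_wrt N F x = ennreal m" "z = ennreal \<zeta>" "0 \<le> m" "m < \<zeta>"
      by (cases "maximal_wrt N F x"; cases z) (auto simp: ennreal_less_iff)
    obtain s where s: "m < of_rat s" "of_rat s < \<zeta>" using of_rat_dense[OF m(4)] by blast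
    obtain t where t: "of_rat s < real_of_rat t" "of_rat t < \<zeta>" using of_rat_dense[OF s(2)] by blast
    obtain n where n: "norm x \<le> real n" using real_arch_simple by blast
    have "- real (Suc n) < x $ i \<and> x $ i < real (Suc n)" for i
      using component_le_norm_cart[of x i] n by auto
    then have "x \<in> interior (cube (\<chi> i. - real (Suc n)) (2 * real (Suc n)))"
      by (simp add: mem_interior_cube)
    moreover have "0 < real_of_rat s" using s m by linarith
    then have "0 \<le> s" by simp
    moreover have "s < t" using t by (simp add: of_rat_less)
    moreover have "maximal_wrt N F x \<le> ennreal (of_rat s)"
      using s m by (simp add: ennreal_leI)
    moreover have "ennreal (of_rat t) < F x"
    proof -
      have "ennreal (of_rat t) \<le> z" using t m by (simp add: ennreal_leI)
      with z(2) show ?thesis by simp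
    qed
    ultimately show "x \<in> (\<Union>j\<in>J. S j)"
      by (intro UN_I[of "((s, t), n)"]) (auto simp: J_def S_def)
  qed
  ultimately show ?thesis by (rule AE_I')
qed

text \<open>The cubes centred at the one point \<open>x\<close> exhaust the space, so zero averages
  over them leave no mass anywhere. In contrapositive form, maximal functions are strictly positive
  at every point.\<close>

lemma maximal_eq_0:
  assumes [measurable]: "F \<in> borel_measurable lebesgue" and "maximal_wrt N F x = 0"
  shows "AE x in N. F x = 0"
proof -
  define R where "R n = cube (\<chi> i. x $ i - real (Suc n)) (2 * real (Suc n))" for n
  have memR: "y \<in> R n \<longleftrightarrow> (\<forall>i. \<bar>y $ i - x $ i\<bar> \<le> real (Suc n))" for y n
    by (auto simp: R_def mem_cube abs_le_iff algebra_simps)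
  have [measurable]: "R n \<in> sets N" for n by (auto simp: R_def)
  have "AE y in N. F y * indicator (R n) y = 0" for n
  proof -
    have "(\<integral>\<^sup>+y\<in>R n. F y \<partial>N) \<le> maximal_wrt N F x * emeasure N (R n)"
      by (rule maximal_geD) (simp_all add: memR, simp add: R_def)
    then have "(\<integral>\<^sup>+y\<in>R n. F y \<partial>N) = 0" using assms(2) by simp
    then show ?thesis
      by (subst (asm) nn_integral_0_iff_AE) (auto simp: borel_measurable_N)
  qed
  then have "AE y in N. \<forall>n. F y * indicator (R n) y = 0"
    by (subst AE_all_countable) blast
  then show ?thesis
  proof eventually_elim
    case (elim y)
    obtain n where n: "norm (y - x) \<le> real n" using real_arch_simple by blast
    have "\<bar>y $ i - x $ i\<bar> \<le> real (Suc n)" for i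
      using component_le_norm_cart[of "y - x" i] n by simp
    then have "y \<in> R n" by (simp add: memR)
    with elim[rule_format, of n] show ?case by simp
  qed
qed

section \<open>Powers of maximal functions\<close>

lemma D_pos: "0 < D"
proof -
  have "0 < emeasure N (cube3 0 1)" using emeasure_cubes_pos by simp
  also have "\<dots> \<le> ennreal D * emeasure N (cube 0 1)" using doubling by simp
  finally show ?thesis by (cases "D \<le> 0") (auto simp: ennreal_neg)
qed

text \<open>Kolmogorov's argument. Let \<open>m\<close> be the maximal function at \<open>x\<close>,
  assumed positive and finite, and \<open>T = D * m\<close>. Levels below \<open>T\<close>
  contribute at most \<open>N(Q) * T powr \<tau>\<close>. Above \<open>T\<close> the weak type
  inequality for the local part of \<open>F\<close> bounds the level set by
  \<open>D * T * N(Q) / t\<close>, and \<open>t powr (\<tau> - 2)\<close> is integrable at infinity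
  because \<open>\<tau> < 1\<close>. The two contributions add up to the stated constant.\<close>

lemma Coifman_Rochberg:
  assumes [measurable]: "F \<in> borel_measurable lebesgue" and \<tau>: "0 < \<tau>" "\<tau> < 1"
    and Q: "Q \<in> cubes" "x \<in> Q"
  shows "(\<integral>\<^sup>+y\<in>Q. epowr (maximal_wrt N F y) \<tau> \<partial>N) \<le>
    ennreal (D powr \<tau> * (1 + D * \<tau> / (1 - \<tau>))) * epowr (maximal_wrt N F x) \<tau> * emeasure N Q"
proof (cases "maximal_wrt N F x")
  case top
  have "0 < emeasure N Q" by (rule emeasure_cubes_pos[OF Q(1)])
  moreover have "0 < D powr \<tau> * (1 + D * \<tau> / (1 - \<tau>))"
    using D_pos \<tau> by (intro mult_pos_pos add_pos_nonneg) auto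
  then have "ennreal (D powr \<tau> * (1 + D * \<tau> / (1 - \<tau>))) \<noteq> 0" (is "?c \<noteq> 0")
    by (simp only: ennreal_eq_0_iff not_le)
  then have "?c * top = top"
    by (rule ennreal_mult_top[THEN trans, OF if_not_P])
  ultimately show ?thesis
    unfolding top epowr_top by (simp add: ennreal_top_mult)
next
  case (real m)
  show ?thesis
  proof (cases "m = 0")
    case True
    then have "AE y in N. F y = 0" using maximal_eq_0[of F x] real by simp
    then have "(\<integral>\<^sup>+y\<in>R. F y \<partial>N) = (\<integral>\<^sup>+y. 0 \<partial>N)" for R
      by (intro nn_integral_cong_AE) (auto elim: eventually_mono)
    then have "maximal_wrt N F y \<le> 0" for y
      by (intro maximal_le_imp) simp
    then show ?thesis by simp
  next
    case False
    with real have m: "0 < m" by simp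
    obtain a l where al: "Q = cube a l" "0 < l" using Q(1) by (auto simp: cubes_iff)
    have [simp]: "Q \<in> sets lebesgue" using Q(1) by simp
    have [measurable]: "cube3 a l \<in> sets lebesgue" by simp
    define T where "T = D * m"
    have T: "0 < T" using D_pos m by (simp add: T_def)
    let ?F1 = "\<lambda>y. F y * indicator (cube3 a l) y"
    have "(\<integral>\<^sup>+y. ?F1 y \<partial>N) \<le> ennreal m * emeasure N (cube3 a l)"
      using maximal_geD[of "cube3 a l" x F] cube_subset_cube3[OF al(2), of a] Q(2) al real by auto
    also have "\<dots> \<le> ennreal m * (ennreal D * emeasure N Q)"
      unfolding al(1) by (intro mult_left_mono doubling al) simp
    finally have F1: "(\<integral>\<^sup>+y. ?F1 y \<partial>N) \<le> ennreal T * emeasure N Q"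
      using D_pos m by (simp add: T_def ennreal_mult mult_ac)
    \<comment> \<open>A cube through a point of \<open>Q\<close> that leaves the triple of \<open>Q\<close> has a triple through \<open>x\<close>,
      so its average is at most \<open>T\<close>: above the level \<open>T\<close> only the local part of \<open>F\<close> counts.\<close>
    have local: "ennreal t < maximal_wrt N ?F1 z" if z: "z \<in> Q" "ennreal t < maximal_wrt N F z" and t: "T \<le> t" for z t
    proof -
      obtain b k where R: "0 < k" "z \<in> cube b k"
        "ennreal t * emeasure N (cube b k) < (\<integral>\<^sup>+y\<in>cube b k. F y \<partial>N)"
        using maximal_lessE[OF z(2)] by blast
      have "cube b k \<subseteq> cube3 a l"
      proof (rule ccontr)
        assume "\<not> cube b k \<subseteq> cube3 a l"
        with z R Q(2) have x: "x \<in> cube3 b k"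
          unfolding al by (intro cube_subset_cube3_if_not_subset[of z a l b k x])
        have "(\<integral>\<^sup>+y\<in>cube b k. F y \<partial>N) \<le> (\<integral>\<^sup>+y\<in>cube3 b k. F y \<partial>N)"
          using cube_subset_cube3[OF R(1), of b] by (intro nn_integral_mono) (auto simp: indicator_def)
        also have "\<dots> \<le> ennreal m * emeasure N (cube3 b k)"
          using maximal_geD[OF cube3_in_cubes[OF R(1)] x, of F] real by simp
        also have "\<dots> \<le> ennreal m * (ennreal D * emeasure N (cube b k))"
          by (intro mult_left_mono doubling R) simp
        also have "\<dots> = ennreal T * emeasure N (cube b k)"
          using D_pos m by (simp add: T_def ennreal_mult mult_ac)
        also have "\<dots> \<le> ennreal t * emeasure N (cube b k)"
          using t by (intro mult_right_mono ennreal_leI) auto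
        finally show False using R(3) by simp
      qed
      then have "(\<integral>\<^sup>+y\<in>cube b k. F y \<partial>N) = (\<integral>\<^sup>+y\<in>cube b k. ?F1 y \<partial>N)"
        by (intro nn_integral_cong) (auto simp: indicator_def)
      with R show ?thesis by (intro maximal_lessI[of "cube b k"]) auto
    qed
    have level: "ennreal (\<tau> * t powr (\<tau> - 1)) * emeasure N {y \<in> Q. ennreal t < maximal_wrt N F y}
        \<le> ennreal (\<tau> * D * T) * emeasure N Q * ennreal (t powr (\<tau> - 2))" if t: "T \<le> t" for t
    proof -
      have t0: "0 < t" using t T by simp
      have "ennreal t * emeasure N {y \<in> Q. ennreal t < maximal_wrt N F y} \<le>
          ennreal t * emeasure N {y. ennreal t < maximal_wrt N ?F1 y}"
        using local t by (intro mult_left_mono emeasure_mono) auto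
      also have "\<dots> \<le> ennreal D * (\<integral>\<^sup>+y. ?F1 y \<partial>N)"
        by (rule weak_type_maximal) measurable
      also have "\<dots> \<le> ennreal D * (ennreal T * emeasure N Q)"
        by (intro mult_left_mono F1) simp
      finally have le: "ennreal (\<tau> * t powr (\<tau> - 2)) * (ennreal t * emeasure N {y \<in> Q. ennreal t < maximal_wrt N F y})
         \<le> ennreal (\<tau> * t powr (\<tau> - 2)) * (ennreal D * (ennreal T * emeasure N Q))"
        by (rule mult_left_mono) simp
      have eq1: "ennreal (\<tau> * t powr (\<tau> - 1)) = ennreal (\<tau> * t powr (\<tau> - 2)) * ennreal t"
        using powr_mult_base[of t "\<tau> - 2"] t0 \<tau> by (simp add: ennreal_mult[symmetric] mult_ac)
      have eq2: "ennreal (\<tau> * t powr (\<tau> - 2)) * (ennreal D * ennreal T) = ennreal (\<tau> * D * T) * ennreal (t powr (\<tau> - 2))"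
        using \<tau> D_pos T by (simp add: ennreal_mult[symmetric] mult_ac)
      have "ennreal (\<tau> * t powr (\<tau> - 1)) * emeasure N {y \<in> Q. ennreal t < maximal_wrt N F y}
          \<le> ennreal (\<tau> * t powr (\<tau> - 2)) * (ennreal D * ennreal T) * emeasure N Q"
        using le by (simp only: eq1 mult.assoc)
      then show ?thesis
        unfolding eq2 by (simp only: mult_ac)
    qed
    have "(\<integral>\<^sup>+y\<in>Q. epowr (maximal_wrt N F y) \<tau> \<partial>N) =
      (\<integral>\<^sup>+t\<in>{0<..}. ennreal (\<tau> * t powr (\<tau> - 1)) * emeasure N {y \<in> Q. ennreal t < maximal_wrt N F y} \<partial>lborel)"
      using \<tau> Q by (intro nn_integral_epowr_layer_cake sigma_finite_N) (auto simp: borel_measurable_N)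
    also have "\<dots> \<le> (\<integral>\<^sup>+t. emeasure N Q * (ennreal (\<tau> * t powr (\<tau> - 1)) * indicator {0<..<T} t) +
        ennreal (\<tau> * D * T) * emeasure N Q * (ennreal (t powr (\<tau> - 2)) * indicator {T..} t) \<partial>lborel)"
    proof (intro nn_integral_mono)
      fix t :: real
      consider "t \<le> 0" | "0 < t" "t < T" | "T \<le> t" using T by linarith
      then show "ennreal (\<tau> * t powr (\<tau> - 1)) * emeasure N {y \<in> Q. ennreal t < maximal_wrt N F y} * indicator {0<..} t
        \<le> emeasure N Q * (ennreal (\<tau> * t powr (\<tau> - 1)) * indicator {0<..<T} t) +
        ennreal (\<tau> * D * T) * emeasure N Q * (ennreal (t powr (\<tau> - 2)) * indicator {T..} t)"
      proof cases
        case 1 then show ?thesis by simp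
      next
        case 2
        have "emeasure N {y \<in> Q. ennreal t < maximal_wrt N F y} \<le> emeasure N Q"
          by (intro emeasure_mono) auto
        with 2 show ?thesis
          by (simp add: mult.commute[of "emeasure N Q"] mult_left_mono)
      next
        case 3
        with level[OF 3] T show ?thesis by (simp add: mult_ac)
      qed
    qed
    also have "\<dots> = emeasure N Q * (\<integral>\<^sup>+t\<in>{0<..<T}. ennreal (\<tau> * t powr (\<tau> - 1)) \<partial>lborel) +
        ennreal (\<tau> * D * T) * emeasure N Q * (\<integral>\<^sup>+t\<in>{T..}. ennreal (t powr (\<tau> - 2)) \<partial>lborel)"
      by (subst nn_integral_add) (auto simp: nn_integral_cmult)
    also have "\<dots> = emeasure N Q * ennreal (T powr \<tau>) +
        ennreal (\<tau> * D * T) * emeasure N Q * ennreal (T powr (\<tau> - 1) / (1 - \<tau>))"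
      using nn_integral_powr_0[of \<tau> T] nn_integral_powr_tail[of \<tau> T] \<tau> T by simp
    also have "\<dots> = ennreal (T powr \<tau> + \<tau> * D * T * (T powr (\<tau> - 1) / (1 - \<tau>))) * emeasure N Q"
    proof -
      have "ennreal (T powr \<tau> + \<tau> * D * T * (T powr (\<tau> - 1) / (1 - \<tau>))) =
          ennreal (T powr \<tau>) + ennreal (\<tau> * D * T) * ennreal (T powr (\<tau> - 1) / (1 - \<tau>))"
        using \<tau> D_pos T by (subst ennreal_plus) (auto simp: ennreal_mult[symmetric])
      then show ?thesis
        by (simp only: distrib_left distrib_right mult_ac)
    qed
    also have "T powr \<tau> + \<tau> * D * T * (T powr (\<tau> - 1) / (1 - \<tau>)) =
        D powr \<tau> * (1 + D * \<tau> / (1 - \<tau>)) * m powr \<tau>"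
    proof -
      have "T * T powr (\<tau> - 1) = T powr \<tau>" using powr_mult_base[of T "\<tau> - 1"] T by simp
      then have "\<tau> * D * T * (T powr (\<tau> - 1) / (1 - \<tau>)) = \<tau> * D / (1 - \<tau>) * T powr \<tau>"
        by (metis (no_types, opaque_lifting) mult.assoc times_divide_eq_left times_divide_eq_right)
      moreover have "T powr \<tau> = D powr \<tau> * m powr \<tau>"
        using D_pos m by (simp add: T_def powr_mult)
      ultimately show ?thesis by (simp add: algebra_simps)
    qed
    finally show ?thesis
      using real m D_pos \<tau> by (simp add: epowr_ennreal ennreal_mult)
  qed
qed

text \<open>A strong type bound without interpolation: the maximal function of an indicator is at
  most 1, so only levels \<open>t < 1\<close> count, and there the weak type inequality leaves
  \<open>t powr (k - 2)\<close>, which is integrable at 0 because \<open>k > 1\<close>.\<close>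

lemma nn_integral_maximal_indicator:
  assumes [measurable]: "E \<in> sets lebesgue" and k: "1 < k"
  shows "(\<integral>\<^sup>+x. epowr (maximal_wrt N (indicator E) x) k \<partial>N) \<le> ennreal (D * k / (k - 1)) * emeasure N E"
proof -
  let ?M = "maximal_wrt N (indicator E)"
  have le1: "?M x \<le> 1" for x
    by (rule maximal_le_imp) (auto intro!: nn_integral_mono simp: indicator_def
        nn_integral_indicator[symmetric] simp del: nn_integral_indicator)
  have "(\<integral>\<^sup>+x. epowr (?M x) k \<partial>N) = (\<integral>\<^sup>+x\<in>UNIV. epowr (?M x) k \<partial>N)" by simp
  also have "\<dots> = (\<integral>\<^sup>+t\<in>{0<..}. ennreal (k * t powr (k - 1)) * emeasure N {x \<in> UNIV. ennreal t < ?M x} \<partial>lborel)"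
    using k by (intro nn_integral_epowr_layer_cake sigma_finite_N) (auto simp: borel_measurable_N)
  also have "\<dots> \<le> (\<integral>\<^sup>+t. ennreal (D * k / (k - 1)) * emeasure N E * (ennreal ((k - 1) * t powr (k - 1 - 1)) * indicator {0<..<1} t) \<partial>lborel)"
  proof (intro nn_integral_mono)
    fix t :: real
    show "ennreal (k * t powr (k - 1)) * emeasure N {x \<in> UNIV. ennreal t < ?M x} * indicator {0<..} t
      \<le> ennreal (D * k / (k - 1)) * emeasure N E * (ennreal ((k - 1) * t powr (k - 1 - 1)) * indicator {0<..<1} t)"
    proof (cases "0 < t \<and> t < 1")
      case False
      have "{x \<in> UNIV. ennreal t < ?M x} = {}" if "1 \<le> t"
        using le1 that by (auto simp: not_less intro!: order_trans[OF le1])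
      with False show ?thesis by (auto simp: indicator_def)
    next
      case True
      have "ennreal t * emeasure N {x. ennreal t < ?M x} \<le> ennreal D * emeasure N E"
        using weak_type_maximal[of "indicator E" "ennreal t"] by simp
      then have le: "ennreal (k * t powr (k - 2)) * (ennreal t * emeasure N {x. ennreal t < ?M x})
        \<le> ennreal (k * t powr (k - 2)) * (ennreal D * emeasure N E)"
        by (rule mult_left_mono) simp
      have eq1: "ennreal (k * t powr (k - 1)) = ennreal (k * t powr (k - 2)) * ennreal t"
        using True k powr_mult_base[of t "k - 2"] by (simp add: ennreal_mult[symmetric] mult_ac)
      have eq2: "ennreal (k * t powr (k - 2)) * ennreal D = ennreal (D * k / (k - 1)) * ennreal ((k - 1) * t powr (k - 1 - 1))"
        using k D_pos by (subst (1 2) ennreal_mult[symmetric]) (simp_all add: mult_ac)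
      have "ennreal (k * t powr (k - 1)) * emeasure N {x. ennreal t < ?M x}
          \<le> ennreal (k * t powr (k - 2)) * ennreal D * emeasure N E"
        using le by (simp only: eq1 mult.assoc)
      then show ?thesis
        unfolding eq2 using True by (simp add: mult_ac)
    qed
  qed
  also have "\<dots> = ennreal (D * k / (k - 1)) * emeasure N E * (\<integral>\<^sup>+t. (ennreal ((k - 1) * t powr (k - 1 - 1)) * indicator {0<..<1} t) \<partial>lborel)"
    by (rule nn_integral_cmult) measurable
  also have "\<dots> = ennreal (D * k / (k - 1)) * emeasure N E"
    using nn_integral_powr_0[of "k - 1" 1] k by simp
  finally show ?thesis .
qed

end

section \<open>Muckenhoupt weights\<close>

declare emeasure_completion [simp del]

lemma emeasure_cubes_lebesgue: "Q \<in> cubes \<Longrightarrow> 0 < emeasure lebesgue Q \<and> emeasure lebesgue Q < \<infinity>"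
  by (auto simp: cubes_iff emeasure_cube)

lemma emeasure_cube3: "0 < l \<Longrightarrow> emeasure lebesgue (cube3 (a :: real ^ 'n) l) = ennreal (3 ^ CARD('n)) * emeasure lebesgue (cube a l)"
  by (simp add: cube3_def emeasure_cube power_mult_distrib flip: ennreal_mult)

lemma doubling_measure_lebesgue: "doubling_measure (lebesgue :: (real ^ 'n) measure) (3 ^ CARD('n))"
  by unfold_locales
    (simp_all add: emeasure_cubes_lebesgue[unfolded infinity_ennreal_def] emeasure_cube3 absolutely_continuous_def)

lemma HL_maximal_eq: "HL_maximal f = maximal_wrt lebesgue (\<lambda>y. ennreal \<bar>f y\<bar>)"
  by (simp add: fun_eq_iff HL_maximal_def maximal_wrt_def avg_def)

text \<open>The \<open>A\<^sub>1\<close> inequality is required at every point \<open>x\<close> of \<open>Q\<close>, not just at almost every one: powers of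
  maximal functions satisfy it in this form, which avoids essential infima.\<close>

definition A1_weight :: "real \<Rightarrow> (real ^ 'n \<Rightarrow> ennreal) \<Rightarrow> bool" where
  "A1_weight c V \<longleftrightarrow> 0 < c \<and> V \<in> borel_measurable lebesgue \<and> (AE x in lebesgue. 0 < V x \<and> V x < \<infinity>) \<and>
    (\<forall>Q\<in>cubes. \<forall>x\<in>Q. (\<integral>\<^sup>+y\<in>Q. V y \<partial>lebesgue) \<le> ennreal c * V x * emeasure lebesgue Q)"

lemma A1_weight_one: "A1_weight 1 (\<lambda>x. 1)"
  by (auto simp: A1_weight_def)

lemma ex_in_cube_if_AE:
  assumes "Q \<in> cubes" "AE x in lebesgue. P x"
  obtains x where "x \<in> Q" "P x"
proof -
  have "\<not> (AE x in lebesgue. x \<notin> Q)"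
    using emeasure_cubes_lebesgue[OF assms(1)] AE_iff_measurable[of Q lebesgue "\<lambda>x. x \<notin> Q"] assms(1)
    by auto
  with assms(2) have "\<not> (\<forall>x\<in>Q. \<not> P x)"
    by (metis (mono_tags, lifting) eventually_mono)
  with that show thesis by blast
qed

lemma nn_integral_cube_pos:
  assumes "Q \<in> cubes" "AE x in lebesgue. 0 < G x" and [measurable]: "G \<in> borel_measurable lebesgue"
  shows "0 < (\<integral>\<^sup>+x\<in>Q. G x \<partial>lebesgue)"
proof (rule ccontr)
  have [measurable]: "Q \<in> sets lebesgue" using assms(1) by simp
  assume "\<not> 0 < (\<integral>\<^sup>+x\<in>Q. G x \<partial>lebesgue)"
  then have "AE x in lebesgue. G x * indicator Q x = 0"
    by (subst (asm) not_gr_zero) (simp add: nn_integral_0_iff_AE)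
  with assms(2) have "AE x in lebesgue. G x * indicator Q x = 0 \<and> 0 < G x"
    by eventually_elim simp
  then obtain x where "x \<in> Q" "G x * indicator Q x = 0 \<and> 0 < G x"
    by (rule ex_in_cube_if_AE[OF assms(1)])
  then show False by (simp add: zero_less_iff_neq_zero)
qed

text \<open>Finiteness comes from the A1 inequality at a single point of \<open>Q\<close> where
  \<open>V\<close> is finite; such a point exists because \<open>Q\<close> has positive
  measure.\<close>

lemma A1_weight_cube:
  assumes "A1_weight c V" "Q \<in> cubes"
  shows "0 < (\<integral>\<^sup>+x\<in>Q. V x \<partial>lebesgue)" "(\<integral>\<^sup>+x\<in>Q. V x \<partial>lebesgue) < \<infinity>"
proof -
  show "0 < (\<integral>\<^sup>+x\<in>Q. V x \<partial>lebesgue)"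
    using assms by (intro nn_integral_cube_pos) (auto simp: A1_weight_def elim: eventually_mono)
  have "AE x in lebesgue. V x < \<infinity>"
    using assms(1) by (auto simp: A1_weight_def elim: eventually_mono)
  from ex_in_cube_if_AE[OF assms(2) this] obtain x where x: "x \<in> Q" "V x < \<infinity>" .
  then have "(\<integral>\<^sup>+x\<in>Q. V x \<partial>lebesgue) \<le> ennreal c * V x * emeasure lebesgue Q"
    using assms by (auto simp: A1_weight_def)
  also have "\<dots> < \<infinity>"
    using x emeasure_cubes_lebesgue[OF assms(2)] by (simp add: ennreal_mult_less_top)
  finally show "(\<integral>\<^sup>+x\<in>Q. V x \<partial>lebesgue) < \<infinity>" .
qed

text \<open>The A1 inequality on the triple holds at every point \<open>x\<close> of the original
  cube. Integrating it over that cube compares the two \<open>V dx\<close> measures, and the ratio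
  of volumes contributes the power of 3.\<close>

lemma doubling_measure_A1:
  fixes V :: "real ^ 'n \<Rightarrow> ennreal"
  assumes A1: "A1_weight c V"
  shows "doubling_measure (density lebesgue V) (c * 3 ^ CARD('n))"
proof
  have [measurable]: "V \<in> borel_measurable lebesgue" and c: "0 < c"
    using A1 by (auto simp: A1_weight_def)
  have em: "emeasure (density lebesgue V) Q = (\<integral>\<^sup>+x\<in>Q. V x \<partial>lebesgue)" if "Q \<in> cubes" for Q
    using that by (subst emeasure_density) auto
  show "sets (density lebesgue V) = sets lebesgue" by simp
  show "absolutely_continuous lebesgue (density lebesgue V)"
    by (rule absolutely_continuousI_density) measurable
  show "emeasure (density lebesgue V) Q < \<infinity>" "0 < emeasure (density lebesgue V) Q" if "Q \<in> cubes" for Q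
    using A1_weight_cube[OF A1 that] by (simp_all add: em[OF that])
  fix a :: "real ^ 'n" and l :: real assume l: "0 < l"
  let ?I = "\<lambda>Q. \<integral>\<^sup>+x\<in>Q. V x \<partial>lebesgue"
  let ?Q = "cube a l" and ?Q3 = "cube3 a l"
  have [measurable]: "?Q \<in> sets lebesgue" using l by simp
  have Q: "0 < emeasure lebesgue ?Q" "emeasure lebesgue ?Q < \<infinity>"
    using emeasure_cubes_lebesgue[of ?Q] l by auto
  have "?I ?Q3 * emeasure lebesgue ?Q = (\<integral>\<^sup>+x\<in>?Q. ?I ?Q3 \<partial>lebesgue)"
    by (simp add: nn_integral_cmult_indicator)
  also have "\<dots> \<le> (\<integral>\<^sup>+x. (ennreal c * emeasure lebesgue ?Q3) * (V x * indicator ?Q x) \<partial>lebesgue)"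
  proof (intro nn_integral_mono)
    fix x
    have "?I ?Q3 \<le> ennreal c * V x * emeasure lebesgue ?Q3" if "x \<in> ?Q"
      using A1 l that cube_subset_cube3[OF l, of a] unfolding A1_weight_def by (meson cube3_in_cubes subsetD)
    then show "?I ?Q3 * indicator ?Q x \<le> (ennreal c * emeasure lebesgue ?Q3) * (V x * indicator ?Q x)"
      by (auto simp: indicator_def mult_ac)
  qed
  also have "\<dots> = ennreal c * emeasure lebesgue ?Q3 * ?I ?Q"
    by (rule nn_integral_cmult) measurable
  also have "\<dots> = ennreal (c * 3 ^ CARD('n)) * ?I ?Q * emeasure lebesgue ?Q"
    using c by (simp add: emeasure_cube3[OF l] ennreal_mult mult_ac)
  finally have "?I ?Q3 \<le> ennreal (c * 3 ^ CARD('n)) * ?I ?Q"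
    using ennreal_mult_strict_right_mono[OF _ Q(1) Q(2)[unfolded infinity_ennreal_def]]
    by (meson leD leI)
  then show "emeasure (density lebesgue V) ?Q3 \<le> ennreal (c * 3 ^ CARD('n)) * emeasure (density lebesgue V) ?Q"
    using l by (simp add: em)
qed

text \<open>The constant of the Coifman-Rochberg inequality. The measure enters only through its
  doubling constant \<open>D\<close>, and the function not at all; all uniformity in
  \<open>f\<close> and \<open>g\<close> rests on that.\<close>

definition CR_const :: "real \<Rightarrow> real \<Rightarrow> real" where
  "CR_const D \<tau> = D powr \<tau> * (1 + D * \<tau> / (1 - \<tau>))"

lemma CR_const_pos: "0 < D \<Longrightarrow> 0 < \<tau> \<Longrightarrow> \<tau> < 1 \<Longrightarrow> 0 < CR_const D \<tau>"
  unfolding CR_const_def by (intro mult_pos_pos add_pos_nonneg) auto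

lemma epowr_pos: "0 < x \<Longrightarrow> 0 < epowr x a"
  by (auto simp: epowr_def enn2real_eq_0_iff ennreal_less_zero_iff less_top[symmetric] enn2real_positive_iff)

lemma epowr_finite: "x < top \<Longrightarrow> epowr x a < top"
  by (auto simp: epowr_def)

text \<open>That \<open>F\<close> is not almost everywhere 0 makes the maximal function positive at
  every point. Its finiteness is supplied in the applications by the integrability of
  \<open>M\<^sub>\<mu> v\<close> or by the boundedness of the maximal operator.\<close>

lemma A1_weight_maximal_powr:
  fixes F :: "real ^ 'n \<Rightarrow> ennreal"
  assumes [measurable]: "F \<in> borel_measurable lebesgue" and \<tau>: "0 < \<tau>" "\<tau> < 1"
    and fin: "AE x in lebesgue. maximal_wrt lebesgue F x < \<infinity>"
    and nz: "\<not> (AE x in lebesgue. F x = 0)"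
  shows "A1_weight (CR_const (3 ^ CARD('n)) \<tau>) (\<lambda>x. epowr (maximal_wrt lebesgue F x) \<tau>)"
  unfolding A1_weight_def
proof (intro conjI ballI)
  have "0 < maximal_wrt lebesgue F x" for x
    using doubling_measure.maximal_eq_0[OF doubling_measure_lebesgue, of F x] nz by (auto simp: zero_less_iff_neq_zero)
  with fin show "AE x in lebesgue. 0 < epowr (maximal_wrt lebesgue F x) \<tau> \<and> epowr (maximal_wrt lebesgue F x) \<tau> < \<infinity>"
    by (auto intro: epowr_pos epowr_finite elim: eventually_mono)
qed (use \<tau> in \<open>auto simp: CR_const_pos intro: doubling_measure.Coifman_Rochberg[OF doubling_measure_lebesgue, folded CR_const_def] measurable_epowr doubling_measure.borel_measurable_maximal[OF doubling_measure_lebesgue]\<close>)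

text \<open>Coifman-Rochberg in the measure \<open>V dx\<close> bounds the integral over
  \<open>Q\<close> by the value of the power at \<open>x\<close> times \<open>N(Q)\<close>, and the
  A1 property of \<open>V\<close> bounds \<open>N(Q)\<close> in turn. Hence the two constants
  multiply.\<close>

lemma A1_weight_mult_maximal_indicator:
  fixes V :: "real ^ 'n \<Rightarrow> ennreal"
  assumes A1: "A1_weight c V" and \<tau>: "0 < \<tau>" "\<tau> < 1" and [measurable]: "E \<in> sets lebesgue"
    and nz: "0 < emeasure (density lebesgue V) E"
  defines "N \<equiv> density lebesgue V"
  shows "A1_weight (CR_const (c * 3 ^ CARD('n)) \<tau> * c) (\<lambda>x. epowr (maximal_wrt N (indicator E) x) \<tau> * V x)"
proof -
  interpret N: doubling_measure N "c * 3 ^ CARD('n)"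
    unfolding N_def by (rule doubling_measure_A1[OF A1])
  have [measurable]: "V \<in> borel_measurable lebesgue" and c: "0 < c"
    using A1 by (auto simp: A1_weight_def)
  let ?H = "\<lambda>x. epowr (maximal_wrt N (indicator E) x) \<tau>"
  let ?K = "CR_const (c * 3 ^ CARD('n)) \<tau>"
  have K: "0 < ?K" using \<tau> c by (intro CR_const_pos) auto
  have pos: "0 < maximal_wrt N (indicator E) x" for x
  proof (rule ccontr)
    assume "\<not> 0 < maximal_wrt N (indicator E) x"
    then have "AE y in N. indicator E y = (0 :: ennreal)"
      by (intro N.maximal_eq_0[of _ x]) auto
    then have "(\<integral>\<^sup>+y. indicator E y \<partial>N) = (\<integral>\<^sup>+y. 0 \<partial>N)"
      by (rule nn_integral_cong_AE)
    then have "emeasure N E = 0" by simp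
    with nz show False by (simp add: N_def)
  qed
  have le1: "maximal_wrt N (indicator E) x \<le> 1" for x
    by (rule N.maximal_le_imp) (auto intro!: nn_integral_mono simp: indicator_def
        nn_integral_indicator[symmetric] simp del: nn_integral_indicator)
  show ?thesis
    unfolding A1_weight_def
  proof (intro conjI ballI)
    show "0 < ?K * c" using K c by simp
    have "AE x in lebesgue. 0 < V x \<and> V x < \<infinity>" using A1 by (simp add: A1_weight_def)
    then show "AE x in lebesgue. 0 < ?H x * V x \<and> ?H x * V x < \<infinity>"
    proof eventually_elim
      case (elim x)
      have "?H x < \<infinity>"
        unfolding infinity_ennreal_def using le1[of x] by (intro epowr_finite) (auto intro: le_less_trans)
      moreover have "0 < ?H x" by (rule epowr_pos[OF pos])
      ultimately show ?case
        using elim by (simp add: ennreal_zero_less_mult_iff ennreal_mult_less_top)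
    qed
    fix Q x assume Q: "Q \<in> cubes" "x \<in> (Q :: (real ^ 'n) set)"
    then have [measurable]: "Q \<in> sets lebesgue" by simp
    have "(\<integral>\<^sup>+y\<in>Q. ?H y * V y \<partial>lebesgue) = (\<integral>\<^sup>+y\<in>Q. ?H y \<partial>N)"
      unfolding N_def using Q by (subst nn_integral_density) (auto simp: mult_ac N_def[symmetric])
    also have "\<dots> \<le> ennreal ?K * ?H x * emeasure N Q"
      unfolding CR_const_def using \<tau> Q by (intro N.Coifman_Rochberg) auto
    also have "emeasure N Q = (\<integral>\<^sup>+y\<in>Q. V y \<partial>lebesgue)"
      unfolding N_def using Q by (subst emeasure_density) auto
    also have "ennreal ?K * ?H x * \<dots> \<le> ennreal ?K * ?H x * (ennreal c * V x * emeasure lebesgue Q)"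
      using A1 Q by (intro mult_left_mono) (auto simp: A1_weight_def)
    also have "\<dots> = ennreal (?K * c) * (?H x * V x) * emeasure lebesgue Q"
      using K c by (simp add: ennreal_mult mult_ac)
    finally show "(\<integral>\<^sup>+y\<in>Q. ?H y * V y \<partial>lebesgue) \<le> ennreal (?K * c) * (?H x * V x) * emeasure lebesgue Q" .
  qed measurable
qed

text \<open>The easy direction of the factorization of Muckenhoupt weights builds them in this form
  from two A1 weights. \<open>enn2real\<close> intervenes because weights are real-valued, while A1
  weights may be infinite on a null set.\<close>

definition factor_weight :: "real \<Rightarrow> (real ^ 'n \<Rightarrow> ennreal) \<Rightarrow> (real ^ 'n \<Rightarrow> ennreal) \<Rightarrow> real ^ 'n \<Rightarrow> real" where
  "factor_weight p V B x = enn2real (V x) * enn2real (B x) powr (1 - p)"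

lemma measurable_factor_weight [measurable]:
  assumes [measurable]: "V \<in> borel_measurable lebesgue" "B \<in> borel_measurable lebesgue"
  shows "factor_weight p V B \<in> borel_measurable lebesgue"
  unfolding factor_weight_def[abs_def] by measurable

context
  fixes p c d :: real and V B :: "real ^ 'n \<Rightarrow> ennreal"
  assumes p: "1 \<le> p" and V: "A1_weight c V" and B: "A1_weight d B"
begin

private lemma meas: "V \<in> borel_measurable lebesgue" "B \<in> borel_measurable lebesgue"
  and cd: "0 < c" "0 < d"
  using V B by (auto simp: A1_weight_def)

lemma factor_weight_nonneg: "0 \<le> factor_weight p V B x"
  by (simp add: factor_weight_def)

lemma AE_factor_weight_pos: "AE x in lebesgue. 0 < factor_weight p V B x"
proof -
  have "AE x in lebesgue. (0 < V x \<and> V x < \<infinity>) \<and> (0 < B x \<and> B x < \<infinity>)"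
    using V B by (intro AE_conjI) (auto simp: A1_weight_def)
  then show ?thesis
  proof eventually_elim
    case (elim x)
    then have "0 < enn2real (V x)" "0 < enn2real (B x)"
      by (simp_all add: enn2real_positive_iff)
    then show ?case by (simp add: factor_weight_def)
  qed
qed

text \<open>\<open>\<alpha>\<close> and \<open>\<beta>\<close> are the averages of \<open>V\<close>
  and \<open>B\<close> over \<open>Q\<close>. By the A1 property \<open>V \<ge> \<alpha> / c\<close>
  and \<open>B \<ge> \<beta> / d\<close> almost everywhere on \<open>Q\<close>; as
  \<open>1 - p \<le> 0\<close>, the second bound turns into an upper bound for the power of
  \<open>B\<close>.\<close>

lemma factor_weight_cube:
  assumes Q: "Q \<in> cubes"
  obtains \<alpha> \<beta> where "0 < \<alpha>" "0 < \<beta>"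
    "AE x in lebesgue. x \<in> Q \<longrightarrow> \<alpha> / c * (enn2real (B x)) powr (1 - p) \<le> factor_weight p V B x
       \<and> 0 < enn2real (B x)"
    "avg Q (\<lambda>x. ennreal (factor_weight p V B x)) \<le> ennreal (\<alpha> * (\<beta> / d) powr (1 - p))"
    "avg Q B = ennreal \<beta>"
proof -
  note [measurable] = meas
  define k where "k = measure lebesgue Q"
  have k: "emeasure lebesgue Q = ennreal k" "0 < k"
    using emeasure_cubes_lebesgue[OF Q] emeasure_eq_ennreal_measure[of lebesgue Q]
    by (auto simp: k_def less_top)
  have [measurable]: "Q \<in> sets lebesgue" using Q by simp
  have ex: "\<exists>\<alpha>. 0 < \<alpha> \<and> (\<integral>\<^sup>+x\<in>Q. U x \<partial>lebesgue) = ennreal (\<alpha> * k) \<and>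
      (\<forall>x\<in>Q. 0 < U x \<and> U x < \<infinity> \<longrightarrow> \<alpha> / e \<le> enn2real (U x) \<and> 0 < enn2real (U x))"
    if U: "A1_weight e U" for e and U :: "real ^ 'n \<Rightarrow> ennreal"
  proof -
    have e: "0 < e" using U by (simp add: A1_weight_def)
    define a where "a = enn2real (\<integral>\<^sup>+x\<in>Q. U x \<partial>lebesgue)"
    have a: "(\<integral>\<^sup>+x\<in>Q. U x \<partial>lebesgue) = ennreal a" "0 < a"
      using A1_weight_cube[OF U Q] by (auto simp: a_def enn2real_positive_iff)
    have "a / k / e \<le> enn2real (U x) \<and> 0 < enn2real (U x)" if x: "x \<in> Q" "0 < U x" "U x < \<infinity>" for x
    proof -
      define r where "r = enn2real (U x)"
      have r: "U x = ennreal r" "0 < r" using x by (auto simp: r_def enn2real_positive_iff)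
      have "ennreal a \<le> ennreal e * U x * emeasure lebesgue Q"
        using U Q x(1) a(1) unfolding A1_weight_def by metis
      also have "\<dots> = ennreal (e * r * k)"
        using r k e by (simp add: ennreal_mult)
      finally have "a \<le> e * r * k" using e r k by (subst (asm) ennreal_le_iff) auto
      then show ?thesis
        unfolding r_def[symmetric] using e r(2) k(2) by (simp add: pos_divide_le_eq mult_ac)
    qed
    with a k show ?thesis by (intro exI[of _ "a / k"]) auto
  qed
  obtain \<alpha> where \<alpha>: "0 < \<alpha>" "(\<integral>\<^sup>+x\<in>Q. V x \<partial>lebesgue) = ennreal (\<alpha> * k)"
      "\<And>x. x \<in> Q \<Longrightarrow> 0 < V x \<Longrightarrow> V x < \<infinity> \<Longrightarrow> \<alpha> / c \<le> enn2real (V x)"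
    using ex[OF V] by blast
  obtain \<beta> where \<beta>: "0 < \<beta>" "(\<integral>\<^sup>+x\<in>Q. B x \<partial>lebesgue) = ennreal (\<beta> * k)"
      "\<And>x. x \<in> Q \<Longrightarrow> 0 < B x \<Longrightarrow> B x < \<infinity> \<Longrightarrow> \<beta> / d \<le> enn2real (B x) \<and> 0 < enn2real (B x)"
    using ex[OF B] by blast
  have ae: "AE x in lebesgue. (0 < V x \<and> V x < \<infinity>) \<and> (0 < B x \<and> B x < \<infinity>)"
    using V B by (intro AE_conjI) (auto simp: A1_weight_def)
  have 1: "AE x in lebesgue. x \<in> Q \<longrightarrow> \<alpha> / c * (enn2real (B x)) powr (1 - p) \<le> factor_weight p V B x
       \<and> 0 < enn2real (B x)"
    using ae
  proof eventually_elim
    case (elim x)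
    show ?case
      using \<alpha>(3)[of x] \<beta>(3)[of x] elim unfolding factor_weight_def
      by (intro impI conjI mult_right_mono) auto
  qed
  have "(\<integral>\<^sup>+x\<in>Q. ennreal (factor_weight p V B x) \<partial>lebesgue) \<le>
      (\<integral>\<^sup>+x. ennreal ((\<beta> / d) powr (1 - p)) * (V x * indicator Q x) \<partial>lebesgue)"
    using ae
  proof (intro nn_integral_mono_AE, eventually_elim)
    case (elim x)
    show ?case
    proof (cases "x \<in> Q")
      case True
      with elim \<beta> have b: "\<beta> / d \<le> enn2real (B x)" by auto
      then have "enn2real (B x) powr (1 - p) \<le> (\<beta> / d) powr (1 - p)"
        using p \<beta>(1) cd by (intro powr_mono2') auto
      then have "factor_weight p V B x \<le> (\<beta> / d) powr (1 - p) * enn2real (V x)"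
        by (simp add: factor_weight_def mult.commute mult_left_mono)
      then have "ennreal (factor_weight p V B x) \<le> ennreal ((\<beta> / d) powr (1 - p) * enn2real (V x))"
        by (rule ennreal_leI)
      also have "\<dots> = ennreal ((\<beta> / d) powr (1 - p)) * V x"
        using elim by (simp add: ennreal_mult)
      finally show ?thesis using True by simp
    qed simp
  qed
  also have "\<dots> = ennreal ((\<beta> / d) powr (1 - p)) * ennreal (\<alpha> * k)"
    unfolding \<alpha>(2)[symmetric] by (rule nn_integral_cmult) measurable
  also have "\<dots> = ennreal (\<alpha> * (\<beta> / d) powr (1 - p)) * emeasure lebesgue Q"
    unfolding k(1) using \<alpha>(1) k(2) by (simp add: mult_ac flip: ennreal_mult)
  finally have 2: "avg Q (\<lambda>x. ennreal (factor_weight p V B x)) \<le> ennreal (\<alpha> * (\<beta> / d) powr (1 - p))"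
    unfolding avg_def using emeasure_cubes_lebesgue[OF Q]
    by (subst ennreal_divide_le_iff) auto
  have "avg Q B = ennreal \<beta>"
    unfolding avg_def \<beta>(2) k(1) using \<beta>(1) k(2) by (simp add: divide_ennreal)
  with \<alpha>(1) \<beta>(1) 1 2 show thesis by (intro that)
qed

lemma weight_factor_weight: "weight (factor_weight p V B)"
  unfolding weight_def
proof (intro conjI allI impI)
  note [measurable] = meas
  show "factor_weight p V B \<in> borel_measurable lebesgue" by measurable
  show "AE x in lebesgue. 0 < factor_weight p V B x" by (rule AE_factor_weight_pos)
  fix K :: "(real ^ 'n) set" assume K: "compact K"
  obtain a l where al: "0 < l" "K \<subseteq> interior (cube a l)"
    using bounded_subset_interior_cube[OF compact_imp_bounded[OF K]] by blast
  let ?Q = "cube a l"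
  have Q: "?Q \<in> cubes" using al by simp
  have [measurable]: "K \<in> sets lebesgue" using K by (auto dest: compact_imp_closed)
  from factor_weight_cube[OF Q] obtain C where C: "avg ?Q (\<lambda>x. ennreal (factor_weight p V B x)) \<le> ennreal C"
    by blast
  have "(\<integral>\<^sup>+x. ennreal (indicator K x *\<^sub>R factor_weight p V B x) \<partial>lebesgue) \<le>
      (\<integral>\<^sup>+x\<in>?Q. ennreal (factor_weight p V B x) \<partial>lebesgue)"
    using al(2) interior_subset[of ?Q] by (intro nn_integral_mono) (auto simp: indicator_def)
  also have "\<dots> \<le> ennreal C * emeasure lebesgue ?Q"
    using C emeasure_cubes_lebesgue[OF Q] unfolding avg_def by (subst (asm) ennreal_divide_le_iff) auto
  also have "\<dots> < \<infinity>"
    using emeasure_cubes_lebesgue[OF Q] by (simp add: ennreal_mult_less_top)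
  finally show "set_integrable lebesgue K (factor_weight p V B)"
    unfolding set_integrable_def
    by (intro integrableI_nonneg) (auto simp: factor_weight_nonneg)
qed

text \<open>The average of the weight uses the lower bound for \<open>B\<close>, the dual average
  the lower bound for \<open>V\<close>, after which \<open>B\<close> itself remains with average
  \<open>\<beta>\<close>. All powers of \<open>\<alpha>\<close> and \<open>\<beta>\<close> cancel,
  so the bound does not depend on the cube.\<close>

lemma Ap_norm_factor_weight: "Ap_norm p (factor_weight p V B) \<le> ennreal (c * d powr (p - 1))"
proof -
  note [measurable] = meas
  let ?W = "factor_weight p V B"
  show ?thesis
  proof (cases "p = 1")
    case True
    have "avg Q (\<lambda>x. ennreal (?W x)) * esssup (lebesgue_on Q) (\<lambda>x. ennreal (1 / ?W x)) \<le> ennreal c"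
      if Q: "Q \<in> cubes" for Q
    proof -
      have QL: "Q \<in> sets lebesgue" using Q by simp
      obtain \<alpha> \<beta> where ab: "0 < \<alpha>" "0 < \<beta>"
        "AE x in lebesgue. x \<in> Q \<longrightarrow> \<alpha> / c * (enn2real (B x)) powr (1 - p) \<le> ?W x \<and> 0 < enn2real (B x)"
        "avg Q (\<lambda>x. ennreal (?W x)) \<le> ennreal (\<alpha> * (\<beta> / d) powr (1 - p))"
        by (rule factor_weight_cube[OF Q])
      have "AE x in lebesgue_on Q. ennreal (1 / ?W x) \<le> ennreal (c / \<alpha>)"
      proof (subst AE_restrict_space_iff)
        show "Q \<inter> space lebesgue \<in> sets lebesgue" using QL by simp
        show "AE x in lebesgue. x \<in> Q \<longrightarrow> ennreal (1 / ?W x) \<le> ennreal (c / \<alpha>)"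
          using ab(3)
        proof eventually_elim
          case (elim x)
          show ?case
          proof
            assume "x \<in> Q"
            with elim have *: "\<alpha> / c * (enn2real (B x)) powr (1 - p) \<le> ?W x" "0 < enn2real (B x)"
              by blast+
            \<comment> \<open>Positivity of the base is essential, since
              \<open>0 powr 0 = 0\<close>.\<close>
            then have "(enn2real (B x)) powr (1 - p) = 1" by (simp add: True)
            with * have "\<alpha> / c \<le> ?W x" by simp
            moreover have "0 < \<alpha> / c" using ab cd by simp
            ultimately have "1 / ?W x \<le> 1 / (\<alpha> / c)" by (intro frac_le) auto
            then show "ennreal (1 / ?W x) \<le> ennreal (c / \<alpha>)" by (simp add: ennreal_leI)
          qed
        qed
      qed
      then have "esssup (lebesgue_on Q) (\<lambda>x. ennreal (1 / ?W x)) \<le> ennreal (c / \<alpha>)"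
        by (intro esssup_I) (auto intro: measurable_restrict_space1)
      then have "avg Q (\<lambda>x. ennreal (?W x)) * esssup (lebesgue_on Q) (\<lambda>x. ennreal (1 / ?W x))
          \<le> ennreal (\<alpha> * (\<beta> / d) powr (1 - p)) * ennreal (c / \<alpha>)"
        using ab(4) by (intro mult_mono) auto
      also have "\<dots> = ennreal c"
        using ab(1,2) cd True by (simp flip: ennreal_mult)
      finally show ?thesis .
    qed
    then show ?thesis
      using True cd unfolding Ap_norm_def by (auto intro!: SUP_least)
  next
    case False
    with p have p1: "1 < p" by simp
    have "avg Q (\<lambda>x. ennreal (?W x)) * epowr (avg Q (\<lambda>x. ennreal (?W x powr (- 1 / (p - 1))))) (p - 1)
        \<le> ennreal (c * d powr (p - 1))" if Q: "Q \<in> cubes" for Q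
    proof -
      have [measurable]: "Q \<in> sets lebesgue" using Q by simp
      obtain \<alpha> \<beta> where ab: "0 < \<alpha>" "0 < \<beta>"
        "AE x in lebesgue. x \<in> Q \<longrightarrow> \<alpha> / c * (enn2real (B x)) powr (1 - p) \<le> ?W x \<and> 0 < enn2real (B x)"
        "avg Q (\<lambda>x. ennreal (?W x)) \<le> ennreal (\<alpha> * (\<beta> / d) powr (1 - p))"
        "avg Q B = ennreal \<beta>"
        by (rule factor_weight_cube[OF Q])
      \<comment> \<open>Raising \<open>\<alpha> / c * B powr (1 - p)\<close> to the negative power
        \<open>- 1 / (p - 1)\<close> gives \<open>r * B\<close> and reverses the inequality, so the
        dual average is at most \<open>r * \<beta>\<close>.\<close>
      define r where "r = (\<alpha> / c) powr (- 1 / (p - 1))"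
      have "- 1 / (p - 1) * (p - 1) = - 1" using p1 by simp
      then have "r powr (p - 1) = (\<alpha> / c) powr (- 1)" unfolding r_def powr_powr by (rule arg_cong)
      also have "\<dots> = c / \<alpha>" using ab cd by (simp add: powr_minus_divide)
      finally have r: "0 < r" "r powr (p - 1) = c / \<alpha>"
        using ab cd by (simp_all add: r_def)
      have "(\<integral>\<^sup>+x\<in>Q. ennreal (?W x powr (- 1 / (p - 1))) \<partial>lebesgue) \<le>
          (\<integral>\<^sup>+x. ennreal r * (B x * indicator Q x) \<partial>lebesgue)"
        using ab(3)
      proof (intro nn_integral_mono_AE, eventually_elim)
        case (elim x)
        show ?case
        proof (cases "x \<in> Q")
          case True
          let ?b = "enn2real (B x)"
          have b: "0 < ?b" "\<alpha> / c * ?b powr (1 - p) \<le> ?W x" using elim True by auto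
          have "?W x powr (- 1 / (p - 1)) \<le> (\<alpha> / c * ?b powr (1 - p)) powr (- 1 / (p - 1))"
            using b ab cd p1 by (intro powr_mono2') (auto intro!: mult_pos_pos divide_nonpos_pos)
          also have "\<dots> = r * ?b"
          proof -
            have "(1 - p) * (- 1 / (p - 1)) = 1" using p1 by (simp add: divide_simps)
            then have "(?b powr (1 - p)) powr (- 1 / (p - 1)) = ?b powr 1"
              unfolding powr_powr by (rule arg_cong)
            then show ?thesis
              unfolding r_def using ab(1) cd b(1) by (subst powr_mult) simp_all
          qed
          finally have "ennreal (?W x powr (- 1 / (p - 1))) \<le> ennreal (r * ?b)" by (rule ennreal_leI)
          also have "\<dots> \<le> ennreal r * B x"
            using r by (cases "B x") (auto simp: ennreal_mult)
          finally show ?thesis using True by simp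
        qed simp
      qed
      also have "\<dots> = ennreal r * (\<integral>\<^sup>+x\<in>Q. B x \<partial>lebesgue)"
        by (rule nn_integral_cmult) measurable
      finally have "avg Q (\<lambda>x. ennreal (?W x powr (- 1 / (p - 1)))) \<le> ennreal r * avg Q B"
        unfolding avg_def ennreal_times_divide by (rule divide_right_mono_ennreal)
      also have "\<dots> = ennreal (r * \<beta>)"
        using r ab by (simp add: ennreal_mult)
      finally have "epowr (avg Q (\<lambda>x. ennreal (?W x powr (- 1 / (p - 1))))) (p - 1) \<le> epowr (ennreal (r * \<beta>)) (p - 1)"
        using p1 by (intro epowr_mono) auto
      also have "\<dots> = ennreal (c / \<alpha> * \<beta> powr (p - 1))"
        using r ab by (subst epowr_ennreal) (auto simp: powr_mult)
      finally have "avg Q (\<lambda>x. ennreal (?W x)) * epowr (avg Q (\<lambda>x. ennreal (?W x powr (- 1 / (p - 1))))) (p - 1)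
          \<le> ennreal (\<alpha> * (\<beta> / d) powr (1 - p)) * ennreal (c / \<alpha> * \<beta> powr (p - 1))"
        using ab(4) by (intro mult_mono) auto
      also have "\<dots> = ennreal (\<alpha> * (\<beta> / d) powr (1 - p) * (c / \<alpha> * \<beta> powr (p - 1)))"
        using ab(1,2) cd by (intro ennreal_mult[symmetric]) auto
      also have "\<alpha> * (\<beta> / d) powr (1 - p) * (c / \<alpha> * \<beta> powr (p - 1)) = c * d powr (p - 1)"
      proof -
        have "(\<beta> / d) powr (1 - p) = d powr (p - 1) / \<beta> powr (p - 1)"
          using ab(2) cd powr_minus_divide[of "\<beta> / d" "p - 1"] by (simp add: powr_divide)
        then show ?thesis using ab(1,2) cd by (simp add: field_simps)
      qed
      finally show ?thesis .
    qed
    then show ?thesis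
      using False unfolding Ap_norm_def by (auto intro!: SUP_least)
  qed
qed

text \<open>Local boundedness controls \<open>\<phi> t\<close> for \<open>0 < t < K\<close> only, so
  the value 0 of the norm has to be excluded before \<open>\<phi>\<close> can be estimated.\<close>

lemma Ap_norm_factor_weight_pos: "0 < Ap_norm p (factor_weight p V B)"
proof -
  note [measurable] = meas
  let ?W = "factor_weight p V B" and ?Q = "cube 0 1 :: (real ^ 'n) set"
  have Q: "?Q \<in> cubes" and [measurable]: "?Q \<in> sets lebesgue" by simp_all
  have avg_pos: "0 < avg ?Q G" if "AE x in lebesgue. 0 < G x" "G \<in> borel_measurable lebesgue" for G
    unfolding avg_def using nn_integral_cube_pos[OF Q that] emeasure_cubes_lebesgue[OF Q]
    by (simp add: ennreal_zero_less_divide)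
  have avg_W: "0 < avg ?Q (\<lambda>x. ennreal (?W x))"
    using AE_factor_weight_pos by (intro avg_pos) auto
  show ?thesis
  proof (cases "p = 1")
    case True
    have "esssup (lebesgue_on ?Q) (\<lambda>x. ennreal (1 / ?W x)) \<noteq> 0"
    proof
      assume 0: "esssup (lebesgue_on ?Q) (\<lambda>x. ennreal (1 / ?W x)) = 0"
      have "AE x in lebesgue_on ?Q. ennreal (1 / ?W x) \<le> 0"
        using esssup_AE[of "\<lambda>x. ennreal (1 / ?W x)" "lebesgue_on ?Q"] by (simp add: 0)
      then have "AE x in lebesgue. x \<in> ?Q \<longrightarrow> ennreal (1 / ?W x) \<le> 0"
        by (subst (asm) AE_restrict_space_iff) auto
      with AE_factor_weight_pos have "AE x in lebesgue. x \<in> ?Q \<longrightarrow> False"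
        by eventually_elim (auto simp: ennreal_eq_0_iff)
      then show False by (rule ex_in_cube_if_AE[OF Q]) simp
    qed
    with avg_W have "0 < avg ?Q (\<lambda>x. ennreal (?W x)) * esssup (lebesgue_on ?Q) (\<lambda>x. ennreal (1 / ?W x))"
      by (simp add: ennreal_zero_less_mult_iff zero_less_iff_neq_zero)
    with True Q show ?thesis
      unfolding Ap_norm_def by (auto simp: less_SUP_iff)
  next
    case False
    have "0 < avg ?Q (\<lambda>x. ennreal (?W x powr (- 1 / (p - 1))))"
      using AE_factor_weight_pos by (intro avg_pos) (auto elim: eventually_mono)
    with avg_W have "0 < avg ?Q (\<lambda>x. ennreal (?W x)) * epowr (avg ?Q (\<lambda>x. ennreal (?W x powr (- 1 / (p - 1))))) (p - 1)"
      by (simp add: ennreal_zero_less_mult_iff epowr_pos)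
    with False Q show ?thesis
      unfolding Ap_norm_def by (auto simp: less_SUP_iff)
  qed
qed

lemma factor_weight_Ap_class: "factor_weight p V B \<in> Ap_class p"
  using weight_factor_weight Ap_norm_factor_weight
  by (auto simp: Ap_class_def intro: le_less_trans)

end

lemma weak_type_factor_weight:
  fixes f g :: "real ^ 'n \<Rightarrow> real"
  assumes p: "1 \<le> p" and V: "A1_weight c V" and B: "A1_weight d B"
    and K: "c * d powr (p - 1) < K" "\<And>t. 0 < t \<Longrightarrow> t < K \<Longrightarrow> \<phi> t \<le> ennreal \<Phi>" "0 \<le> \<Phi>"
    and hyp: "\<forall>w\<in>Ap_class p. weak_Lp_norm p w (\<lambda>x. ennreal \<bar>g x\<bar>)
            \<le> \<phi> (enn2real (Ap_norm p w)) * Lp_norm p w (\<lambda>x. ennreal \<bar>f x\<bar>)"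
    and f: "\<And>x. 0 \<le> f x" and g: "\<And>x. 0 \<le> g x" and y: "0 < y"
  shows "ennreal (y powr p) * (\<integral>\<^sup>+x\<in>{x. y < g x}. ennreal (factor_weight p V B x) \<partial>lebesgue) \<le>
    ennreal (\<Phi> powr p) * (\<integral>\<^sup>+x. ennreal (f x powr p * factor_weight p V B x) \<partial>lebesgue)"
proof -
  let ?W = "factor_weight p V B"
  let ?X = "\<integral>\<^sup>+x\<in>{x. y < g x}. ennreal (?W x) \<partial>lebesgue"
  let ?Y = "\<integral>\<^sup>+x. ennreal (f x powr p * ?W x) \<partial>lebesgue"
  let ?t = "enn2real (Ap_norm p ?W)"
  have cd: "0 < c" "0 < d" using V B by (auto simp: A1_weight_def)
  note le = Ap_norm_factor_weight[OF p V B]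
  have "Ap_norm p ?W < \<infinity>" using le by (auto intro: le_less_trans)
  then have "0 < ?t"
    using Ap_norm_factor_weight_pos[OF p V B] by (simp add: enn2real_positive_iff)
  moreover have "?t \<le> c * d powr (p - 1)"
    using enn2real_mono[OF le] cd by simp
  ultimately have \<phi>: "\<phi> ?t \<le> ennreal \<Phi>" using K by auto
  have Y: "(\<integral>\<^sup>+x. epowr (ennreal \<bar>f x\<bar>) p * ennreal (?W x) \<partial>lebesgue) = ?Y"
    using f by (intro nn_integral_cong) (simp add: epowr_ennreal ennreal_mult factor_weight_nonneg[OF p V B])
  have X: "(\<integral>\<^sup>+x\<in>{x. ennreal y < ennreal \<bar>g x\<bar>}. ennreal (?W x) \<partial>lebesgue) = ?X"
    using g y by (simp add: ennreal_less_iff)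
  have "ennreal y * epowr ?X (1 / p) \<le> weak_Lp_norm p ?W (\<lambda>x. ennreal \<bar>g x\<bar>)"
    unfolding weak_Lp_norm_def X[symmetric] using y by (intro SUP_upper) auto
  also have "\<dots> \<le> \<phi> ?t * Lp_norm p ?W (\<lambda>x. ennreal \<bar>f x\<bar>)"
    using hyp factor_weight_Ap_class[OF p V B] by blast
  also have "\<dots> \<le> ennreal \<Phi> * epowr ?Y (1 / p)"
    unfolding Lp_norm_def Y by (intro mult_right_mono \<phi>) simp
  finally have "epowr (ennreal y * epowr ?X (1 / p)) p \<le> epowr (ennreal \<Phi> * epowr ?Y (1 / p)) p"
    using p by (intro epowr_mono) auto
  then show ?thesis
    using p y K(3) by (simp add: epowr_mult epowr_epowr epowr_ennreal)
qed

section \<open>Weak type estimates for a pair of functions\<close>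

text \<open>Bundles the hypotheses on \<open>f\<close> and \<open>g\<close>, so that the constants
  below can be chosen before the pair.\<close>

definition weak_pair :: "(real \<Rightarrow> ennreal) \<Rightarrow> real \<Rightarrow> (real ^ 'n \<Rightarrow> real) \<Rightarrow> (real ^ 'n \<Rightarrow> real) \<Rightarrow> bool" where
  "weak_pair \<phi> p f g \<longleftrightarrow> f \<in> borel_measurable lebesgue \<and> g \<in> borel_measurable lebesgue \<and>
    (\<forall>x. 0 \<le> f x) \<and> (\<forall>x. 0 \<le> g x) \<and>
    (\<forall>w \<in> Ap_class p. weak_Lp_norm p w (\<lambda>x. ennreal \<bar>g x\<bar>)
            \<le> \<phi> (enn2real (Ap_norm p w)) * Lp_norm p w (\<lambda>x. ennreal \<bar>f x\<bar>))"

lemma locally_boundedE: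
  assumes "locally_bounded \<phi>" "0 < K"
  obtains \<Phi> where "0 \<le> \<Phi>" "\<And>t. 0 < t \<Longrightarrow> t < K \<Longrightarrow> \<phi> t \<le> ennreal \<Phi>"
proof
  have fin: "(SUP t\<in>{0<..<K}. \<phi> t) < top"
    using assms by (auto simp: locally_bounded_def)
  show "\<phi> t \<le> ennreal (enn2real (SUP t\<in>{0<..<K}. \<phi> t))" if "0 < t" "t < K" for t
    using fin that by (auto intro!: SUP_upper)
qed simp

text \<open>The order of quantifiers is the point: \<open>\<Psi>\<close> is fixed by
  \<open>\<phi>\<close>, \<open>p\<close> and the A1 constants, before the weights and the pair.
  Later \<open>B\<close> is built from \<open>f\<close>, or \<open>V\<close> from a level set of
  \<open>g\<close>, without affecting \<open>\<Psi>\<close>.\<close>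

lemma weak_type_A1:
  assumes "locally_bounded \<phi>" and p: "1 \<le> p" and cd: "0 < c" "0 < d"
  obtains \<Psi> where "0 < \<Psi>" "\<And>V B f g y. A1_weight c V \<Longrightarrow> A1_weight d B \<Longrightarrow> weak_pair \<phi> p f g \<Longrightarrow> 0 < y \<Longrightarrow>
    ennreal (y powr p) * (\<integral>\<^sup>+x\<in>{x. y < g x}. ennreal (enn2real (B x) powr (1 - p)) * V x \<partial>lebesgue) \<le>
    ennreal \<Psi> * (\<integral>\<^sup>+x. ennreal (f x powr p * enn2real (B x) powr (1 - p)) * (V x :: ennreal) \<partial>(lebesgue :: (real ^ 'n) measure))"
proof -
  \<comment> \<open>The added 1 puts the norm, which may equal \<open>c * d powr (p - 1)\<close>,
    strictly inside the interval where \<open>\<phi>\<close> is bounded.\<close>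
  have "0 < c * d powr (p - 1) + 1" using cd by (intro add_nonneg_pos) auto
  then obtain \<Phi> where \<Phi>: "0 \<le> \<Phi>" "\<And>t. 0 < t \<Longrightarrow> t < c * d powr (p - 1) + 1 \<Longrightarrow> \<phi> t \<le> ennreal \<Phi>"
    using locally_boundedE[OF assms(1)] by metis
  show thesis
  proof
    \<comment> \<open>The added 1 keeps the constant positive when
      \<open>\<Phi> = 0\<close>.\<close>
    show "0 < \<Phi> powr p + 1" by (rule add_nonneg_pos) auto
    fix V B :: "real ^ 'n \<Rightarrow> ennreal" and f g :: "real ^ 'n \<Rightarrow> real" and y :: real
    assume V: "A1_weight c V" and B: "A1_weight d B" and fg: "weak_pair \<phi> p f g" and y: "0 < y"
    have V_fin: "AE x in lebesgue. V x < \<infinity>"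
      using V by (auto simp: A1_weight_def elim: eventually_mono)
    have eq: "(\<integral>\<^sup>+x. ennreal (h x * factor_weight p V B x) \<partial>lebesgue) =
        (\<integral>\<^sup>+x. ennreal (h x * enn2real (B x) powr (1 - p)) * V x \<partial>lebesgue)"
      if "\<And>x. 0 \<le> h x" for h :: "real ^ 'n \<Rightarrow> real"
      using V_fin
    proof (intro nn_integral_cong_AE, eventually_elim)
      case (elim x)
      have "ennreal (h x * factor_weight p V B x) = ennreal (h x * enn2real (B x) powr (1 - p)) * ennreal (enn2real (V x))"
        using that[of x] by (simp add: factor_weight_def mult_ac flip: ennreal_mult)
      with elim show ?case by simp
    qed
    have "ennreal (y powr p) * (\<integral>\<^sup>+x\<in>{x. y < g x}. ennreal (factor_weight p V B x) \<partial>lebesgue) \<le>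
      ennreal (\<Phi> powr p) * (\<integral>\<^sup>+x. ennreal (f x powr p * factor_weight p V B x) \<partial>lebesgue)"
      by (rule weak_type_factor_weight[OF p V B _ \<Phi>(2,1) _ _ _ y])
        (use fg in \<open>auto simp: weak_pair_def\<close>)
    moreover have "(\<integral>\<^sup>+x\<in>{x. y < g x}. ennreal (factor_weight p V B x) \<partial>lebesgue) =
      (\<integral>\<^sup>+x\<in>{x. y < g x}. ennreal (enn2real (B x) powr (1 - p)) * V x \<partial>lebesgue)"
    proof -
      have "(\<integral>\<^sup>+x\<in>{x. y < g x}. ennreal (factor_weight p V B x) \<partial>lebesgue) =
          (\<integral>\<^sup>+x. ennreal (indicator {x. y < g x} x * factor_weight p V B x) \<partial>lebesgue)"
        by (intro nn_integral_cong) (auto simp: indicator_def)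
      also have "\<dots> = (\<integral>\<^sup>+x. ennreal (indicator {x. y < g x} x * enn2real (B x) powr (1 - p)) * V x \<partial>lebesgue)"
        by (rule eq) (auto simp: indicator_def)
      also have "\<dots> = (\<integral>\<^sup>+x\<in>{x. y < g x}. ennreal (enn2real (B x) powr (1 - p)) * V x \<partial>lebesgue)"
        by (intro nn_integral_cong) (auto simp: indicator_def)
      finally show ?thesis .
    qed
    moreover have "(\<integral>\<^sup>+x. ennreal (f x powr p * factor_weight p V B x) \<partial>lebesgue) =
       (\<integral>\<^sup>+x. ennreal (f x powr p * enn2real (B x) powr (1 - p)) * V x \<partial>lebesgue)"
      by (rule eq) simp
    ultimately have "ennreal (y powr p) * (\<integral>\<^sup>+x\<in>{x. y < g x}. ennreal (enn2real (B x) powr (1 - p)) * V x \<partial>lebesgue) \<le>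
       ennreal (\<Phi> powr p) * (\<integral>\<^sup>+x. ennreal (f x powr p * enn2real (B x) powr (1 - p)) * V x \<partial>lebesgue)"
      by simp
    also have "\<dots> \<le> ennreal (\<Phi> powr p + 1) * (\<integral>\<^sup>+x. ennreal (f x powr p * enn2real (B x) powr (1 - p)) * V x \<partial>lebesgue)"
      by (intro mult_right_mono ennreal_leI) auto
    finally show "ennreal (y powr p) * (\<integral>\<^sup>+x\<in>{x. y < g x}. ennreal (enn2real (B x) powr (1 - p)) * V x \<partial>lebesgue) \<le>
       ennreal (\<Phi> powr p + 1) * (\<integral>\<^sup>+x. ennreal (f x powr p * enn2real (B x) powr (1 - p)) * V x \<partial>lebesgue)" .
  qed
qed

lemma weak_type_A1_single:
  assumes "locally_bounded \<phi>" and p: "1 \<le> p" and c: "0 < c"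
  obtains \<Psi> where "0 < \<Psi>" "\<And>V f g y. A1_weight c V \<Longrightarrow> weak_pair \<phi> p f g \<Longrightarrow> 0 < y \<Longrightarrow>
    ennreal (y powr p) * (\<integral>\<^sup>+x\<in>{x. y < g x}. V x \<partial>lebesgue) \<le>
    ennreal \<Psi> * (\<integral>\<^sup>+x. ennreal (f x powr p) * V x \<partial>(lebesgue :: (real ^ 'n) measure))"
proof (rule weak_type_A1[OF assms(1) p c zero_less_one])
  fix \<Psi> :: real
  assume "0 < \<Psi>" and *: "\<And>V B f g y. A1_weight c V \<Longrightarrow> A1_weight 1 B \<Longrightarrow> weak_pair \<phi> p f g \<Longrightarrow> 0 < y \<Longrightarrow>
    ennreal (y powr p) * (\<integral>\<^sup>+x\<in>{x. y < g x}. ennreal (enn2real (B x) powr (1 - p)) * V x \<partial>lebesgue) \<le>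
    ennreal \<Psi> * (\<integral>\<^sup>+x. ennreal (f x powr p * enn2real (B x) powr (1 - p)) * (V x :: ennreal) \<partial>(lebesgue :: (real ^ 'n) measure))"
  then show thesis
    by (intro that[of \<Psi>]) (use *[OF _ A1_weight_one] in simp_all)
qed

text \<open>Settles the case in which the maximal function of \<open>f\<close> vanishes and provides
  no A1 weight.\<close>

lemma weak_type_zero:
  fixes V :: "real ^ 'n \<Rightarrow> ennreal"
  assumes "locally_bounded \<phi>" "1 \<le> p" and V: "A1_weight c V" and fg: "weak_pair \<phi> p f g"
    and f0: "AE x in lebesgue. f x = 0" and y: "0 < y"
  shows "(\<integral>\<^sup>+x\<in>{x. y < g x}. V x \<partial>lebesgue) = 0"
proof -
  have c: "0 < c" using V by (simp add: A1_weight_def)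
  obtain \<Psi> where "ennreal (y powr p) * (\<integral>\<^sup>+x\<in>{x. y < g x}. V x \<partial>lebesgue) \<le>
    ennreal \<Psi> * (\<integral>\<^sup>+x. ennreal (f x powr p) * V x \<partial>lebesgue)"
    by (rule weak_type_A1_single[OF assms(1,2) c]) (use V fg y in blast)
  moreover have "(\<integral>\<^sup>+x. ennreal (f x powr p) * V x \<partial>lebesgue) = (\<integral>\<^sup>+x. 0 \<partial>(lebesgue :: (real ^ 'n) measure))"
    by (rule nn_integral_cong_AE) (use f0 in eventually_elim, simp)
  ultimately show ?thesis using y by simp
qed

text \<open>With \<open>m\<close> as in the overview and \<open>r < p\<close>, the factor
  \<open>m powr (r - p)\<close> serves on both sides: it is at least \<open>y powr (r - p)\<close>
  where \<open>m \<le> y\<close>, and \<open>f powr p * m powr (r - p) \<le> f powr r\<close> where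
  \<open>f \<le> m\<close>. Thus an estimate with exponent \<open>p\<close> becomes one with
  exponent \<open>r\<close>.\<close>

lemma weak_type_good_set:
  fixes V :: "real ^ 'n \<Rightarrow> ennreal"
  assumes lb: "locally_bounded \<phi>" and p: "1 \<le> p" and c: "0 < c"
    and r: "r \<le> p" and \<delta>: "0 < \<delta>" "r < p \<Longrightarrow> (p - r) * \<delta> < p - 1"
  obtains C where "0 < C" "\<And>V f g y. A1_weight c V \<Longrightarrow> weak_pair \<phi> p f g \<Longrightarrow> \<not> (AE x in lebesgue. f x = 0) \<Longrightarrow>
    (AE x in lebesgue. HL_maximal (\<lambda>x. f x powr (1 / \<delta>)) x < \<infinity>) \<Longrightarrow> 0 < y \<Longrightarrow>
    ennreal (y powr r) * (\<integral>\<^sup>+x\<in>{x. y < g x \<and> HL_maximal (\<lambda>x. f x powr (1 / \<delta>)) x \<le> ennreal (y powr (1 / \<delta>))}. V x \<partial>lebesgue)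
    \<le> ennreal C * (\<integral>\<^sup>+x. ennreal (f x powr r) * (V x :: ennreal) \<partial>(lebesgue :: (real ^ 'n) measure))"
proof (cases "r = p")
  case True
  obtain \<Psi> where \<Psi>: "0 < \<Psi>" "\<And>V f g y. A1_weight c V \<Longrightarrow> weak_pair \<phi> p f g \<Longrightarrow> 0 < y \<Longrightarrow>
    ennreal (y powr p) * (\<integral>\<^sup>+x\<in>{x. y < g x}. V x \<partial>lebesgue) \<le>
    ennreal \<Psi> * (\<integral>\<^sup>+x. ennreal (f x powr p) * V x \<partial>(lebesgue :: (real ^ 'n) measure))"
    using weak_type_A1_single[OF lb p c] by blast
  show thesis
  proof (rule that[OF \<Psi>(1)])
    fix V :: "real ^ 'n \<Rightarrow> ennreal" and f g :: "real ^ 'n \<Rightarrow> real" and y :: real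
    assume *: "A1_weight c V" "weak_pair \<phi> p f g" "0 < y"
    let ?S = "{x. y < g x \<and> HL_maximal (\<lambda>x. f x powr (1 / \<delta>)) x \<le> ennreal (y powr (1 / \<delta>))}"
    have "ennreal (y powr r) * (\<integral>\<^sup>+x\<in>?S. V x \<partial>lebesgue) \<le> ennreal (y powr r) * (\<integral>\<^sup>+x\<in>{x. y < g x}. V x \<partial>lebesgue)"
      by (intro mult_left_mono nn_integral_mono) (auto simp: indicator_def)
    also have "\<dots> \<le> ennreal \<Psi> * (\<integral>\<^sup>+x. ennreal (f x powr r) * V x \<partial>lebesgue)"
      using \<Psi>(2)[OF *] by (simp add: True)
    finally show "ennreal (y powr r) * (\<integral>\<^sup>+x\<in>?S. V x \<partial>lebesgue) \<le> ennreal \<Psi> * (\<integral>\<^sup>+x. ennreal (f x powr r) * V x \<partial>lebesgue)" .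
  qed
next
  case False
  with r have rp: "r < p" by simp
  \<comment> \<open>Chosen so that the factor \<open>B powr (1 - p)\<close> equals the power
    \<open>r - p\<close> of the overview's \<open>m\<close>; the assumption on
    \<open>\<delta>\<close> says precisely that \<open>\<tau> < 1\<close>.\<close>
  define \<tau> where "\<tau> = (p - r) * \<delta> / (p - 1)"
  have "0 < (p - r) * \<delta>" using rp \<delta>(1) by simp
  then have p1: "0 < p - 1" using \<delta>(2)[OF rp] by linarith
  have \<tau>: "0 < \<tau>" "\<tau> < 1"
    using \<open>0 < (p - r) * \<delta>\<close> \<delta>(2)[OF rp] p1 by (auto simp: \<tau>_def)
  have \<tau>_eq: "\<tau> * (1 - p) = - ((p - r) * \<delta>)"
    using p1 by (simp add: \<tau>_def field_simps)
  have d: "0 < CR_const (3 ^ CARD('n)) \<tau>" using \<tau> by (intro CR_const_pos) auto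
  obtain \<Psi> where \<Psi>: "0 < \<Psi>" "\<And>V B f g y. A1_weight c V \<Longrightarrow> A1_weight (CR_const (3 ^ CARD('n)) \<tau>) B \<Longrightarrow> weak_pair \<phi> p f g \<Longrightarrow> 0 < y \<Longrightarrow>
    ennreal (y powr p) * (\<integral>\<^sup>+x\<in>{x. y < g x}. ennreal (enn2real (B x) powr (1 - p)) * V x \<partial>lebesgue) \<le>
    ennreal \<Psi> * (\<integral>\<^sup>+x. ennreal (f x powr p * enn2real (B x) powr (1 - p)) * V x \<partial>(lebesgue :: (real ^ 'n) measure))"
    using weak_type_A1[OF lb p c d] by blast
  show thesis
  proof (rule that[OF \<Psi>(1)])
    fix V :: "real ^ 'n \<Rightarrow> ennreal" and f g :: "real ^ 'n \<Rightarrow> real" and y :: real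
    assume V: "A1_weight c V" and fg: "weak_pair \<phi> p f g" and nz: "\<not> (AE x in lebesgue. f x = 0)"
      and fin: "AE x in lebesgue. HL_maximal (\<lambda>x. f x powr (1 / \<delta>)) x < \<infinity>" and y: "0 < y"
    have [measurable]: "f \<in> borel_measurable lebesgue" "g \<in> borel_measurable lebesgue" "V \<in> borel_measurable lebesgue"
      and f: "\<And>x. 0 \<le> f x"
      using fg V by (auto simp: weak_pair_def A1_weight_def)
    let ?F = "\<lambda>x. ennreal (f x powr (1 / \<delta>))"
    let ?M = "maximal_wrt lebesgue ?F"
    let ?b = "\<lambda>x. enn2real (epowr (?M x) \<tau>) powr (1 - p)"
    let ?S = "{x. y < g x \<and> HL_maximal (\<lambda>x. f x powr (1 / \<delta>)) x \<le> ennreal (y powr (1 / \<delta>))}"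
    have HL: "HL_maximal (\<lambda>x. f x powr (1 / \<delta>)) = ?M"
      by (simp add: HL_maximal_eq)
    have "\<not> (AE x in lebesgue. ?F x = 0)"
    proof
      assume "AE x in lebesgue. ?F x = 0"
      then have "AE x in lebesgue. f x = 0"
        by eventually_elim (simp add: ennreal_eq_0_iff)
      with nz show False by simp
    qed
    then have B: "A1_weight (CR_const (3 ^ CARD('n)) \<tau>) (\<lambda>x. epowr (?M x) \<tau>)"
      using fin by (intro A1_weight_maximal_powr \<tau>) (auto simp: HL)
    have ae: "AE x in lebesgue. ?F x \<le> ?M x \<and> ?M x < \<infinity> \<and> 0 < epowr (?M x) \<tau>"
      using fin B by (intro AE_conjI doubling_measure.AE_le_maximal[OF doubling_measure_lebesgue])
        (auto simp: HL A1_weight_def elim: eventually_mono)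
    have b: "AE x in lebesgue. f x powr p * ?b x \<le> f x powr r \<and>
        (?M x \<le> ennreal (y powr (1 / \<delta>)) \<longrightarrow> y powr (r - p) \<le> ?b x)"
      using ae
    proof eventually_elim
      case (elim x)
      \<comment> \<open>This \<open>m\<close> is the maximal function of
        \<open>f powr (1 / \<delta>)\<close> itself; the overview's \<open>m\<close> is its power
        \<open>\<delta>\<close>, whence the exponent \<open>- ((p - r) * \<delta>)\<close>.\<close>
      define m where "m = enn2real (?M x)"
      have m: "?M x = ennreal m" "0 \<le> m" using elim by (auto simp: m_def)
      with elim have "0 < m" by (cases "m = 0") auto
      have bx: "?b x = m powr (- ((p - r) * \<delta>))"
        using m(2) by (simp add: m(1) epowr_ennreal powr_powr \<tau>_eq)
      have fm: "f x powr (1 / \<delta>) \<le> m"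
        using elim m by (simp add: ennreal_le_iff)
      have exp: "1 / \<delta> * - ((p - r) * \<delta>) = r - p" using \<delta>(1) by simp
      have "f x powr p * ?b x \<le> f x powr r"
      proof (cases "f x = 0")
        case False
        with f[of x] have f0: "0 < f x" by simp
        have "m powr (- ((p - r) * \<delta>)) \<le> (f x powr (1 / \<delta>)) powr (- ((p - r) * \<delta>))"
          using fm f0 rp \<delta>(1) by (intro powr_mono2') auto
        also have "\<dots> = f x powr (r - p)"
          unfolding powr_powr exp by simp
        finally have "f x powr p * ?b x \<le> f x powr p * f x powr (r - p)"
          unfolding bx by (intro mult_left_mono) auto
        also have "\<dots> = f x powr r" using f0 by (simp flip: powr_add)
        finally show ?thesis .
      qed simp
      moreover have "y powr (r - p) \<le> ?b x" if "?M x \<le> ennreal (y powr (1 / \<delta>))"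
      proof -
        have "m \<le> y powr (1 / \<delta>)" using that m by (simp add: ennreal_le_iff)
        then have "(y powr (1 / \<delta>)) powr (- ((p - r) * \<delta>)) \<le> m powr (- ((p - r) * \<delta>))"
          using \<open>0 < m\<close> rp \<delta>(1) by (intro powr_mono2') auto
        then show ?thesis unfolding bx powr_powr exp .
      qed
      ultimately show ?case by blast
    qed
    have "ennreal (y powr (r - p)) * (\<integral>\<^sup>+x\<in>?S. V x \<partial>lebesgue) = (\<integral>\<^sup>+x. ennreal (y powr (r - p)) * (V x * indicator ?S x) \<partial>lebesgue)"
      unfolding HL by (rule nn_integral_cmult[symmetric])
        (use doubling_measure.borel_measurable_maximal[OF doubling_measure_lebesgue, measurable] in measurable)
    also have "\<dots> \<le> (\<integral>\<^sup>+x\<in>{x. y < g x}. ennreal (?b x) * V x \<partial>lebesgue)"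
      using b unfolding HL
      by (intro nn_integral_mono_AE, eventually_elim) (auto simp: indicator_def intro!: mult_right_mono ennreal_leI)
    finally have "ennreal (y powr p) * (ennreal (y powr (r - p)) * (\<integral>\<^sup>+x\<in>?S. V x \<partial>lebesgue)) \<le>
        ennreal (y powr p) * (\<integral>\<^sup>+x\<in>{x. y < g x}. ennreal (?b x) * V x \<partial>lebesgue)"
      by (rule mult_left_mono) simp
    also have "\<dots> \<le> ennreal \<Psi> * (\<integral>\<^sup>+x. ennreal (f x powr p * ?b x) * V x \<partial>lebesgue)"
      by (rule \<Psi>(2)[OF V B fg y])
    also have "\<dots> \<le> ennreal \<Psi> * (\<integral>\<^sup>+x. ennreal (f x powr r) * V x \<partial>lebesgue)"
      using b by (intro mult_left_mono nn_integral_mono_AE, eventually_elim) (auto intro!: mult_right_mono ennreal_leI)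
    finally show "ennreal (y powr r) * (\<integral>\<^sup>+x\<in>?S. V x \<partial>lebesgue) \<le> ennreal \<Psi> * (\<integral>\<^sup>+x. ennreal (f x powr r) * V x \<partial>lebesgue)"
      using y by (simp add: mult.assoc[symmetric] ennreal_mult[symmetric] powr_add[symmetric])
  qed
qed

section \<open>Extrapolation to larger exponents\<close>

lemma Young_absorb:
  fixes a k \<eta> \<Psi> :: real
  assumes "1 < a" "k = a / (a - 1)" "0 < \<eta>" "0 < \<Psi>"
  obtains C where "0 < C" "\<And>x h. 0 \<le> x \<Longrightarrow> 0 \<le> h \<Longrightarrow> \<Psi> * (x * h) \<le> C * x powr a + \<eta> * h powr k"
proof
  \<comment> \<open>Young's inequality is applied to \<open>(\<Psi> / s * x) * (s * h)\<close>; as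
    \<open>s powr k = \<eta>\<close>, the term in \<open>h\<close> gets the prescribed small
    constant at the expense of the term in \<open>x\<close>.\<close>
  let ?s = "\<eta> powr (1 / k)"
  have k: "1 < k" "1 / a + 1 / k = 1"
    using assms(1) by (auto simp: assms(2) field_simps)
  have s: "0 < ?s" using assms(3) by simp
  show "0 < (\<Psi> / ?s) powr a" using s assms by simp
  fix x h :: real assume xh: "0 \<le> x" "0 \<le> h"
  have "\<Psi> * (x * h) = (\<Psi> / ?s * x) * (?s * h)" using s by simp
  also have "\<dots> \<le> (\<Psi> / ?s * x) powr a / a + (?s * h) powr k / k"
    using assms k xh s by (intro Youngs_inequality) auto
  also have "\<dots> \<le> (\<Psi> / ?s * x) powr a + (?s * h) powr k"
    using assms(1) k by (intro add_mono) (auto simp: divide_le_eq mult_le_cancel_left1)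
  also have "(\<Psi> / ?s * x) powr a = (\<Psi> / ?s) powr a * x powr a"
    using assms s xh by (intro powr_mult)
  also have "(?s * h) powr k = \<eta> * h powr k"
    using assms(3) k xh s by (simp add: powr_mult powr_powr)
  finally show "\<Psi> * (x * h) \<le> (\<Psi> / ?s) powr a * x powr a + \<eta> * h powr k" .
qed

text \<open>Half of \<open>X\<close> can be subtracted only if \<open>X\<close> is finite, which is
  why the extrapolation below starts from pieces of the level set of finite measure.\<close>

lemma ennreal_half_absorb:
  fixes X R :: ennreal
  assumes "X \<le> R + ennreal (1 / 2) * X" "X < top"
  shows "X \<le> 2 * R"
proof (cases R)
  case (real \<rho>)
  define \<xi> where "\<xi> = enn2real X"
  have \<xi>: "X = ennreal \<xi>" "0 \<le> \<xi>" using assms(2) by (simp_all add: \<xi>_def)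
  have "ennreal (\<rho> + 1 / 2 * \<xi>) = ennreal \<rho> + ennreal (1 / 2 * \<xi>)"
    using real \<xi> by (intro ennreal_plus) auto
  also have "ennreal (1 / 2 * \<xi>) = ennreal (1 / 2) * ennreal \<xi>"
    using \<xi> by (intro ennreal_mult) auto
  finally have "ennreal \<xi> \<le> ennreal (\<rho> + 1 / 2 * \<xi>)"
    using assms(1) real(2) \<xi>(1) by simp
  then have "\<xi> \<le> \<rho> + 1 / 2 * \<xi>" using real \<xi>(2) by (subst (asm) ennreal_le_iff) auto
  then have "ennreal \<xi> \<le> ennreal (2 * \<rho>)" by (intro ennreal_leI) simp
  then show ?thesis using real \<xi> by (simp add: ennreal_mult)
qed (simp add: ennreal_mult_top)

text \<open>For \<open>p < r\<close> the weight \<open>V\<close> alone would need extrapolation upwards. Multiplying \<open>V\<close> by a power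
  of the maximal function, taken with respect to the measure \<open>V dx\<close>, of the indicator of the level
  set \<open>E\<close> gives a weight of \<open>A\<^sub>1\<close> that dominates \<open>V\<close> on \<open>E\<close>, while its excess is absorbed by Young's inequality.\<close>

lemma weak_type_extrapolated:
  assumes lb: "locally_bounded \<phi>" and p: "1 \<le> p" and c: "0 < c" and pr: "p < r"
  obtains C where "0 < C" "\<And>V f g y. A1_weight c V \<Longrightarrow> weak_pair \<phi> p f g \<Longrightarrow> 0 < y \<Longrightarrow>
    ennreal (y powr r) * (\<integral>\<^sup>+x\<in>{x. y < g x}. V x \<partial>lebesgue)
    \<le> ennreal C * (\<integral>\<^sup>+x. ennreal (f x powr r) * (V x :: ennreal) \<partial>(lebesgue :: (real ^ 'n) measure))"
proof -
  define a where "a = r / p"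
  define k where "k = a / (a - 1)"
  \<comment> \<open>Midpoint of \<open>1 / k\<close> and 1: \<open>\<tau> < 1\<close> yields an A1
    weight by Coifman-Rochberg, and \<open>\<tau> * k > 1\<close> admits the strong type bound for
    the power that Young's inequality creates.\<close>
  define \<tau> where "\<tau> = (1 + 1 / k) / 2"
  define D where "D = c * 3 ^ CARD('n)"
  have a: "1 < a" using p pr by (simp add: a_def)
  have k: "1 < k" using a by (simp add: k_def)
  have \<tau>: "0 < \<tau>" "\<tau> < 1" using k by (auto simp: \<tau>_def add_pos_pos)
  have "\<tau> * k = (k + 1) / 2" using k by (simp add: \<tau>_def field_simps)
  with k have \<tau>k: "1 < \<tau> * k" by simp
  have D: "0 < D" using c by (simp add: D_def)
  define c' where "c' = CR_const D \<tau> * c"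
  have c': "0 < c'" using CR_const_pos[OF D \<tau>] c by (simp add: c'_def)
  \<comment> \<open>\<open>K\<close> is the strong type constant at exponent
    \<open>\<tau> * k\<close>. Young's inequality with \<open>\<eta> = 1 / (2 * K)\<close> then
    returns exactly half of \<open>N(E)\<close>.\<close>
  define K where "K = D * (\<tau> * k) / (\<tau> * k - 1)"
  have K: "0 < K" using D \<tau>k by (simp add: K_def)
  obtain \<Psi> where \<Psi>: "0 < \<Psi>" "\<And>V f g y. A1_weight c' V \<Longrightarrow> weak_pair \<phi> p f g \<Longrightarrow> 0 < y \<Longrightarrow>
    ennreal (y powr p) * (\<integral>\<^sup>+x\<in>{x. y < g x}. V x \<partial>lebesgue) \<le>
    ennreal \<Psi> * (\<integral>\<^sup>+x. ennreal (f x powr p) * V x \<partial>(lebesgue :: (real ^ 'n) measure))"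
    using weak_type_A1_single[OF lb p c'] by blast
  have "0 < 1 / (2 * K)" using K by simp
  then obtain C where C: "0 < C"
    "\<And>x h. 0 \<le> x \<Longrightarrow> 0 \<le> h \<Longrightarrow> \<Psi> * (x * h) \<le> C * x powr a + 1 / (2 * K) * h powr k"
    using Young_absorb[OF a k_def _ \<Psi>(1)] by metis
  show thesis
  proof (rule that[of "2 * C"])
    show "0 < 2 * C" using C by simp
    fix V :: "real ^ 'n \<Rightarrow> ennreal" and f g :: "real ^ 'n \<Rightarrow> real" and y :: real
    assume V: "A1_weight c V" and fg: "weak_pair \<phi> p f g" and y: "0 < y"
    have [measurable]: "f \<in> borel_measurable lebesgue" "g \<in> borel_measurable lebesgue" "V \<in> borel_measurable lebesgue"
      and f: "\<And>x. 0 \<le> f x"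
      using fg V by (auto simp: weak_pair_def A1_weight_def)
    define N where "N = density lebesgue V"
    interpret N: doubling_measure N D
      unfolding N_def D_def by (rule doubling_measure_A1[OF V])
    have intN: "(\<integral>\<^sup>+x. G x \<partial>N) = (\<integral>\<^sup>+x. G x * V x \<partial>lebesgue)" if "G \<in> borel_measurable lebesgue" for G
      unfolding N_def using that by (subst nn_integral_density) (auto simp: mult.commute)
    let ?R = "\<integral>\<^sup>+x. ennreal ((f x / y) powr r) \<partial>N"
    have bd: "emeasure N E \<le> 2 * (ennreal C * ?R)"
      if E: "E \<subseteq> {x. y < g x}" "E \<in> sets lebesgue" "emeasure N E < \<infinity>" for E
    proof (cases "emeasure N E = 0")
      case False
      note [measurable] = E(2)
      let ?M = "maximal_wrt N (indicator E)"
      let ?H = "\<lambda>x. epowr (?M x) \<tau>"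
      have le1: "?M x \<le> 1" for x
        by (rule N.maximal_le_imp) (auto intro!: nn_integral_mono simp: indicator_def
            nn_integral_indicator[symmetric] simp del: nn_integral_indicator)
      have HV: "A1_weight c' (\<lambda>x. ?H x * V x)"
        unfolding c'_def D_def N_def
        using False by (intro A1_weight_mult_maximal_indicator V \<tau>) (auto simp: N_def zero_less_iff_neq_zero)
      have "AE x in N. (indicator E x :: ennreal) \<le> ?M x"
        by (rule N.AE_le_maximal) measurable
      then have "AE x in N. indicator E x \<le> ?H x * indicator {x. y < g x} x"
      proof eventually_elim
        case (elim x)
        show ?case
        proof (cases "x \<in> E")
          case True
          with elim have "epowr 1 \<tau> \<le> ?H x" using \<tau> by (intro epowr_mono) auto
          with True E(1) show ?thesis by auto
        qed simp
      qed
      then have "(\<integral>\<^sup>+x. indicator E x \<partial>N) \<le> (\<integral>\<^sup>+x\<in>{x. y < g x}. ?H x \<partial>N)"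
        by (rule nn_integral_mono_AE)
      then have "ennreal (y powr p) * emeasure N E \<le> ennreal (y powr p) * (\<integral>\<^sup>+x\<in>{x. y < g x}. ?H x * V x \<partial>lebesgue)"
        by (intro mult_left_mono) (simp_all add: intN mult_ac)
      also have "\<dots> \<le> ennreal \<Psi> * (\<integral>\<^sup>+x. ennreal (f x powr p) * (?H x * V x) \<partial>lebesgue)"
        using \<Psi>(2)[OF HV fg y] by simp
      also have "(\<integral>\<^sup>+x. ennreal (f x powr p) * (?H x * V x) \<partial>lebesgue) = (\<integral>\<^sup>+x. ennreal (f x powr p) * ?H x \<partial>N)"
        by (subst intN) (simp_all add: mult.assoc)
      finally have "ennreal (1 / y powr p) * (ennreal (y powr p) * emeasure N E) \<le>
          ennreal (1 / y powr p) * (ennreal \<Psi> * (\<integral>\<^sup>+x. ennreal (f x powr p) * ?H x \<partial>N))"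
        by (rule mult_left_mono) simp
      then have "emeasure N E \<le> ennreal (1 / y powr p) * (ennreal \<Psi> * (\<integral>\<^sup>+x. ennreal (f x powr p) * ?H x \<partial>N))"
        using y by (simp add: mult.assoc[symmetric] ennreal_mult[symmetric])
      also have "\<dots> = (\<integral>\<^sup>+x. ennreal (1 / y powr p) * (ennreal \<Psi> * (ennreal (f x powr p) * ?H x)) \<partial>N)"
        by (simp add: nn_integral_cmult N.borel_measurable_N)
      also have "\<dots> \<le> (\<integral>\<^sup>+x. ennreal C * ennreal ((f x / y) powr r) + ennreal (1 / (2 * K)) * epowr (?M x) (\<tau> * k) \<partial>N)"
      proof (intro nn_integral_mono)
        fix x
        define h where "h = enn2real (?H x)"
        have "?M x < top" using le1[of x] by (auto intro: le_less_trans)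
        then have "?H x < top" by (rule epowr_finite)
        then have h: "?H x = ennreal h" "0 \<le> h" by (auto simp: h_def)
        have "ennreal (1 / y powr p) * (ennreal \<Psi> * (ennreal (f x powr p) * ?H x)) =
            ennreal (\<Psi> * ((f x / y) powr p * h))"
          using \<Psi>(1) h y f[of x] by (simp add: powr_divide mult_ac flip: ennreal_mult)
        also have "\<dots> \<le> ennreal (C * ((f x / y) powr p) powr a + 1 / (2 * K) * h powr k)"
          using C(2)[of "(f x / y) powr p" h] h by (intro ennreal_leI) auto
        also have "((f x / y) powr p) powr a = (f x / y) powr r"
          using p by (simp add: powr_powr a_def)
        also have "ennreal (C * (f x / y) powr r + 1 / (2 * K) * h powr k) =
            ennreal C * ennreal ((f x / y) powr r) + ennreal (1 / (2 * K)) * ennreal (h powr k)"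
        proof -
          have "ennreal (C * (f x / y) powr r) = ennreal C * ennreal ((f x / y) powr r)"
            "ennreal (1 / (2 * K) * h powr k) = ennreal (1 / (2 * K)) * ennreal (h powr k)"
            using C(1) K by (auto intro!: ennreal_mult simp del: times_divide_eq_left)
          then show ?thesis
            using C(1) K by (subst ennreal_plus) (auto simp del: times_divide_eq_left)
        qed
        also have "ennreal (h powr k) = epowr (?M x) (\<tau> * k)"
          by (metis epowr_ennreal epowr_epowr h)
        finally show "ennreal (1 / y powr p) * (ennreal \<Psi> * (ennreal (f x powr p) * ?H x)) \<le>
          ennreal C * ennreal ((f x / y) powr r) + ennreal (1 / (2 * K)) * epowr (?M x) (\<tau> * k)" .
      qed
      also have "\<dots> = ennreal C * ?R + ennreal (1 / (2 * K)) * (\<integral>\<^sup>+x. epowr (?M x) (\<tau> * k) \<partial>N)"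
        by (subst nn_integral_add) (auto simp: nn_integral_cmult N.borel_measurable_N)
      also have "\<dots> \<le> ennreal C * ?R + ennreal (1 / (2 * K)) * (ennreal K * emeasure N E)"
        unfolding K_def using \<tau>k by (intro add_left_mono mult_left_mono N.nn_integral_maximal_indicator) auto
      also have "\<dots> = ennreal C * ?R + ennreal (1 / 2) * emeasure N E"
        using K by (simp add: mult.assoc[symmetric] ennreal_mult[symmetric])
      finally show ?thesis
        using E(3) by (intro ennreal_half_absorb) auto
    qed simp
    \<comment> \<open>The level set may have infinite measure, so the bound is proved on bounded
      pieces, with a constant independent of the piece, and passed to the limit.\<close>
    define E where "E n = {x. y < g x} \<inter> cube (\<chi> i. - real (Suc n)) (2 * real (Suc n))" for n
    have gy: "{x. y < g x} \<in> sets lebesgue"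
    proof -
      have "{x \<in> space lebesgue. y < g x} \<in> sets lebesgue" by measurable
      then show ?thesis by simp
    qed
    have E: "E n \<in> sets lebesgue" "emeasure N (E n) < \<infinity>" for n
    proof -
      have Q: "cube (\<chi> i. - real (Suc n)) (2 * real (Suc n)) \<in> cubes" by simp
      show 1: "E n \<in> sets lebesgue" unfolding E_def using gy Q by (intro sets.Int) auto
      have "emeasure N (E n) \<le> emeasure N (cube (\<chi> i. - real (Suc n)) (2 * real (Suc n)))"
        using 1 Q by (intro emeasure_mono) (auto simp: E_def)
      also have "\<dots> < \<infinity>" using Q by (rule N.emeasure_cubes_finite)
      finally show "emeasure N (E n) < \<infinity>" .
    qed
    have "incseq E"
    proof (intro incseq_SucI subsetI)
      fix n x assume x: "x \<in> E n"
      then have "- real (Suc n) \<le> x $ i \<and> x $ i \<le> - real (Suc n) + 2 * real (Suc n)" for i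
        unfolding E_def Int_iff mem_cube vec_lambda_beta by blast
      then have "- real (Suc (Suc n)) \<le> x $ i \<and> x $ i \<le> - real (Suc (Suc n)) + 2 * real (Suc (Suc n))" for i
        by (smt (verit) of_nat_Suc)
      with x show "x \<in> E (Suc n)"
        unfolding E_def Int_iff mem_cube vec_lambda_beta by blast
    qed
    have UE: "(\<Union>n. E n) = {x. y < g x}"
    proof
      show "{x. y < g x} \<subseteq> (\<Union>n. E n)"
      proof
        fix x assume x: "x \<in> {x. y < g x}"
        obtain n where n: "norm x \<le> real n" using real_arch_simple by blast
        have "- real (Suc n) \<le> x $ i \<and> x $ i \<le> real (Suc n)" for i
          using component_le_norm_cart[of x i] n by auto
        then have "x \<in> E n" using x by (simp add: E_def mem_cube)
        then show "x \<in> (\<Union>n. E n)" by blast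
      qed
    qed (auto simp: E_def)
    have "emeasure N {x. y < g x} = (SUP n. emeasure N (E n))"
      unfolding UE[symmetric] using E \<open>incseq E\<close> by (intro SUP_emeasure_incseq[symmetric]) auto
    also have "\<dots> \<le> 2 * (ennreal C * ?R)"
      by (intro SUP_least bd E) (auto simp: E_def)
    also have "emeasure N {x. y < g x} = (\<integral>\<^sup>+x\<in>{x. y < g x}. V x \<partial>lebesgue)"
      unfolding N_def using gy by (subst emeasure_density) auto
    finally have "ennreal (y powr r) * (\<integral>\<^sup>+x\<in>{x. y < g x}. V x \<partial>lebesgue) \<le> ennreal (y powr r) * (2 * (ennreal C * ?R))"
      by (rule mult_left_mono) simp
    also have "\<dots> = ennreal (2 * C) * (ennreal (y powr r) * ?R)"
      using C by (simp add: ennreal_mult mult_ac)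
    also have "ennreal (y powr r) * ?R = (\<integral>\<^sup>+x. ennreal (y powr r) * ennreal ((f x / y) powr r) \<partial>N)"
      by (rule nn_integral_cmult[symmetric]) (simp add: N.borel_measurable_N)
    also have "\<dots> = (\<integral>\<^sup>+x. ennreal (f x powr r) \<partial>N)"
      using y f by (intro nn_integral_cong) (simp add: powr_divide flip: ennreal_mult)
    also have "\<dots> = (\<integral>\<^sup>+x. ennreal (f x powr r) * V x \<partial>lebesgue)"
      by (rule intN) measurable
    finally show "ennreal (y powr r) * (\<integral>\<^sup>+x\<in>{x. y < g x}. V x \<partial>lebesgue) \<le>
      ennreal (2 * C) * (\<integral>\<^sup>+x. ennreal (f x powr r) * V x \<partial>lebesgue)" .
  qed
qed

section \<open>The two-weight estimate\<close>

text \<open>A finite norm against a weight that is positive almost everywhere forces the maximal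
  function to be finite almost everywhere, the input needed for the A1 property. Domination of
  \<open>v\<close> follows from that of \<open>v powr (1 / \<mu>)\<close>.\<close>

lemma A1_weight_HL_maximal_mu:
  fixes u v :: "real ^ 'n \<Rightarrow> real"
  assumes u: "weight u" and v: "weight v" and \<mu>: "0 < \<mu>" "\<mu> < 1" and P: "0 < P"
    and in_Lp: "in_Lp P (\<lambda>x. u x powr b) (HL_maximal_mu \<mu> v)"
  shows "A1_weight (CR_const (3 ^ CARD('n)) \<mu>) (HL_maximal_mu \<mu> v)"
    "AE x in lebesgue. ennreal (v x) \<le> HL_maximal_mu \<mu> v x"
proof -
  have [measurable]: "u \<in> borel_measurable lebesgue" "v \<in> borel_measurable lebesgue"
    and pos: "AE x in lebesgue. 0 < u x" "AE x in lebesgue. 0 < v x"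
    using u v by (auto simp: weight_def)
  let ?F = "\<lambda>x. ennreal (\<bar>v x\<bar> powr (1 / \<mu>))"
  let ?M = "maximal_wrt lebesgue ?F"
  have V: "HL_maximal_mu \<mu> v = (\<lambda>x. epowr (?M x) \<mu>)"
    by (simp add: fun_eq_iff HL_maximal_mu_def HL_maximal_eq)
  let ?I = "\<integral>\<^sup>+x. epowr (epowr (?M x) \<mu>) P * ennreal (u x powr b) \<partial>lebesgue"
  have "epowr ?I (1 / P) < \<infinity>"
    using in_Lp by (simp add: in_Lp_def Lp_norm_def V)
  then have I: "?I \<noteq> \<infinity>" by auto
  have [measurable]: "?M \<in> borel_measurable lebesgue"
    by (rule doubling_measure.borel_measurable_maximal[OF doubling_measure_lebesgue])
  have "(\<lambda>x. u x powr b) \<in> borel_measurable lebesgue" by measurable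
  then have "AE x in lebesgue. epowr (epowr (?M x) \<mu>) P * ennreal (u x powr b) \<noteq> \<infinity>"
    by (intro nn_integral_noteq_infinite I) measurable
  with pos(1) have fin: "AE x in lebesgue. ?M x < \<infinity>"
  proof eventually_elim
    case (elim x)
    show ?case
    proof (rule ccontr)
      assume "\<not> ?M x < \<infinity>"
      then have "?M x = top" by (simp add: less_top[symmetric])
      with elim show False by (simp add: ennreal_top_mult ennreal_eq_0_iff)
    qed
  qed
  have nz: "\<not> (AE x in lebesgue. ?F x = 0)"
  proof
    assume "AE x in lebesgue. ?F x = 0"
    with pos(2) have "AE x in lebesgue. 0 < v x \<and> ?F x = 0"
      by (rule AE_conjI)
    then show False
      by (rule ex_in_cube_if_AE[OF cube_in_cubes[OF zero_less_one, of 0]]) (auto simp: ennreal_eq_0_iff)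
  qed
  show "A1_weight (CR_const (3 ^ CARD('n)) \<mu>) (HL_maximal_mu \<mu> v)"
    unfolding V by (intro A1_weight_maximal_powr \<mu> fin nz) measurable
  have "AE x in lebesgue. ?F x \<le> ?M x"
    by (rule doubling_measure.AE_le_maximal[OF doubling_measure_lebesgue]) measurable
  with pos(2) show "AE x in lebesgue. ennreal (v x) \<le> HL_maximal_mu \<mu> v x"
  proof eventually_elim
    case (elim x)
    have "ennreal (v x) = epowr (?F x) \<mu>"
      using elim \<mu> by (simp add: epowr_ennreal powr_powr)
    also have "\<dots> \<le> epowr (?M x) \<mu>"
      using elim \<mu> by (intro epowr_mono) auto
    finally show ?case by (simp add: V)
  qed
qed

text \<open>Insert \<open>u powr (r / p)\<close> and its inverse and use the conjugate exponents
  \<open>p / r\<close> and \<open>p / (p - r)\<close>. The exponent of \<open>u\<close> in the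
  second term is \<open>- r / (p - r) = 1 - p / (p - r)\<close>, the dual weight of the
  hypotheses.\<close>

lemma Young_weighted:
  fixes x v u r p :: real
  assumes "1 \<le> r" "r < p" "0 \<le> x" "0 \<le> v" "0 < u"
  shows "x powr r * v \<le> x powr p * u + v powr (p / (p - r)) * u powr (1 - p / (p - r))"
proof -
  have "x powr r * v = (x powr r * u powr (r / p)) * (v * u powr (- (r / p)))"
    using assms by (simp add: mult_ac flip: powr_add)
  also have "\<dots> \<le> (x powr r * u powr (r / p)) powr (p / r) / (p / r) + (v * u powr (- (r / p))) powr (p / (p - r)) / (p / (p - r))"
    using assms by (intro Youngs_inequality) (auto simp: field_simps)
  also have "\<dots> \<le> (x powr r * u powr (r / p)) powr (p / r) + (v * u powr (- (r / p))) powr (p / (p - r))"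
  proof -
    have aux: "X / a \<le> X" if "0 \<le> X" "1 \<le> a" for X a :: real
      using that by (simp add: divide_le_eq mult_le_cancel_left1)
    then show ?thesis
      using assms by (intro add_mono aux) auto
  qed
  also have "(x powr r * u powr (r / p)) powr (p / r) = x powr p * u"
    using assms by (simp add: powr_mult powr_powr)
  also have "(v * u powr (- (r / p))) powr (p / (p - r)) = v powr (p / (p - r)) * u powr (- (r / p) * (p / (p - r)))"
    using assms by (subst powr_mult) (simp_all add: powr_powr)
  also have "- (r / p) * (p / (p - r)) = 1 - p / (p - r)"
    using assms by (simp add: field_simps)
  finally show ?thesis .
qed

text \<open>Hoelder's inequality in pointwise form: Young's inequality is applied to
  \<open>f / A\<close>, whose first term integrates to at most 1, and the factor
  \<open>A powr r\<close> restores homogeneity.\<close>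

lemma nn_integral_Young_weighted:
  fixes f u :: "real ^ 'n \<Rightarrow> real" and V :: "real ^ 'n \<Rightarrow> ennreal"
  assumes r: "1 \<le> r" "r < p" and A: "0 < A"
    and [measurable]: "f \<in> borel_measurable lebesgue" "u \<in> borel_measurable lebesgue" "V \<in> borel_measurable lebesgue"
    and f: "\<And>x. 0 \<le> f x" and u: "AE x in lebesgue. 0 < u x" and V: "AE x in lebesgue. V x < \<infinity>"
    and le: "(\<integral>\<^sup>+x. ennreal (f x powr p) * ennreal (u x) \<partial>lebesgue) \<le> ennreal (A powr p)"
  shows "(\<integral>\<^sup>+x. ennreal (f x powr r) * V x \<partial>lebesgue) \<le>
    ennreal (A powr r) * (1 + (\<integral>\<^sup>+x. epowr (V x) (p / (p - r)) * ennreal (u x powr (1 - p / (p - r))) \<partial>lebesgue))"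
proof -
  let ?P = "p / (p - r)"
  have "(\<integral>\<^sup>+x. ennreal (f x powr r) * V x \<partial>lebesgue) \<le>
     (\<integral>\<^sup>+x. ennreal (A powr r) * (ennreal (1 / A powr p) * (ennreal (f x powr p) * ennreal (u x)) +
        epowr (V x) ?P * ennreal (u x powr (1 - ?P))) \<partial>lebesgue)"
    using u V
  proof (intro nn_integral_mono_AE, eventually_elim)
    case (elim x)
    define v where "v = enn2real (V x)"
    have v: "V x = ennreal v" "0 \<le> v" using elim by (auto simp: v_def)
    have "f x powr r * v = A powr r * ((f x / A) powr r * v)"
      using A f[of x] by (simp add: powr_divide)
    also have "\<dots> \<le> A powr r * ((f x / A) powr p * u x + v powr ?P * u x powr (1 - ?P))"
      using r A f[of x] elim v by (intro mult_left_mono Young_weighted) auto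
    also have "(f x / A) powr p * u x = 1 / A powr p * (f x powr p * u x)"
      using A f[of x] by (simp add: powr_divide)
    finally have "ennreal (f x powr r * v) \<le> ennreal (A powr r * (1 / A powr p * (f x powr p * u x) + v powr ?P * u x powr (1 - ?P)))"
      by (rule ennreal_leI)
    also have "\<dots> = ennreal (A powr r) * (ennreal (1 / A powr p * (f x powr p * u x)) + ennreal (v powr ?P * u x powr (1 - ?P)))"
      using elim A by (subst ennreal_mult) auto
    also have "ennreal (1 / A powr p * (f x powr p * u x)) = ennreal (1 / A powr p) * (ennreal (f x powr p) * ennreal (u x))"
      using elim by (subst ennreal_mult) (auto simp: ennreal_mult)
    also have "ennreal (v powr ?P * u x powr (1 - ?P)) = epowr (V x) ?P * ennreal (u x powr (1 - ?P))"
      using v by (simp add: epowr_ennreal ennreal_mult)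
    also have "ennreal (f x powr r * v) = ennreal (f x powr r) * V x"
      using v by (simp add: ennreal_mult)
    finally show ?case .
  qed
  also have "\<dots> = ennreal (A powr r) * (ennreal (1 / A powr p) * (\<integral>\<^sup>+x. ennreal (f x powr p) * ennreal (u x) \<partial>lebesgue) +
      (\<integral>\<^sup>+x. epowr (V x) ?P * ennreal (u x powr (1 - ?P)) \<partial>lebesgue))"
    by (simp add: nn_integral_cmult nn_integral_add)
  also have "\<dots> \<le> ennreal (A powr r) * (ennreal (1 / A powr p) * ennreal (A powr p) +
      (\<integral>\<^sup>+x. epowr (V x) ?P * ennreal (u x powr (1 - ?P)) \<partial>lebesgue))"
    by (intro mult_left_mono add_right_mono le) auto
  also have "ennreal (1 / A powr p) * ennreal (A powr p) = 1"
    using A by (simp flip: ennreal_mult)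
  finally show ?thesis .
qed

text \<open>The boundedness is applied to \<open>f powr (1 / \<delta>)\<close> at the level
  \<open>y powr (1 / \<delta>)\<close>. Its norm with exponent \<open>\<delta> * p\<close> is the
  power \<open>1 / \<delta>\<close> of the norm of \<open>f\<close>, so \<open>\<delta>\<close>
  survives only in the constant.\<close>

lemma Apq_level_set:
  fixes u v :: "real ^ 'n \<Rightarrow> real"
  assumes apq: "Apq (\<delta> * p) (\<delta> * q) u v" and \<delta>: "0 < \<delta>" and p: "0 < p" and q: "0 < q"
  obtains C where "0 < C" "\<And>f A y. f \<in> borel_measurable lebesgue \<Longrightarrow> (\<And>x. 0 \<le> f x) \<Longrightarrow> 0 < A \<Longrightarrow> 0 < y \<Longrightarrow>
    (\<integral>\<^sup>+x. ennreal (f x powr p) * ennreal (u x) \<partial>lebesgue) \<le> ennreal (A powr p) \<Longrightarrow>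
    (\<integral>\<^sup>+x\<in>{x. ennreal (y powr (1 / \<delta>)) < HL_maximal (\<lambda>x. f x powr (1 / \<delta>)) x}. ennreal (v x) \<partial>lebesgue)
      \<le> ennreal (C * (A / y) powr q)"
proof -
  obtain C where C: "0 < C" "\<And>f. f \<in> borel_measurable lebesgue \<Longrightarrow>
      weak_Lp_norm (\<delta> * q) v (HL_maximal f) \<le> ennreal C * Lp_norm (\<delta> * p) u (\<lambda>x. ennreal \<bar>f x\<bar>)"
    using apq by (auto simp: Apq_def)
  show thesis
  proof
    show "0 < C powr (\<delta> * q)" using C by simp
    fix f :: "real ^ 'n \<Rightarrow> real" and A y :: real
    assume [measurable]: "f \<in> borel_measurable lebesgue" and f: "\<And>x. 0 \<le> f x" and A: "0 < A" and y: "0 < y"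
      and le: "(\<integral>\<^sup>+x. ennreal (f x powr p) * ennreal (u x) \<partial>lebesgue) \<le> ennreal (A powr p)"
    let ?h = "\<lambda>x. f x powr (1 / \<delta>)"
    let ?t = "y powr (1 / \<delta>)"
    let ?X = "\<integral>\<^sup>+x\<in>{x. ennreal ?t < HL_maximal ?h x}. ennreal (v x) \<partial>lebesgue"
    have "epowr (ennreal \<bar>?h x\<bar>) (\<delta> * p) = ennreal (f x powr p)" for x
      using \<delta> by (simp add: epowr_ennreal powr_powr)
    then have Lp: "Lp_norm (\<delta> * p) u (\<lambda>x. ennreal \<bar>?h x\<bar>) \<le> ennreal (A powr (1 / \<delta>))"
      unfolding Lp_norm_def using epowr_mono[OF le, of "1 / (\<delta> * p)"] \<delta> p by (simp add: epowr_ennreal powr_powr)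
    have "ennreal ?t * epowr ?X (1 / (\<delta> * q)) \<le> weak_Lp_norm (\<delta> * q) v (HL_maximal ?h)"
      unfolding weak_Lp_norm_def using y by (intro SUP_upper) auto
    also have "\<dots> \<le> ennreal C * Lp_norm (\<delta> * p) u (\<lambda>x. ennreal \<bar>?h x\<bar>)"
      by (rule C(2)) measurable
    also have "\<dots> \<le> ennreal C * ennreal (A powr (1 / \<delta>))"
      by (intro mult_left_mono Lp) simp
    finally have "ennreal (1 / ?t) * (ennreal ?t * epowr ?X (1 / (\<delta> * q))) \<le> ennreal (1 / ?t) * (ennreal C * ennreal (A powr (1 / \<delta>)))"
      by (rule mult_left_mono) simp
    moreover have "ennreal (1 / ?t) * (ennreal ?t * epowr ?X (1 / (\<delta> * q))) = epowr ?X (1 / (\<delta> * q))"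
      using y by (simp add: mult.assoc[symmetric] ennreal_mult[symmetric])
    moreover have "ennreal (1 / ?t) * (ennreal C * ennreal (A powr (1 / \<delta>))) = ennreal (C * (A / y) powr (1 / \<delta>))"
      using y A C(1) by (simp add: powr_divide mult_ac flip: ennreal_mult)
    ultimately have "epowr ?X (1 / (\<delta> * q)) \<le> ennreal (C * (A / y) powr (1 / \<delta>))" by simp
    then have "?X \<le> epowr (ennreal (C * (A / y) powr (1 / \<delta>))) (\<delta> * q)"
      using \<delta> q by (subst (asm) epowr_le_iff) auto
    also have "\<dots> = ennreal (C powr (\<delta> * q) * (A / y) powr q)"
      using C(1) A y \<delta> by (subst epowr_ennreal) (auto simp: powr_mult powr_powr)
    finally show "?X \<le> ennreal (C powr (\<delta> * q) * (A / y) powr q)" .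
  qed
qed

text \<open>The set where the maximal function is infinite lies in every level set, and their
  \<open>v\<close>-measures tend to 0 as \<open>y\<close> grows. As \<open>v > 0\<close> almost
  everywhere, this set is null for Lebesgue measure.\<close>

lemma AE_HL_maximal_finite:
  fixes v :: "real ^ 'n \<Rightarrow> real"
  assumes v: "weight v" and A: "0 < A" and q: "0 < q" and \<delta>: "0 < \<delta>"
    and le: "\<And>y. 0 < y \<Longrightarrow> (\<integral>\<^sup>+x\<in>{x. ennreal (y powr (1 / \<delta>)) < HL_maximal h x}. ennreal (v x) \<partial>lebesgue)
      \<le> ennreal (C * (A / y) powr q)"
  shows "AE x in lebesgue. HL_maximal h x < \<infinity>"
proof -
  have [measurable]: "v \<in> borel_measurable lebesgue" and pos: "AE x in lebesgue. 0 < v x"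
    using v by (auto simp: weight_def)
  have [measurable]: "HL_maximal h \<in> borel_measurable lebesgue"
    unfolding HL_maximal_eq by (rule doubling_measure.borel_measurable_maximal[OF doubling_measure_lebesgue])
  let ?X = "\<integral>\<^sup>+x. ennreal (v x) * indicator {x. HL_maximal h x = \<infinity>} x \<partial>lebesgue"
  have "?X \<le> ennreal (C * (A / real (Suc n)) powr q)" for n
  proof -
    have "?X \<le> (\<integral>\<^sup>+x\<in>{x. ennreal (real (Suc n) powr (1 / \<delta>)) < HL_maximal h x}. ennreal (v x) \<partial>lebesgue)"
      by (intro nn_integral_mono) (auto simp: indicator_def)
    also have "\<dots> \<le> ennreal (C * (A / real (Suc n)) powr q)"
      by (rule le) simp
    finally show ?thesis .
  qed
  moreover have "(\<lambda>n. C * (A / real (Suc n)) powr q) \<longlonglongrightarrow> C * 0"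
  proof (rule tendsto_mult_left)
    have "(\<lambda>n. A / real (Suc n)) \<longlonglongrightarrow> 0"
      using LIMSEQ_Suc[OF lim_const_over_n[of A]] by simp
    then show "(\<lambda>n. (A / real (Suc n)) powr q) \<longlonglongrightarrow> 0"
      using A q by (intro tendsto_zero_powrI[where b = q]) auto
  qed
  then have "(\<lambda>n. ennreal (C * (A / real (Suc n)) powr q)) \<longlonglongrightarrow> ennreal (C * 0)"
    by (rule tendsto_ennrealI)
  ultimately have "?X \<le> ennreal (C * 0)"
    by (intro LIMSEQ_le_const) auto
  then have "?X = 0" by simp
  then have "AE x in lebesgue. ennreal (v x) * indicator {x. HL_maximal h x = \<infinity>} x = 0"
    by (subst (asm) nn_integral_0_iff_AE) measurable
  with pos show ?thesis
    by eventually_elim (auto simp: indicator_def ennreal_eq_0_iff less_top split: if_splits)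
qed

text \<open>Both powers of \<open>A / y\<close> are kept: \<open>r\<close> comes from the estimate
  for \<open>g\<close> against \<open>V\<close>, \<open>q\<close> from the level set of the maximal
  function. Which one prevails depends on the size of \<open>A / y\<close> and is decided only in
  the theorem.\<close>

lemma weak_type_two_weight:
  fixes u v :: "real ^ 'n \<Rightarrow> real"
  assumes p0: "1 \<le> p0" and lb: "locally_bounded \<phi>" and u: "weight u" and v: "weight v"
    and q: "0 < q" and r: "1 \<le> r" "r < p"
    and \<delta>: "0 < \<delta>" "r < p0 \<Longrightarrow> (p0 - r) * \<delta> < p0 - 1" and apq: "Apq (\<delta> * p) (\<delta> * q) u v"
    and \<mu>: "0 < \<mu>" "\<mu> < 1"
    and in_Lp: "in_Lp (p / (p - r)) (\<lambda>x. u x powr (1 - p / (p - r))) (HL_maximal_mu \<mu> v)"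
  obtains C where "0 < C" "\<And>f g A y. weak_pair \<phi> p0 f g \<Longrightarrow> 0 < A \<Longrightarrow> 0 < y \<Longrightarrow>
    (\<integral>\<^sup>+x. ennreal (f x powr p) * ennreal (u x) \<partial>lebesgue) \<le> ennreal (A powr p) \<Longrightarrow>
    (\<integral>\<^sup>+x\<in>{x. y < g x}. ennreal (v x) \<partial>lebesgue) \<le> ennreal (C * ((A / y) powr r + (A / y) powr q))"
proof -
  let ?P = "p / (p - r)"
  let ?V = "HL_maximal_mu \<mu> v"
  define c where "c = CR_const (3 ^ CARD('n)) \<mu>"
  have P: "0 < ?P" using r by simp
  have V: "A1_weight c ?V" "AE x in lebesgue. ennreal (v x) \<le> ?V x"
    unfolding c_def using A1_weight_HL_maximal_mu[OF u v \<mu> P in_Lp] by auto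
  have c: "0 < c" using V by (simp add: A1_weight_def)
  have [measurable]: "u \<in> borel_measurable lebesgue" "v \<in> borel_measurable lebesgue" "?V \<in> borel_measurable lebesgue"
    and u_pos: "AE x in lebesgue. 0 < u x" and V_fin: "AE x in lebesgue. ?V x < \<infinity>"
    using u v V by (auto simp: weight_def A1_weight_def elim: eventually_mono)
  let ?J = "\<integral>\<^sup>+x. epowr (?V x) ?P * ennreal (u x powr (1 - ?P)) \<partial>lebesgue"
  have "epowr ?J (1 / ?P) < \<infinity>" using in_Lp by (simp add: in_Lp_def Lp_norm_def)
  then have "?J \<noteq> \<infinity>" by auto
  then obtain J where J: "?J = ennreal J" "0 \<le> J" by (cases ?J) auto
  have Young: "(\<integral>\<^sup>+x. ennreal (f x powr r) * ?V x \<partial>lebesgue) \<le> ennreal (A powr r * (1 + J))"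
    if "weak_pair \<phi> p0 f g" "0 < A"
      "(\<integral>\<^sup>+x. ennreal (f x powr p) * ennreal (u x) \<partial>lebesgue) \<le> ennreal (A powr p)" for f g A
  proof -
    have "(\<integral>\<^sup>+x. ennreal (f x powr r) * ?V x \<partial>lebesgue) \<le> ennreal (A powr r) * (1 + ?J)"
      using that by (intro nn_integral_Young_weighted r u_pos V_fin) (auto simp: weak_pair_def)
    also have "\<dots> = ennreal (A powr r * (1 + J))"
      unfolding J(1) using J(2) by (simp add: ennreal_mult)
    finally show ?thesis .
  qed
  have divide: "X \<le> ennreal (C * (1 + J) * (A / y) powr r)"
    if "ennreal (y powr r) * X \<le> ennreal C * I" "I \<le> ennreal (A powr r * (1 + J))" "0 < C" "0 < A" "0 < y"
    for X I :: ennreal and C A y :: real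
  proof -
    have "ennreal (1 / y powr r) * (ennreal (y powr r) * X) \<le> ennreal (1 / y powr r) * (ennreal C * ennreal (A powr r * (1 + J)))"
      using that by (intro mult_left_mono order.trans[OF that(1)]) auto
    moreover have "ennreal (1 / y powr r) * (ennreal (y powr r) * X) = X"
      using that by (simp add: mult.assoc[symmetric] ennreal_mult[symmetric])
    moreover have "ennreal (1 / y powr r) * (ennreal C * ennreal (A powr r * (1 + J))) = ennreal (C * (1 + J) * (A / y) powr r)"
      using that J(2) by (simp add: powr_divide mult_ac flip: ennreal_mult)
    ultimately show ?thesis by simp
  qed
  have v_le: "(\<integral>\<^sup>+x\<in>S. ennreal (v x) \<partial>lebesgue) \<le> (\<integral>\<^sup>+x\<in>S. ?V x \<partial>lebesgue)" for S
    using V(2) by (intro nn_integral_mono_AE) (auto elim!: eventually_mono intro: mult_right_mono)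
  show thesis
  proof (cases "p0 < r")
    case True
    obtain C where C: "0 < C" "\<And>V f g y. A1_weight c V \<Longrightarrow> weak_pair \<phi> p0 f g \<Longrightarrow> 0 < y \<Longrightarrow>
      ennreal (y powr r) * (\<integral>\<^sup>+x\<in>{x. y < g x}. V x \<partial>lebesgue)
      \<le> ennreal C * (\<integral>\<^sup>+x. ennreal (f x powr r) * (V x :: ennreal) \<partial>(lebesgue :: (real ^ 'n) measure))"
      using weak_type_extrapolated[OF lb p0 c True] by blast
    show thesis
    proof
      show "0 < C * (1 + J)" using C J by simp
      fix f g :: "real ^ 'n \<Rightarrow> real" and A y :: real
      assume fg: "weak_pair \<phi> p0 f g" and A: "0 < A" and y: "0 < y"
        and le: "(\<integral>\<^sup>+x. ennreal (f x powr p) * ennreal (u x) \<partial>lebesgue) \<le> ennreal (A powr p)"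
      have "(\<integral>\<^sup>+x\<in>{x. y < g x}. ?V x \<partial>lebesgue) \<le> ennreal (C * (1 + J) * (A / y) powr r)"
        by (rule divide[OF C(2)[OF V(1) fg y] Young[OF fg A le] C(1) A y])
      also have "\<dots> \<le> ennreal (C * (1 + J) * ((A / y) powr r + (A / y) powr q))"
        using C J by (intro ennreal_leI mult_left_mono) auto
      finally show "(\<integral>\<^sup>+x\<in>{x. y < g x}. ennreal (v x) \<partial>lebesgue) \<le> \<dots>"
        using v_le by (rule order.trans[rotated])
    qed
  next
    case False
    then have r_le: "r \<le> p0" by simp
    obtain C1 where C1: "0 < C1" "\<And>V f g y. A1_weight c V \<Longrightarrow> weak_pair \<phi> p0 f g \<Longrightarrow> \<not> (AE x in lebesgue. f x = 0) \<Longrightarrow>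
      (AE x in lebesgue. HL_maximal (\<lambda>x. f x powr (1 / \<delta>)) x < \<infinity>) \<Longrightarrow> 0 < y \<Longrightarrow>
      ennreal (y powr r) * (\<integral>\<^sup>+x\<in>{x. y < g x \<and> HL_maximal (\<lambda>x. f x powr (1 / \<delta>)) x \<le> ennreal (y powr (1 / \<delta>))}. V x \<partial>lebesgue)
      \<le> ennreal C1 * (\<integral>\<^sup>+x. ennreal (f x powr r) * (V x :: ennreal) \<partial>(lebesgue :: (real ^ 'n) measure))"
      using weak_type_good_set[OF lb p0 c r_le \<delta>] by blast
    have p: "0 < p" using r by simp
    obtain C2 where C2: "0 < C2" "\<And>f A y. f \<in> borel_measurable lebesgue \<Longrightarrow> (\<And>x. 0 \<le> f x) \<Longrightarrow> 0 < A \<Longrightarrow> 0 < y \<Longrightarrow>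
      (\<integral>\<^sup>+x. ennreal (f x powr p) * ennreal (u x) \<partial>lebesgue) \<le> ennreal (A powr p) \<Longrightarrow>
      (\<integral>\<^sup>+x\<in>{x. ennreal (y powr (1 / \<delta>)) < HL_maximal (\<lambda>x. f x powr (1 / \<delta>)) x}. ennreal (v x) \<partial>lebesgue)
        \<le> ennreal (C2 * (A / y) powr q)"
      using Apq_level_set[OF apq \<delta>(1) p q] by blast
    show thesis
    proof
      have "0 < 1 + J" using J(2) by simp
      then show "0 < C1 * (1 + J) + C2" using C1(1) C2(1) by (simp add: add_pos_pos)
      fix f g :: "real ^ 'n \<Rightarrow> real" and A y :: real
      assume fg: "weak_pair \<phi> p0 f g" and A: "0 < A" and y: "0 < y"
        and le: "(\<integral>\<^sup>+x. ennreal (f x powr p) * ennreal (u x) \<partial>lebesgue) \<le> ennreal (A powr p)"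
      have [measurable]: "f \<in> borel_measurable lebesgue" "g \<in> borel_measurable lebesgue" and f: "\<And>x. 0 \<le> f x"
        using fg by (auto simp: weak_pair_def)
      let ?h = "\<lambda>x. f x powr (1 / \<delta>)"
      have [measurable]: "HL_maximal ?h \<in> borel_measurable lebesgue"
        unfolding HL_maximal_eq by (rule doubling_measure.borel_measurable_maximal[OF doubling_measure_lebesgue])
      show "(\<integral>\<^sup>+x\<in>{x. y < g x}. ennreal (v x) \<partial>lebesgue) \<le> ennreal ((C1 * (1 + J) + C2) * ((A / y) powr r + (A / y) powr q))"
      proof (cases "AE x in lebesgue. f x = 0")
        case True
        with v_le[of "{x. y < g x}"] weak_type_zero[OF lb p0 V(1) fg True y] show ?thesis by simp
      next
        case False
        let ?S = "{x. y < g x \<and> HL_maximal ?h x \<le> ennreal (y powr (1 / \<delta>))}"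
        let ?T = "{x. ennreal (y powr (1 / \<delta>)) < HL_maximal ?h x}"
        have T: "(\<integral>\<^sup>+x\<in>?T. ennreal (v x) \<partial>lebesgue) \<le> ennreal (C2 * (A / y) powr q)"
          by (rule C2(2)[OF _ f A y le]) measurable
        have fin: "AE x in lebesgue. HL_maximal ?h x < \<infinity>"
          by (rule AE_HL_maximal_finite[OF v A q \<delta>(1) C2(2)[OF _ f A _ le]]) measurable
        have S: "(\<integral>\<^sup>+x\<in>?S. ?V x \<partial>lebesgue) \<le> ennreal (C1 * (1 + J) * (A / y) powr r)"
          by (rule divide[OF C1(2)[OF V(1) fg False fin y] Young[OF fg A le] C1(1) A y])
        have "(\<integral>\<^sup>+x\<in>{x. y < g x}. ennreal (v x) \<partial>lebesgue) \<le>
            (\<integral>\<^sup>+x. ennreal (v x) * indicator ?S x + ennreal (v x) * indicator ?T x \<partial>lebesgue)"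
          by (intro nn_integral_mono) (auto simp: indicator_def)
        also have "\<dots> = (\<integral>\<^sup>+x\<in>?S. ennreal (v x) \<partial>lebesgue) + (\<integral>\<^sup>+x\<in>?T. ennreal (v x) \<partial>lebesgue)"
          by (rule nn_integral_add) measurable
        also have "\<dots> \<le> ennreal (C1 * (1 + J) * (A / y) powr r) + ennreal (C2 * (A / y) powr q)"
          by (intro add_mono T order.trans[OF v_le S])
        also have "\<dots> = ennreal (C1 * (1 + J) * (A / y) powr r + C2 * (A / y) powr q)"
          using C1 C2 J by (intro ennreal_plus[symmetric]) auto
        also have "\<dots> \<le> ennreal ((C1 * (1 + J) + C2) * ((A / y) powr r + (A / y) powr q))"
          using C1 C2 J by (intro ennreal_leI) (simp add: algebra_simps)
        finally show ?thesis .
      qed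
    qed
  qed
qed

theorem theorem3p7:
  fixes p0 p q :: real
    and \<phi> :: "real \<Rightarrow> ennreal"
    and u v :: "real ^ 'n \<Rightarrow> real"
  assumes "1 \<le> p0"
    and "locally_bounded \<phi>"
    and "0 < q" and "q < 1" and "1 < p"
    and "weight u" and "weight v"
    and "integrable lebesgue v"
    and "(\<exists>\<delta>. 0 < \<delta> \<and> \<delta> < 1 \<and> Apq (\<delta> * p) (\<delta> * q) u v \<and>
            (\<exists>\<mu>. 0 < \<mu> \<and> \<mu> < 1 \<and>
               (let p' = p / (p - 1) in
                in_Lp p' (\<lambda>x. u x powr (1 - p')) (HL_maximal_mu \<mu> v)))) \<or>
         (Apq p q u v \<and>
          (\<exists>s. 1 < s \<and> s < p \<and>
            (\<exists>\<mu>. 0 < \<mu> \<and> \<mu> < 1 \<and>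
               in_Lp (p / (p - s)) (\<lambda>x. u x powr (1 - p / (p - s))) (HL_maximal_mu \<mu> v))))"
  shows "\<exists>C::real. 0 < C \<and>
    (\<forall>f g :: real ^ 'n \<Rightarrow> real.
       f \<in> borel_measurable lebesgue \<longrightarrow> g \<in> borel_measurable lebesgue \<longrightarrow>
       (\<forall>x. 0 \<le> f x) \<longrightarrow> (\<forall>x. 0 \<le> g x) \<longrightarrow>
       (\<forall>w \<in> Ap_class p0.
          weak_Lp_norm p0 w (\<lambda>x. ennreal \<bar>g x\<bar>)
            \<le> \<phi> (enn2real (Ap_norm p0 w)) * Lp_norm p0 w (\<lambda>x. ennreal \<bar>f x\<bar>)) \<longrightarrow>
       weak_Lp_norm q v (\<lambda>x. ennreal \<bar>g x\<bar>) \<le> ennreal C * Lp_norm p u (\<lambda>x. ennreal \<bar>f x\<bar>))"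
proof -
  note p0 = assms(1) and lb = assms(2) and q = assms(3,4) and p = assms(5) and u = assms(6) and v = assms(7)
  \<comment> \<open>The inequality \<open>(p0 - r) * \<delta> < p0 - 1\<close> is the common form of
    the two cases: for \<open>r = 1\<close> it reads \<open>\<delta> < 1\<close>, for
    \<open>\<delta> = 1\<close> and \<open>r = s\<close> it reads \<open>1 < s\<close>.\<close>
  have "\<exists>r \<delta> \<mu>. 1 \<le> r \<and> r < p \<and> 0 < \<delta> \<and> (r < p0 \<longrightarrow> (p0 - r) * \<delta> < p0 - 1) \<and> Apq (\<delta> * p) (\<delta> * q) u v \<and>
    0 < \<mu> \<and> \<mu> < 1 \<and> in_Lp (p / (p - r)) (\<lambda>x. u x powr (1 - p / (p - r))) (HL_maximal_mu \<mu> v)"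
    using assms(9)
  proof (elim disjE exE conjE)
    fix \<delta> \<mu>
    assume "0 < \<delta>" "\<delta> < 1" "Apq (\<delta> * p) (\<delta> * q) u v" "0 < \<mu>" "\<mu> < 1"
      "let p' = p / (p - 1) in in_Lp p' (\<lambda>x. u x powr (1 - p')) (HL_maximal_mu \<mu> v)"
    with p show ?thesis
      by (intro exI[of _ 1] exI[of _ \<delta>] exI[of _ \<mu>]) (auto simp: Let_def)
  next
    fix s \<mu>
    assume "Apq p q u v" "1 < s" "s < p" "0 < \<mu>" "\<mu> < 1"
      "in_Lp (p / (p - s)) (\<lambda>x. u x powr (1 - p / (p - s))) (HL_maximal_mu \<mu> v)"
    then show ?thesis
      by (intro exI[of _ s] exI[of _ 1] exI[of _ \<mu>]) auto
  qed
  then obtain r \<delta> \<mu> where r: "1 \<le> r" "r < p" and \<delta>: "0 < \<delta>" "r < p0 \<Longrightarrow> (p0 - r) * \<delta> < p0 - 1"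
    and apq: "Apq (\<delta> * p) (\<delta> * q) u v" and \<mu>: "0 < \<mu>" "\<mu> < 1"
    and in_Lp: "in_Lp (p / (p - r)) (\<lambda>x. u x powr (1 - p / (p - r))) (HL_maximal_mu \<mu> v)"
    by blast
  obtain C where C: "0 < C" "\<And>f g A y. weak_pair \<phi> p0 f g \<Longrightarrow> 0 < A \<Longrightarrow> 0 < y \<Longrightarrow>
    (\<integral>\<^sup>+x. ennreal (f x powr p) * ennreal (u x) \<partial>lebesgue) \<le> ennreal (A powr p) \<Longrightarrow>
    (\<integral>\<^sup>+x\<in>{x. y < g x}. ennreal (v x) \<partial>lebesgue) \<le> ennreal (C * ((A / y) powr r + (A / y) powr q))"
    using weak_type_two_weight[OF p0 lb u v q(1) r \<delta> apq \<mu> in_Lp] by blast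
  have v_pos: "AE x in lebesgue. 0 < v x" using v by (simp add: weight_def)
  have "(\<integral>\<^sup>+x. ennreal (v x) \<partial>lebesgue) = ennreal (integral\<^sup>L lebesgue v)"
    using assms(8) v_pos by (intro nn_integral_eq_integral) (auto elim: eventually_mono)
  moreover define \<nu> where "\<nu> = \<bar>integral\<^sup>L lebesgue v\<bar>"
  ultimately have \<nu>: "(\<integral>\<^sup>+x. ennreal (v x) \<partial>lebesgue) \<le> ennreal \<nu>" "0 \<le> \<nu>"
    by (auto intro: ennreal_leI)
  \<comment> \<open>\<open>2 * C\<close> serves \<open>A \<le> y\<close>, where both powers of
    \<open>A / y\<close> are at most \<open>(A / y) powr q\<close>; \<open>\<nu>\<close> serves
    \<open>y < A\<close>, where that power is at least 1 and the total mass of \<open>v\<close>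
    suffices.\<close>
  define C' where "C' = (2 * C + \<nu>) powr (1 / q)"
  have C': "0 < C'" unfolding C'_def using C(1) \<nu>(2) by (simp add: add_pos_nonneg)
  have main: "ennreal y * epowr (\<integral>\<^sup>+x\<in>{x. y < g x}. ennreal (v x) \<partial>lebesgue) (1 / q) \<le> ennreal (C' * A)"
    if fg: "weak_pair \<phi> p0 f g" and A: "0 < A" and y: "0 < y"
      and le: "(\<integral>\<^sup>+x. ennreal (f x powr p) * ennreal (u x) \<partial>lebesgue) \<le> ennreal (A powr p)" for f g A y
  proof -
    let ?X = "\<integral>\<^sup>+x\<in>{x. y < g x}. ennreal (v x) \<partial>lebesgue"
    let ?z = "A / y"
    have z: "0 < ?z" using A y by simp
    have "?X \<le> ennreal ((2 * C + \<nu>) * ?z powr q)"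
    proof (cases "?z \<le> 1")
      case True
      have "?z powr r \<le> ?z powr q"
        using True z r q by (intro powr_mono') auto
      then have "C * (?z powr r + ?z powr q) \<le> C * (2 * ?z powr q)"
        using C(1) by (intro mult_left_mono) auto
      also have "\<dots> \<le> (2 * C + \<nu>) * ?z powr q"
        using \<nu>(2) by (simp add: algebra_simps)
      finally have "ennreal (C * (?z powr r + ?z powr q)) \<le> ennreal ((2 * C + \<nu>) * ?z powr q)"
        by (rule ennreal_leI)
      with C(2)[OF fg A y le] show ?thesis by (rule order.trans)
    next
      case False
      have "?X \<le> (\<integral>\<^sup>+x. ennreal (v x) \<partial>lebesgue)"
        by (intro nn_integral_mono) (auto simp: indicator_def)
      also note \<nu>(1)
      also have "\<nu> \<le> (2 * C + \<nu>) * ?z powr q"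
      proof -
        have "1 \<le> ?z powr q" using False q by (intro ge_one_powr_ge_zero) auto
        then have "\<nu> * 1 \<le> (2 * C + \<nu>) * ?z powr q"
          using C(1) \<nu>(2) by (intro mult_mono) auto
        then show ?thesis by simp
      qed
      then have "ennreal \<nu> \<le> ennreal ((2 * C + \<nu>) * ?z powr q)" by (rule ennreal_leI)
      finally show ?thesis .
    qed
    then have "epowr ?X (1 / q) \<le> epowr (ennreal ((2 * C + \<nu>) * ?z powr q)) (1 / q)"
      using q by (intro epowr_mono) auto
    also have "\<dots> = ennreal (C' * ?z)"
      using C(1) \<nu>(2) A y q by (subst epowr_ennreal) (auto simp: C'_def powr_mult powr_powr)
    finally have "ennreal y * epowr ?X (1 / q) \<le> ennreal y * ennreal (C' * ?z)"
      by (rule mult_left_mono) simp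
    also have "\<dots> = ennreal (C' * A)"
      using C' A y by (simp flip: ennreal_mult)
    finally show ?thesis .
  qed
  show ?thesis
  proof (intro exI[of _ C'] conjI C' allI impI)
    fix f g :: "real ^ 'n \<Rightarrow> real"
    assume fg: "f \<in> borel_measurable lebesgue" "g \<in> borel_measurable lebesgue" "\<forall>x. 0 \<le> f x" "\<forall>x. 0 \<le> g x"
      "\<forall>w \<in> Ap_class p0. weak_Lp_norm p0 w (\<lambda>x. ennreal \<bar>g x\<bar>)
            \<le> \<phi> (enn2real (Ap_norm p0 w)) * Lp_norm p0 w (\<lambda>x. ennreal \<bar>f x\<bar>)"
    then have pair: "weak_pair \<phi> p0 f g" by (simp add: weak_pair_def)
    let ?L = "Lp_norm p u (\<lambda>x. ennreal \<bar>f x\<bar>)"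
    let ?I = "\<integral>\<^sup>+x. ennreal (f x powr p) * ennreal (u x) \<partial>lebesgue"
    have L: "?L = epowr ?I (1 / p)"
      using fg(3) by (simp add: Lp_norm_def epowr_ennreal)
    show "weak_Lp_norm q v (\<lambda>x. ennreal \<bar>g x\<bar>) \<le> ennreal C' * ?L"
    proof (cases ?L)
      case top
      with C' show ?thesis by (simp add: ennreal_mult_top)
    next
      case (real l)
      have "ennreal y * epowr (\<integral>\<^sup>+x\<in>{x. ennreal y < ennreal \<bar>g x\<bar>}. ennreal (v x) \<partial>lebesgue) (1 / q) \<le> ennreal C' * ?L"
        if y: "0 < y" for y
      proof -
        have eq: "{x. ennreal y < ennreal \<bar>g x\<bar>} = {x. y < g x}"
          using y fg(4) by (auto simp: ennreal_less_iff)
        have "ennreal y * epowr (\<integral>\<^sup>+x\<in>{x. y < g x}. ennreal (v x) \<partial>lebesgue) (1 / q) \<le> ennreal (C' * l)"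
        proof (rule ennreal_le_epsilon)
          fix e :: real assume e: "0 < e"
          \<comment> \<open>The level estimate requires \<open>A > 0\<close>, whereas the norm
            \<open>l\<close> may be 0. The increment \<open>e / C'\<close> costs exactly
            \<open>e\<close> in the conclusion.\<close>
          define A where "A = l + e / C'"
          have A: "0 < A" "l \<le> A" using real e C' by (auto simp: A_def add_nonneg_pos)
          have "epowr ?I (1 / p) \<le> ennreal A"
            using A(2) real L by (simp add: ennreal_leI)
          then have "?I \<le> ennreal (A powr p)"
            using p A(1) by (subst (asm) epowr_le_iff) (auto simp: epowr_ennreal)
          from main[OF pair A(1) y this]
          have "ennreal y * epowr (\<integral>\<^sup>+x\<in>{x. y < g x}. ennreal (v x) \<partial>lebesgue) (1 / q) \<le> ennreal (C' * A)" .
          also have "C' * A = C' * l + e" using C' by (simp add: A_def field_simps)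
          also have "ennreal (C' * l + e) = ennreal (C' * l) + ennreal e"
            using C' real e by (intro ennreal_plus) auto
          finally show "ennreal y * epowr (\<integral>\<^sup>+x\<in>{x. y < g x}. ennreal (v x) \<partial>lebesgue) (1 / q) \<le> ennreal (C' * l) + ennreal e" .
        qed
        also have "ennreal (C' * l) = ennreal C' * ?L"
          using C' real by (simp add: ennreal_mult)
        finally show ?thesis unfolding eq .
      qed
      then show ?thesis
        unfolding weak_Lp_norm_def by (intro SUP_least) auto
    qed
  qed
qed

end
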